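(* Let $\mathbb{K}$ be a field and let $R$ be a reduced standard graded $\mathbb{K}$-algebra whose minimal primes are the distinct primes $$\mathfrak{q}_1,\ldots,\mathfrak{q}_a,\mathfrak{p}_1,\ldots,\mathfrak{p}_b$$ ($a\ge1$, $b\ge0$), where $\dim(R/\mathfrak{q}_i)=\dim(R)$ for all $i$, $\dim(R/\mathfrak{p}_i)<\dim(R)$ for all $i$, and $\mathrm{e}(R/\mathfrak{q}_i)\le\mathrm{e}(R/\mathfrak{q}_j)$ for $i\le j$. Let $\ell\ge1$ be an integer and let $s_R(\ell)$ be the stabilization value of the generalized minimum distance function of $R$. 1. If $R$ is mixed and $\dim(R/\mathfrak{p}_j)\ge2$ for some $j$, then $s_R(\ell)=0$. 2. If $R$ is a domain, then $s_R(\ell)=\mathrm{e}(R)$. 3. If $R$ is unmixed and $\dim(R)\ge2$, then $s_R(\ell)=\mathrm{e}(R/\mathfrak{q}_1)$. 4. If $\dim(R)=1$ and $\ell\le\mathrm{e}(R)-\mathrm{e}(R/\mathfrak{q}_1)$, then $$s_R(\ell)=\min\Big\{\sum_{i\in\sigma}\mathrm{e}(R/\mathfrak{q}_i)\ \Big|\ \sigma\subsetneq\{1,\ldots,a\}\text{ and }\ell\le\sum_{i\in\sigma}\mathrm{e}(R/\mathfrak{q}_i)\Big\}.$$ 5. If $\dim(R)=1$ and $\ell>\mathrm{e}(R)-\mathrm{e}(R/\mathfrak{q}_1)$, then $s_R(\ell)=\mathrm{e}(R)$. 6. If $R$ is mixed, $\dim(R/\mathfrak{p}_j)=1$ for all $j$,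 and $\ell\le\mathrm{e}_T(T)$ where $T=R/\bigcap_{i=1}^b\mathfrak{p}_i$, then $s_R(\ell)=0$. 7. If $R$ is mixed, $\dim(R/\mathfrak{p}_j)=1$ for all $j$, and $\ell>\mathrm{e}_T(T)$ where $T=R/\bigcap_{i=1}^b\mathfrak{p}_i$, then $s_R(\ell)=\mathrm{e}(R/\mathfrak{q}_1)$.
   Context: A standard graded $\mathbb{K}$-algebra is a (commutative, Noetherian) graded ring $R=\bigoplus_{t\ge 0}R_t$ with $R_0=\mathbb{K}$, generated as a $\mathbb{K}$-algebra by finitely many elements of $R_1$. For a standard graded $\mathbb{K}$-algebra $A$ and a finitely generated graded $A$-module $M$, let $h_M(i)=\dim_{\mathbb{K}}[M]_i$ and let $$\mathrm{e}_A(M)=\lim_{t\to\infty}\frac{(\dim A)!\,\sum_{i\le t}h_M(i)}{t^{\dim A}}$$ be the Hilbert-Samuel multiplicity of $M$ as an $A$-module (so $\mathrm{e}_A(M)=0$ if $\dim(M)<\dim(A)$). Write $\mathrm{e}(M)=\mathrm{e}_R(M)$. The reduced algebra $R$ is unmixed if all its associated (equivalently, minimal) primes $\mathfrak{p}$ satisfy $\dim(R/\mathfrak{p})=\dim(R)$ (i.e. $b=0$), and mixed otherwise (i.e. $b\ge1$). For positive integers $t,\ell$, let $\mathcal{F}_{t,\ell}$ be the collection of sets $F=\{f_1,\ldots,f_\ell\}\subseteq R_t$ such that $f_1,\ldots,f_\ell$ are $\mathbb{K}$-linearly independent and $\mathrm{Ann}_R(F)=\{r\in R\mid rf_i=0\text{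 for all }i\}\neq 0$. The generalized minimum distance function of $R$ is $$\delta_R(t,\ell)=\begin{cases}\mathrm{e}(R)-\max\{\mathrm{e}(R/(F))\mid F\in\mathcal{F}_{t,\ell}\}&\text{if }\mathcal{F}_{t,\ell}\neq\varnothing,\\ \mathrm{e}(R)&\text{if }\mathcal{F}_{t,\ell}=\varnothing.\end{cases}$$ For reduced $R$ and fixed $\ell$, the function $t\mapsto\delta_R(t,\ell)$ is non-increasing and eventually constant; the stabilization value is $s_R(\ell)=\lim_{t\to\infty}\delta_R(t,\ell)$. *)

theory Defs
  imports
    Complex_Main
    "HOL-Library.Extended_Nat"
    "HOL-Algebra.QuotRing"
    "HOL-Algebra.Subrings"
    "HOL-Algebra.Generated_Rings"
    "HOL-Algebra.Ring_Divisibility"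
    "Jordan_Normal_Form.Missing_VectorSpace"
begin

text \<open>The family \<open>G\<close> is the grading, \<open>G t\<close> being the degree-\<open>t\<close> component. The ground field
  \<open>K\<close> is literally the subring \<open>G 0\<close> of \<open>R\<close>, so the \<open>K\<close>-algebra structure of \<open>R\<close> is
  multiplication in \<open>R\<close>.\<close>

locale standard_graded_algebra = cring R + noetherian_ring R
  for K :: "'a set" and R :: "('a, 'm) ring_scheme" (structure) and G :: "nat \<Rightarrow> 'a set" +
  assumes ground_field: "subfield K R"
    and degree_zero: "G 0 = K"
    and component_subgroup: "subgroup (G i) (add_monoid R)"
    and component_mult: "\<lbrakk> x \<in> G i; y \<in> G j \<rbrakk> \<Longrightarrow> x \<otimes> y \<in> G (i + j)"
    and direct_sum: "x \<in> carrier R \<Longrightarrow>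
      \<exists>!c. (\<forall>i. c i \<in> G i) \<and> finite {i. c i \<noteq> \<zero>} \<and> x = (\<Oplus>i\<in>{i. c i \<noteq> \<zero>}. c i)"
    and generated_in_degree_one:
      "\<exists>S. finite S \<and> S \<subseteq> G 1 \<and> generate_ring R (K \<union> S) = carrier R"

definition reduced_ring :: "('a, 'm) ring_scheme \<Rightarrow> bool" where
  "reduced_ring R \<longleftrightarrow>
     (\<forall>x\<in>carrier R. \<forall>n::nat. x [^]\<^bsub>R\<^esub> n = \<zero>\<^bsub>R\<^esub> \<longrightarrow> x = \<zero>\<^bsub>R\<^esub>)"

definition minimal_primes :: "('a, 'm) ring_scheme \<Rightarrow> 'a set set" where
  "minimal_primes R =
     {P. primeideal P R \<and> (\<forall>Q. primeideal Q R \<and> Q \<subseteq> P \<longrightarrow> Q = P)}"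

definition annihilator :: "('a, 'm) ring_scheme \<Rightarrow> 'a set \<Rightarrow> 'a set" where
  "annihilator R F = {r \<in> carrier R. \<forall>f\<in>F. r \<otimes>\<^bsub>R\<^esub> f = \<zero>\<^bsub>R\<^esub>}"

definition associated_primes :: "('a, 'm) ring_scheme \<Rightarrow> 'a set set" where
  "associated_primes R = {P. primeideal P R \<and> (\<exists>x\<in>carrier R. P = annihilator R {x})}"

text \<open>Supremum of the lengths of chains of prime ideals; for the zero ring this gives 0.\<close>

definition krull_dim :: "('a, 'm) ring_scheme \<Rightarrow> enat" where
  "krull_dim R = (SUP n \<in> {n. \<exists>P. (\<forall>i\<le>n. primeideal (P i) R) \<and> (\<forall>i<n. P i \<subset> P (Suc i))}. enat n)"

definition unmixed :: "('a, 'm) ring_scheme \<Rightarrow> bool" where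
  "unmixed R \<longleftrightarrow> (\<forall>P\<in>associated_primes R. krull_dim (R Quot P) = krull_dim R)"

abbreviation mixed :: "('a, 'm) ring_scheme \<Rightarrow> bool" where
  "mixed R \<equiv> \<not> unmixed R"

text \<open>\<open>A\<close> is a graded ring with components \<open>GA i\<close>, and \<open>M\<close> is a graded \<open>A\<close>-module with
  components \<open>GM i\<close>; each \<open>GM i\<close> is a vector space over the field \<open>GA 0\<close>.\<close>

definition hilbert_function ::
  "('a, 'm) ring_scheme \<Rightarrow> (nat \<Rightarrow> 'a set) \<Rightarrow> ('a, 'b, 'n) module_scheme \<Rightarrow> (nat \<Rightarrow> 'b set)
    \<Rightarrow> nat \<Rightarrow> nat" where
  "hilbert_function A GA M GM i =
     vectorspace.dim (A\<lparr>carrier := GA 0\<rparr>) (M\<lparr>carrier := GM i\<rparr>)"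

text \<open>The normalization uses the dimension of the ring \<open>A\<close>, not that of the module \<open>M\<close>.\<close>

definition hs_multiplicity ::
  "('a, 'm) ring_scheme \<Rightarrow> (nat \<Rightarrow> 'a set) \<Rightarrow> ('a, 'b, 'n) module_scheme \<Rightarrow> (nat \<Rightarrow> 'b set)
    \<Rightarrow> real" where
  "hs_multiplicity A GA M GM =
     (let d = the_enat (krull_dim A) in
      lim (\<lambda>t. fact d * (\<Sum>i\<le>t. real (hilbert_function A GA M GM i)) / real t ^ d))"

text \<open>The ring \<open>B\<close> as a module along a ring homomorphism \<open>\<phi>\<close> into \<open>B\<close>.\<close>

definition module_along :: "('a \<Rightarrow> 'b) \<Rightarrow> ('b, 'm) ring_scheme \<Rightarrow> ('a, 'b) module" where
  "module_along \<phi> B =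
     \<lparr>carrier = carrier B, monoid.mult = monoid.mult B, one = \<one>\<^bsub>B\<^esub>,
      zero = \<zero>\<^bsub>B\<^esub>, add = ring.add B,
      smult = (\<lambda>a b. \<phi> a \<otimes>\<^bsub>B\<^esub> b)\<rparr>"

definition self_module :: "('a, 'm) ring_scheme \<Rightarrow> ('a, 'a) module" where
  "self_module A = module_along (\<lambda>x. x) A"

definition quotient_module :: "('a, 'm) ring_scheme \<Rightarrow> 'a set \<Rightarrow> ('a, 'a set) module" where
  "quotient_module R I = module_along (\<lambda>a. I +>\<^bsub>R\<^esub> a) (R Quot I)"

definition quotient_grading ::
  "('a, 'm) ring_scheme \<Rightarrow> (nat \<Rightarrow> 'a set) \<Rightarrow> 'a set \<Rightarrow> nat \<Rightarrow> 'a set set" where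
  "quotient_grading R G I i = (\<lambda>x. I +>\<^bsub>R\<^esub> x) ` G i"

text \<open>\<open>e_ring A G\<close> is the multiplicity of \<open>A\<close> over itself; \<open>e_quot R G I\<close> is the multiplicity
  of the quotient by \<open>I\<close> as a module over \<open>R\<close> (so it is 0 when the quotient has smaller
  dimension), in contrast to \<open>e_ring (R Quot I) (quotient_grading R G I)\<close>.\<close>

definition e_ring :: "('a, 'm) ring_scheme \<Rightarrow> (nat \<Rightarrow> 'a set) \<Rightarrow> real" where
  "e_ring A G = hs_multiplicity A G (self_module A) G"

definition e_quot :: "('a, 'm) ring_scheme \<Rightarrow> (nat \<Rightarrow> 'a set) \<Rightarrow> 'a set \<Rightarrow> real" where
  "e_quot R G I = hs_multiplicity R G (quotient_module R I) (quotient_grading R G I)"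

definition gmd_family ::
  "('a, 'm) ring_scheme \<Rightarrow> (nat \<Rightarrow> 'a set) \<Rightarrow> nat \<Rightarrow> nat \<Rightarrow> 'a set set" where
  "gmd_family R G t l =
     {F. F \<subseteq> G t \<and> finite F \<and> card F = l
         \<and> \<not> module.lin_dep (R\<lparr>carrier := G 0\<rparr>) (self_module R) F
         \<and> annihilator R F \<noteq> {\<zero>\<^bsub>R\<^esub>}}"

text \<open>The set under \<open>Max\<close> may be indexed by infinitely many \<open>F\<close>, but its elements are
  integers between 0 and the multiplicity of \<open>R\<close>, so it is finite.\<close>

definition gmd ::
  "('a, 'm) ring_scheme \<Rightarrow> (nat \<Rightarrow> 'a set) \<Rightarrow> nat \<Rightarrow> nat \<Rightarrow> real" where
  "gmd R G t l =
     (if gmd_family R G t l = {} then e_ring R G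
      else e_ring R G - Max {e_quot R G (Idl\<^bsub>R\<^esub> F) | F. F \<in> gmd_family R G t l})"

definition gmd_stable :: "('a, 'm) ring_scheme \<Rightarrow> (nat \<Rightarrow> 'a set) \<Rightarrow> nat \<Rightarrow> real" where
  "gmd_stable R G l = lim (\<lambda>t. gmd R G t l)"

end

theory Submission
  imports Defs
begin

text \<open>All dimensions are those of \<open>K\<close>-subspaces of \<open>R\<close>. A homogeneous ideal \<open>I\<close> has a filtration by
  shifted quotients \<open>R/Q\<close> with \<open>Q\<close> a homogeneous prime, obtained from maximal colon ideals. Cutting a
  homogeneous prime \<open>P\<close> by a linear form \<open>x \<notin> P\<close> turns the Hilbert function of \<open>R/P\<close> into the summed
  Hilbert function of \<open>R/(P + xR)\<close>, so Noetherian induction shows that the summed Hilbert function of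
  \<open>R/P\<close> grows like \<open>c t^e\<close> with \<open>c > 0\<close>. A strict inclusion of primes, homogeneous or not, lowers the
  growth exponent, so \<open>e\<close> is the Krull dimension of \<open>R/P\<close>.

  When \<open>R\<close> is reduced, every minimal prime \<open>P\<close> has a homogeneous separator \<open>f\<close> lying in all the other
  minimal primes, with annihilator \<open>P\<close>. The submodules \<open>f R \<cong> R/P\<close> are independent, which makes the
  multiplicity of \<open>R/J\<close> the sum of those of the \<open>R/P\<close> over the top-dimensional minimal \<open>P \<supseteq> J\<close>. A
  family \<open>F\<close> has a nonzero annihilator iff it lies in some minimal prime; it then contributes to
  \<open>\<delta>\<close> the sum of the \<open>e(R/P)\<close> over the \<open>P\<close> not containing it, and such a family exists for large \<open>t\<close>
  on a given set of primes as soon as the separators of these primes leave room for \<open>\<ell>\<close> independent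
  elements.\<close>

section \<open>Dimensions of subspaces\<close>

text \<open>No Hilbert polynomial is constructed. Every multiplicity is read off a limit, because
  limits ignore degree shifts and can be squeezed. This is what makes separators usable: they have
  no common degree, so the embedded copies of the \<open>R/P\<close> give only inequalities in a
  single degree, and equality appears asymptotically.

  The case split of the theorem reflects how Hilbert functions of primes behave. In dimension at
  least 2 the Hilbert function of \<open>R/P\<close> is unbounded, so one component alone carries
  \<open>l\<close> independent forms in every large degree. In dimension 1 it rises to the
  multiplicity and stays there, so a set of components carries at most the sum of its multiplicities
  in every degree, and exactly that many in large degrees; this is where the thresholds for
  \<open>l\<close> come from. Components of smaller dimension have weight 0 in the multiplicity of
  \<open>R\<close>, so a family living on them alone brings the distance down to 0.\<close>

definition (in vectorspace) sdim :: "'c set \<Rightarrow> nat" where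
  "sdim W = vectorspace.dim K (vs W)"

definition (in vectorspace) sfin :: "'c set \<Rightarrow> bool" where
  "sfin W \<longleftrightarrow> vectorspace.fin_dim K (vs W)"

context vectorspace
begin

lemma subspaceD:
  assumes "subspace K W V"
  shows "W \<subseteq> carrier V" "\<zero>\<^bsub>V\<^esub> \<in> W" "\<And>v w. v \<in> W \<Longrightarrow> w \<in> W \<Longrightarrow> v \<oplus>\<^bsub>V\<^esub> w \<in> W"
    "\<And>c v. c \<in> carrier K \<Longrightarrow> v \<in> W \<Longrightarrow> c \<odot>\<^bsub>V\<^esub> v \<in> W"
proof -
  have s: "submodule K W V" using assms by (rule is_module)
  show "W \<subseteq> carrier V" "\<zero>\<^bsub>V\<^esub> \<in> W" "\<And>v w. v \<in> W \<Longrightarrow> w \<in> W \<Longrightarrow> v \<oplus>\<^bsub>V\<^esub> w \<in> W"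
    "\<And>c v. c \<in> carrier K \<Longrightarrow> v \<in> W \<Longrightarrow> c \<odot>\<^bsub>V\<^esub> v \<in> W"
    using submodule.subset[OF s] submodule.zero_closed[OF s] submodule.m_closed[OF s]
      submodule.smult_closed[OF s] by auto
qed

lemma subspaceI:
  assumes "W \<subseteq> carrier V" "\<zero>\<^bsub>V\<^esub> \<in> W" "\<And>v w. v \<in> W \<Longrightarrow> w \<in> W \<Longrightarrow> v \<oplus>\<^bsub>V\<^esub> w \<in> W"
    "\<And>c v. c \<in> carrier K \<Longrightarrow> v \<in> W \<Longrightarrow> c \<odot>\<^bsub>V\<^esub> v \<in> W"
  shows "subspace K W V"
  by (intro subspace.intro submodule.intro vectorspace_axioms module_axioms assms)

lemma subspace_Int:
  assumes "subspace K A V" "subspace K B V"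
  shows "subspace K (A \<inter> B) V"
  using subspaceD[OF assms(1)] subspaceD[OF assms(2)] by (intro subspaceI) auto

lemma subspace_relative:
  assumes "subspace K W V" "subspace K U V" "U \<subseteq> W"
  shows "subspace K U (vs W)"
proof -
  interpret W: vectorspace K "vs W" by (rule subspace_is_vs[OF assms(1)])
  show ?thesis using subspaceD[OF assms(2)] assms(3) by (intro W.subspaceI) auto
qed

text \<open>Independence does not depend on the ambient space, so independent subsets of
  \<open>U\<close> have at most \<open>sdim W\<close> elements, and a maximal one is a basis of
  \<open>U\<close>.\<close>

lemma sfin_subspace:
  assumes W: "subspace K W V" and U: "subspace K U V" and UW: "U \<subseteq> W" and f: "sfin W"
  shows "sfin U" "sdim U \<le> sdim W"
proof -
  interpret W: vectorspace K "vs W" by (rule subspace_is_vs[OF W])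
  interpret U: vectorspace K "vs U" by (rule subspace_is_vs[OF U])
  have fd: W.fin_dim using f by (simp add: sfin_def)
  have UsW: "submodule K U (vs W)" by (rule W.is_module[OF subspace_relative[OF W U UW]])
  have lin: "W.lin_indpt A" if "A \<subseteq> U" "U.lin_indpt A" for A
    using W.span_li_not_depend(2)[OF that(1) UsW] that(2) by simp
  let ?P = "\<lambda>A. A \<subseteq> carrier (vs U) \<and> U.lin_indpt A"
  have bd: "finite A \<and> card A \<le> W.dim" if "?P A" for A
    using W.li_le_dim[OF fd, of A] lin that UW by auto
  have "?P {}" by (simp add: U.lin_dep_def)
  from maximal_exists[of ?P W.dim, OF bd this]
  have "\<exists>A. finite A \<and> maximal A ?P" by simp
  then obtain A where A: "finite A" "maximal A ?P" by blast
  then have bas: "U.basis A" using U.max_li_is_basis by blast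
  then have "U.fin_dim" unfolding U.fin_dim_def U.basis_def using A by blast
  then show "sfin U" by (simp add: sfin_def)
  have "U.dim = card A" using U.dim_basis[OF A(1) bas] .
  moreover have "card A \<le> W.dim" using bd A(2) unfolding maximal_def by blast
  ultimately show "sdim U \<le> sdim W" by (simp add: sdim_def)
qed

lemma sfin_zero: "sfin {\<zero>\<^bsub>V\<^esub>}" "sdim {\<zero>\<^bsub>V\<^esub>} = 0" "subspace K {\<zero>\<^bsub>V\<^esub>} V"
proof -
  show s: "subspace K {\<zero>\<^bsub>V\<^esub>} V" by (rule subspaceI) auto
  interpret U: vectorspace K "vs {\<zero>\<^bsub>V\<^esub>}" by (rule subspace_is_vs[OF s])
  have sp: "U.span {} = {\<zero>\<^bsub>V\<^esub>}" using U.span_empty by simp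
  then show "sfin {\<zero>\<^bsub>V\<^esub>}" by (auto simp: sfin_def U.fin_dim_def intro!: exI[of _ "{}"])
  have "U.dim \<le> card ({} :: 'c set)" by (rule U.gen_ge_dim) (use sp in auto)
  then show "sdim {\<zero>\<^bsub>V\<^esub>} = 0" by (simp add: sdim_def)
qed

lemma sdim_indep:
  assumes W: "subspace K W V" and f: "sfin W" and A: "A \<subseteq> W" "lin_indpt A"
  shows "card A \<le> sdim W"
proof -
  interpret W: vectorspace K "vs W" by (rule subspace_is_vs[OF W])
  have "W.lin_indpt A" using span_li_not_depend(2)[OF A(1)] W A(2) by auto
  then show ?thesis using W.li_le_dim(2)[of A] f A(1) by (simp add: sfin_def sdim_def)
qed

lemma exists_indep_subset:
  assumes W: "subspace K W V" and f: "sfin W" and n: "n \<le> sdim W"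
  shows "\<exists>A\<subseteq>W. finite A \<and> card A = n \<and> lin_indpt A"
proof -
  interpret W: vectorspace K "vs W" by (rule subspace_is_vs[OF W])
  obtain B where B: "finite B" "W.basis B" using W.finite_basis_exists f by (auto simp: sfin_def)
  have "card B = sdim W" using W.dim_basis[OF B] by (simp add: sdim_def)
  then obtain A where A: "A \<subseteq> B" "card A = n"
    using n obtain_subset_with_card_n[of n B] by auto
  have BW: "B \<subseteq> W" "W.lin_indpt B" using B(2) by (auto simp: W.basis_def)
  have "lin_indpt B" using span_li_not_depend(2)[OF BW(1)] W BW(2) by auto
  then have "lin_indpt A" using subset_li_is_li A(1) by blast
  moreover have "finite A" using finite_subset[OF A(1) B(1)] .
  moreover have "A \<subseteq> W" using A(1) BW(1) by simp
  ultimately show ?thesis using A(2) by (intro exI[of _ A]) simp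
qed

lemma sdim_pos:
  assumes W: "subspace K W V" and f: "sfin W" and x: "x \<in> W" "x \<noteq> \<zero>\<^bsub>V\<^esub>"
  shows "sdim W > 0"
proof -
  have "lin_indpt {x}"
  proof
    assume "lin_dep {x}"
    have xc: "x \<in> carrier V" using x(1) subspaceD(1)[OF W] by blast
    obtain a v where a: "a \<in> {x} \<rightarrow> carrier K" "lincomb a {x} = \<zero>\<^bsub>V\<^esub>" "v \<in> {x}" "a v \<noteq> \<zero>\<^bsub>K\<^esub>"
      using finite_lin_dep[OF _ \<open>lin_dep {x}\<close>] xc by auto
    have "a x \<odot>\<^bsub>V\<^esub> x = \<zero>\<^bsub>V\<^esub>" using a xc by (simp add: lincomb_def)
    then have "x = (inv\<^bsub>K\<^esub> (a x)) \<odot>\<^bsub>V\<^esub> \<zero>\<^bsub>V\<^esub>" using mult_inverse[of "a x" x "\<zero>\<^bsub>V\<^esub>"] a xc by auto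
    moreover have "inv\<^bsub>K\<^esub> (a x) \<in> carrier K" using a field_Units
      by (auto simp: Pi_def)
    ultimately show False using x(2) by simp
  qed
  from sdim_indep[OF W f _ this] x(1) show ?thesis by simp
qed

lemma sfin_span:
  assumes "finite A" "A \<subseteq> carrier V"
  shows "sfin (span A)"
proof -
  have s: "subspace K (span A) V" by (rule span_is_subspace[OF assms(2)])
  interpret W: vectorspace K "vs (span A)" by (rule subspace_is_vs[OF s])
  have "A \<subseteq> span A" using in_own_span assms by blast
  then have "W.span A = span A" using span_li_not_depend(1)[of A "span A"] s by auto
  then show ?thesis unfolding sfin_def W.fin_dim_def using \<open>A \<subseteq> span A\<close> assms by auto
qed

end

lemma linear_map_restrict:
  assumes "linear_map K V W T" "subspace K U V"
  shows "linear_map K (V\<lparr>carrier := U\<rparr>) W T"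
proof -
  interpret linear_map K V W T by fact
  interpret U: vectorspace K "V\<lparr>carrier := U\<rparr>" by (rule V.subspace_is_vs[OF assms(2)])
  have sub: "U \<subseteq> carrier V" by (rule V.subspaceD(1)[OF assms(2)])
  show ?thesis
    by (intro linear_map.intro mod_hom.intro mod_hom_axioms.intro U.vectorspace_axioms
        W.vectorspace_axioms U.module.module_axioms W.module.module_axioms)
      (use f_hom sub in \<open>auto simp: module_hom_def Pi_def subset_iff\<close>)
qed

text \<open>Rank-nullity for the restriction to \<open>U\<close>, in additive form to avoid
  subtraction of natural numbers.\<close>

lemma linear_image_dim:
  assumes "linear_map K V W T" "subspace K U V" "vectorspace.sfin K V U"
  shows "vectorspace.sdim K W (T ` U) + vectorspace.sdim K V {u \<in> U. T u = \<zero>\<^bsub>W\<^esub>}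
           = vectorspace.sdim K V U"
    and "vectorspace.sfin K W (T ` U)" and "subspace K (T ` U) W"
proof -
  interpret linear_map K V W T by fact
  interpret U: linear_map K "V\<lparr>carrier := U\<rparr>" W T by (rule linear_map_restrict[OF assms(1,2)])
  have fd: "U.V.fin_dim" using assms(3) by (simp add: V.sfin_def)
  have im: "U.im = T ` U" by (simp add: U.im_def)
  show s: "subspace K (T ` U) W" using U.imT_is_subspace im by simp
  have ker: "U.ker = {u \<in> U. T u = \<zero>\<^bsub>W\<^esub>}" by (simp add: U.ker_def)
  show "vectorspace.sdim K W (T ` U) + vectorspace.sdim K V {u \<in> U. T u = \<zero>\<^bsub>W\<^esub>}
           = vectorspace.sdim K V U"
    using U.rank_nullity[OF fd] by (simp add: im ker V.sdim_def W.sdim_def)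
  interpret TU: vectorspace K "W\<lparr>carrier := T ` U\<rparr>" by (rule W.subspace_is_vs[OF s])
  \<comment> \<open>With the image as codomain the map is onto, so finite dimension passes to
    it.\<close>
  have "linear_map K (V\<lparr>carrier := U\<rparr>) (W\<lparr>carrier := T ` U\<rparr>) T"
    by (intro linear_map.intro mod_hom.intro mod_hom_axioms.intro U.V.vectorspace_axioms
        TU.vectorspace_axioms U.V.module.module_axioms TU.module.module_axioms)
      (use U.f_hom in \<open>auto simp: module_hom_def\<close>)
  from linear_map.rank_nullity_main(2)[OF this fd]
  have "TU.fin_dim" by simp
  then show "vectorspace.sfin K W (T ` U)" by (simp add: W.sfin_def)
qed

context vectorspace
begin

lemma sdim_whole: "dim = sdim (carrier V)" "fin_dim \<longleftrightarrow> sfin (carrier V)"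
  "subspace K (carrier V) V"
  by (auto simp: sdim_def sfin_def intro!: subspaceI)

text \<open>Addition maps the external direct sum of \<open>A\<close> and \<open>B\<close> onto
  their sum, and its kernel is a copy of the intersection.\<close>

lemma sdim_sum:
  assumes A: "subspace K A V" "sfin A" and B: "subspace K B V" "sfin B"
  shows "sdim (subspace_sum A B) + sdim (A \<inter> B) = sdim A + sdim B"
    and "sfin (subspace_sum A B)"
proof -
  interpret VA: vectorspace K "vs A" by (rule subspace_is_vs[OF A(1)])
  interpret VB: vectorspace K "vs B" by (rule subspace_is_vs[OF B(1)])
  let ?D = "direct_sum (vs A) (vs B)"
  let ?i1 = "\<lambda>v. (v, \<zero>\<^bsub>V\<^esub>)" and ?i2 = "\<lambda>v. (\<zero>\<^bsub>V\<^esub>, v)"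
  interpret D: vectorspace K ?D by (rule direct_sum_is_vs) unfold_locales
  have Ac: "A \<subseteq> carrier V" and Bc: "B \<subseteq> carrier V" using subspaceD(1) A B by auto
  have i1: "linear_map K (vs A) ?D ?i1"
    by (intro linear_map.intro mod_hom.intro mod_hom_axioms.intro D.vectorspace_axioms
        VA.vectorspace_axioms D.module.module_axioms VA.module.module_axioms)
      (use subspaceD(2)[OF A(1)] subspaceD(2)[OF B(1)] in \<open>auto simp: module_hom_def direct_sum_def\<close>)
  have i2: "linear_map K (vs B) ?D ?i2"
    by (intro linear_map.intro mod_hom.intro mod_hom_axioms.intro D.vectorspace_axioms
        VB.vectorspace_axioms D.module.module_axioms VB.module.module_axioms)
      (use subspaceD(2)[OF A(1)] subspaceD(2)[OF B(1)] in \<open>auto simp: module_hom_def direct_sum_def\<close>)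
  have sA: "subspace K A (vs A)" using VA.sdim_whole(3) by simp
  have sB: "subspace K B (vs B)" using VB.sdim_whole(3) by simp
  have fA: "VA.sfin A" "VA.sdim A = sdim A" using A by (simp_all add: sfin_def VA.sfin_def sdim_def VA.sdim_def)
  have fB: "VB.sfin B" "VB.sdim B = sdim B" using B by (simp_all add: sfin_def VB.sfin_def sdim_def VB.sdim_def)
  let ?A' = "?i1 ` A" and ?B' = "?i2 ` B"
  note I1 = linear_image_dim[OF i1 sA fA(1)] and I2 = linear_image_dim[OF i2 sB fB(1)]
  have kB: "{u \<in> B. ?i2 u = \<zero>\<^bsub>?D\<^esub>} = {\<zero>\<^bsub>V\<^esub>}"
    using subspaceD(2)[OF B(1)] by (auto simp: direct_sum_def)
  have dB: "D.sdim ?B' = sdim B" using I2(1) VB.sfin_zero(2) fB unfolding kB by simp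
  have gen: "D.subspace_sum ?A' ?B' = carrier ?D"
  proof -
    have "(x, y) \<in> D.subspace_sum ?A' ?B'" if "x \<in> A" "y \<in> B" for x y
      unfolding D.submodule_sum_def
      by (rule image_eqI[of _ _ "((x, \<zero>\<^bsub>V\<^esub>), (\<zero>\<^bsub>V\<^esub>, y))"])
        (use that Ac Bc in \<open>auto simp: direct_sum_def\<close>)
    moreover have "D.subspace_sum ?A' ?B' \<subseteq> carrier ?D"
      using D.subspaceD(1)[OF D.sum_is_subspace[OF I1(3) I2(3)]] .
    ultimately show ?thesis by (auto simp: direct_sum_def)
  qed
  have finD: "D.sfin (carrier ?D)"
  proof -
    interpret A': vectorspace K "D.vs ?A'" by (rule D.subspace_is_vs[OF I1(3)])
    interpret B': vectorspace K "D.vs ?B'" by (rule D.subspace_is_vs[OF I2(3)])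
    obtain X where X: "finite X" "X \<subseteq> ?A'" "A'.span X = ?A'"
      using I1(2) by (auto simp: D.sfin_def A'.fin_dim_def)
    obtain Y where Y: "finite Y" "Y \<subseteq> ?B'" "B'.span Y = ?B'"
      using I2(2) by (auto simp: D.sfin_def B'.fin_dim_def)
    have X': "D.span X = ?A'" using D.span_li_not_depend(1)[OF X(2)] I1(3) X(3) by auto
    have Y': "D.span Y = ?B'" using D.span_li_not_depend(1)[OF Y(2)] I2(3) Y(3) by auto
    have XY: "X \<subseteq> carrier ?D" "Y \<subseteq> carrier ?D"
      using X(2) Y(2) D.subspaceD(1)[OF I1(3)] D.subspaceD(1)[OF I2(3)] by auto
    have "D.span (X \<union> Y) = carrier ?D" using D.span_union_is_sum[OF XY] X' Y' gen by simp
    then show ?thesis using D.sfin_span[of "X \<union> Y"] X(1) Y(1) XY by auto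
  qed
  \<comment> \<open>\<open>fst\<close> is used twice: on the whole direct sum, where its kernel is
    the copy of \<open>B\<close>, and on the kernel of addition, where it is injective.\<close>
  have fstl: "linear_map K ?D V fst"
    by (intro linear_map.intro mod_hom.intro mod_hom_axioms.intro D.vectorspace_axioms
        vectorspace_axioms D.module.module_axioms module.module_axioms)
      (use Ac in \<open>auto simp: module_hom_def direct_sum_def\<close>)
  have "fst ` carrier ?D = A" using subspaceD(2)[OF B(1)] by (force simp: direct_sum_def)
  moreover have "{u \<in> carrier ?D. fst u = \<zero>\<^bsub>V\<^esub>} = ?B'"
    using subspaceD(2)[OF A(1)] by (auto simp: direct_sum_def)
  ultimately have dD: "sdim A + sdim B = D.sdim (carrier ?D)"
    using linear_image_dim(1)[OF fstl D.sdim_whole(3) finD] dB by simp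
  note L = sum_map_linear[OF A(1) B(1)]
  let ?f = "\<lambda>v. fst v \<oplus>\<^bsub>V\<^esub> snd v"
  have im: "?f ` carrier ?D = subspace_sum A B"
    by (auto simp: submodule_sum_def direct_sum_def image_def)
  note J = linear_image_dim[OF L D.sdim_whole(3) finD]
  show "sfin (subspace_sum A B)" using J(2) im by simp
  let ?k = "{u \<in> carrier ?D. ?f u = \<zero>\<^bsub>V\<^esub>}"
  interpret L: linear_map K ?D V ?f by (rule L)
  have ks: "subspace K ?k ?D" using L.kerT_is_subspace by (simp add: L.ker_def)
  have kf: "D.sfin ?k" using D.sfin_subspace(1)[OF D.sdim_whole(3) ks _ finD] by auto
  \<comment> \<open>The kernel of addition consists of the pairs of an \<open>x\<close> and its
    negative.\<close>
  have "fst ` ?k = A \<inter> B"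
  proof (intro equalityI subsetI)
    fix x assume "x \<in> fst ` ?k"
    then obtain y where y: "x \<in> A" "y \<in> B" "x \<oplus>\<^bsub>V\<^esub> y = \<zero>\<^bsub>V\<^esub>" by (auto simp: direct_sum_def)
    then have "x = \<ominus>\<^bsub>V\<^esub> y"
      using M.minus_equality[of x y] Ac Bc by (auto simp: subset_iff)
    also have "\<dots> = (\<ominus>\<^bsub>K\<^esub> \<one>\<^bsub>K\<^esub>) \<odot>\<^bsub>V\<^esub> y" using y Bc smult_l_minus[of "\<one>\<^bsub>K\<^esub>" y] by auto
    also have "\<dots> \<in> B" using subspaceD(4)[OF B(1) _ y(2)] by auto
    finally show "x \<in> A \<inter> B" using y by simp
  next
    fix x assume x: "x \<in> A \<inter> B"
    have "\<ominus>\<^bsub>V\<^esub> x = (\<ominus>\<^bsub>K\<^esub> \<one>\<^bsub>K\<^esub>) \<odot>\<^bsub>V\<^esub> x" using x Bc smult_l_minus[of "\<one>\<^bsub>K\<^esub>" x] by auto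
    also have "\<dots> \<in> B" using subspaceD(4)[OF B(1)] x by auto
    finally have "(x, \<ominus>\<^bsub>V\<^esub> x) \<in> ?k" using x Ac by (auto simp: direct_sum_def M.r_neg)
    then show "x \<in> fst ` ?k" by force
  qed
  moreover have "{u \<in> ?k. fst u = \<zero>\<^bsub>V\<^esub>} = {\<zero>\<^bsub>?D\<^esub>}"
    using subspaceD(2)[OF A(1)] subspaceD(2)[OF B(1)] Bc by (auto simp: direct_sum_def)
  ultimately have "sdim (A \<inter> B) = D.sdim ?k"
    using linear_image_dim(1)[OF fstl ks kf] D.sfin_zero(2) by simp
  then show "sdim (subspace_sum A B) + sdim (A \<inter> B) = sdim A + sdim B"
    using J(1) dD im by simp
qed

end

section \<open>Graded rings\<close>

lemma self_module_simps [simp]: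
  "carrier (self_module A) = carrier A" "zero (self_module A) = zero A"
  "add (self_module A) = add A" "smult (self_module A) = monoid.mult A"
  by (auto simp: self_module_def module_along_def)

lemma (in abelian_monoid) finsum_mem:
  assumes "\<zero> \<in> W" "W \<subseteq> carrier G" "\<And>x y. x \<in> W \<Longrightarrow> y \<in> W \<Longrightarrow> x \<oplus> y \<in> W"
    and "\<And>i. i \<in> A \<Longrightarrow> f i \<in> W"
  shows "(\<Oplus>i\<in>A. f i) \<in> W"
  using assms(4)
proof (induction A rule: infinite_finite_induct)
  case (insert i A)
  then have "f i \<in> W" "(\<Oplus>i\<in>A. f i) \<in> W" by auto
  moreover have "(\<Oplus>i\<in>insert i A. f i) = f i \<oplus> (\<Oplus>i\<in>A. f i)"
    using insert assms(2) by (intro finsum_insert) auto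
  ultimately show ?case using assms(3) by simp
qed (use assms(1) in \<open>auto simp: finsum_infinite\<close>)

lemma (in abelian_monoid) finsum_superset:
  assumes "finite B" "A \<subseteq> B" "\<And>i. i \<in> A \<Longrightarrow> f i \<in> carrier G" "\<And>i. i \<in> B - A \<Longrightarrow> f i = \<zero>"
  shows "(\<Oplus>i\<in>B. f i) = (\<Oplus>i\<in>A. f i)"
proof -
  have c: "f \<in> B \<rightarrow> carrier G" using assms(3,4) by force
  have "(\<Oplus>i\<in>A \<union> (B - A). f i) = (\<Oplus>i\<in>A. f i) \<oplus> (\<Oplus>i\<in>B - A. f i)"
    using assms(1,2) c by (intro finsum_Un_disjoint) (auto dest: finite_subset)
  moreover have "(\<Oplus>i\<in>B - A. f i) = \<zero>"
    by (rule add.finprod_one_eqI) (use assms(4) in auto)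
  moreover have "A \<union> (B - A) = B" using assms(2) by auto
  moreover have "(\<Oplus>i\<in>A. f i) \<in> carrier G" using assms(2,3) by (intro finsum_closed) auto
  ultimately show ?thesis by simp
qed

text \<open>The union of a nonempty chain of ideals is a member of the chain, so Zorn applies to any
  nonempty set of ideals, closed under unions or not.\<close>

lemma (in noetherian_ring) exists_maximal_ideal_in:
  assumes "\<A> \<noteq> {}" "\<And>I. I \<in> \<A> \<Longrightarrow> ideal I R"
  shows "\<exists>M\<in>\<A>. \<forall>X\<in>\<A>. M \<subseteq> X \<longrightarrow> X = M"
proof (rule subset_Zorn_nonempty[OF assms(1)])
  fix C assume C: "C \<noteq> {}" "subset.chain \<A> C"
  then have "subset.chain {I. ideal I R} C" using assms(2) by (auto simp: subset_chain_def)
  from ideal_chain_is_trivial[OF C(1) this] show "\<Union>C \<in> \<A>"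
    using C(2) by (auto simp: subset_chain_def)
qed

lemma (in noetherian_ring) noetherian_induct [consumes 1, case_names step]:
  assumes I: "ideal I R"
    and step: "\<And>I. ideal I R \<Longrightarrow> (\<And>J. ideal J R \<Longrightarrow> I \<subset> J \<Longrightarrow> P J) \<Longrightarrow> P I"
  shows "P I"
proof (rule ccontr)
  assume "\<not> P I"
  then have ne: "{J. ideal J R \<and> \<not> P J} \<noteq> {}" using I by blast
  from exists_maximal_ideal_in[OF ne] obtain M where
    M: "ideal M R" "\<not> P M" "\<And>X. ideal X R \<Longrightarrow> \<not> P X \<Longrightarrow> M \<subseteq> X \<Longrightarrow> X = M"
    by auto
  have "P M" by (rule step[OF M(1)]) (use M(3) in blast)
  with M(2) show False by simp
qed

context standard_graded_algebra
begin

abbreviation KF where "KF \<equiv> R\<lparr>carrier := K\<rparr>"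

lemma K_props: "K \<subseteq> carrier R" "\<one> \<in> K" "\<zero> \<in> K" "\<And>x y. x \<in> K \<Longrightarrow> y \<in> K \<Longrightarrow> x \<otimes> y \<in> K"
  "\<And>x y. x \<in> K \<Longrightarrow> y \<in> K \<Longrightarrow> x \<oplus> y \<in> K" "\<And>x. x \<in> K \<Longrightarrow> \<ominus> x \<in> K" "\<one> \<noteq> \<zero>" "field KF"
proof -
  have sr: "subring K R" by (intro subdomainE(1) subfieldE(1) ground_field)
  show "K \<subseteq> carrier R" "\<one> \<in> K" "\<zero> \<in> K" "\<And>x y. x \<in> K \<Longrightarrow> y \<in> K \<Longrightarrow> x \<otimes> y \<in> K"
  "\<And>x y. x \<in> K \<Longrightarrow> y \<in> K \<Longrightarrow> x \<oplus> y \<in> K" "\<And>x. x \<in> K \<Longrightarrow> \<ominus> x \<in> K"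
    using subringE[OF sr] by auto
  show "\<one> \<noteq> \<zero>" using subfieldE(6)[OF ground_field] .
  show "field KF" by (rule subfield_iff(2)[OF ground_field])
qed

lemma self_vectorspace: "vectorspace KF (self_module R)"
proof (rule vs_criteria[OF K_props(8)])
  show "\<forall>v\<in>carrier (self_module R). \<exists>neg_v\<in>carrier (self_module R).
      v \<oplus>\<^bsub>self_module R\<^esub> neg_v = \<zero>\<^bsub>self_module R\<^esub>"
  proof
    fix v assume "v \<in> carrier (self_module R)"
    then show "\<exists>neg_v\<in>carrier (self_module R). v \<oplus>\<^bsub>self_module R\<^esub> neg_v = \<zero>\<^bsub>self_module R\<^esub>"
      by (intro bexI[of _ "\<ominus> v"]) (auto simp: r_neg)
  qed
qed (use K_props(1) in \<open>auto simp: subset_iff a_ac m_ac l_distr r_distr\<close>)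

sublocale V: vectorspace KF "self_module R" by (rule self_vectorspace)

abbreviation sub where "sub W \<equiv> subspace KF W (self_module R)"
abbreviation dm where "dm \<equiv> V.sdim"
abbreviation fin where "fin \<equiv> V.sfin"

lemma subI:
  assumes "W \<subseteq> carrier R" "\<zero> \<in> W" "\<And>v w. v \<in> W \<Longrightarrow> w \<in> W \<Longrightarrow> v \<oplus> w \<in> W"
    "\<And>c v. c \<in> K \<Longrightarrow> v \<in> W \<Longrightarrow> c \<otimes> v \<in> W"
  shows "sub W"
  by (rule V.subspaceI) (use assms in auto)

lemma subD:
  assumes "sub W"
  shows "W \<subseteq> carrier R" "\<zero> \<in> W" "\<And>v w. v \<in> W \<Longrightarrow> w \<in> W \<Longrightarrow> v \<oplus> w \<in> W"
    "\<And>c v. c \<in> K \<Longrightarrow> v \<in> W \<Longrightarrow> c \<otimes> v \<in> W" "\<And>v. v \<in> W \<Longrightarrow> \<ominus> v \<in> W"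
    "\<And>v w. v \<in> W \<Longrightarrow> w \<in> W \<Longrightarrow> v \<ominus> w \<in> W"
proof -
  show 1: "W \<subseteq> carrier R" "\<zero> \<in> W" "\<And>v w. v \<in> W \<Longrightarrow> w \<in> W \<Longrightarrow> v \<oplus> w \<in> W"
    "\<And>c v. c \<in> K \<Longrightarrow> v \<in> W \<Longrightarrow> c \<otimes> v \<in> W"
    using V.subspaceD[OF assms] by auto
  show 2: "\<ominus> v \<in> W" if "v \<in> W" for v
    using 1(4)[of "\<ominus> \<one>" v] K_props(2,6) that 1(1) by (auto simp: l_minus subset_iff)
  show "v \<ominus> w \<in> W" if "v \<in> W" "w \<in> W" for v w
    using 1(3) 2 that by (simp add: a_minus_def)
qed

lemma sub_G: "sub (G i)"
proof (rule subI)
  note s = component_subgroup[of i]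
  show "G i \<subseteq> carrier R" using subgroup.subset[OF s] by simp
  show "\<zero> \<in> G i" using subgroup.one_closed[OF s] by simp
  show "\<And>v w. v \<in> G i \<Longrightarrow> w \<in> G i \<Longrightarrow> v \<oplus> w \<in> G i" using subgroup.m_closed[OF s] by simp
  show "\<And>c v. c \<in> K \<Longrightarrow> v \<in> G i \<Longrightarrow> c \<otimes> v \<in> G i" using component_mult[of _ 0 _ i] degree_zero by simp
qed

lemmas G_carrier = subD(1)[OF sub_G, THEN subsetD]
lemmas G_closed = subD(2-6)[OF sub_G]

lemma ideal_props:
  assumes "ideal I R"
  shows "I \<subseteq> carrier R" "\<zero> \<in> I" "\<And>v w. v \<in> I \<Longrightarrow> w \<in> I \<Longrightarrow> v \<oplus> w \<in> I"
    "\<And>c v. c \<in> carrier R \<Longrightarrow> v \<in> I \<Longrightarrow> c \<otimes> v \<in> I" "\<And>c v. c \<in> carrier R \<Longrightarrow> v \<in> I \<Longrightarrow> v \<otimes> c \<in> I"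
    "\<And>v. v \<in> I \<Longrightarrow> \<ominus> v \<in> I" "\<And>v w. v \<in> I \<Longrightarrow> w \<in> I \<Longrightarrow> v \<ominus> w \<in> I" "sub I"
proof -
  interpret ideal I R by fact
  show 1: "I \<subseteq> carrier R" "\<zero> \<in> I" "\<And>v w. v \<in> I \<Longrightarrow> w \<in> I \<Longrightarrow> v \<oplus> w \<in> I"
    "\<And>c v. c \<in> carrier R \<Longrightarrow> v \<in> I \<Longrightarrow> c \<otimes> v \<in> I" "\<And>c v. c \<in> carrier R \<Longrightarrow> v \<in> I \<Longrightarrow> v \<otimes> c \<in> I"
    "\<And>v. v \<in> I \<Longrightarrow> \<ominus> v \<in> I"
    by (auto simp: I_l_closed I_r_closed)
  then show "\<And>v w. v \<in> I \<Longrightarrow> w \<in> I \<Longrightarrow> v \<ominus> w \<in> I" by (simp add: a_minus_def)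
  show "sub I" using 1 K_props(1) by (intro subI) auto
qed

lemma idealI':
  assumes "I \<subseteq> carrier R" "\<zero> \<in> I" "\<And>v w. v \<in> I \<Longrightarrow> w \<in> I \<Longrightarrow> v \<oplus> w \<in> I"
    "\<And>c v. c \<in> carrier R \<Longrightarrow> v \<in> I \<Longrightarrow> c \<otimes> v \<in> I"
  shows "ideal I R"
proof (rule idealI[OF ring_axioms])
  have "\<ominus> v \<in> I" if "v \<in> I" for v
    using assms(4)[of "\<ominus> \<one>" v] that assms(1) by (auto simp: l_minus subset_iff)
  then show "subgroup I (add_monoid R)"
    using assms(1-3) by (intro add.subgroupI) (auto simp: a_inv_def)
  show "\<And>a x. a \<in> I \<Longrightarrow> x \<in> carrier R \<Longrightarrow> x \<otimes> a \<in> I" using assms(4) by blast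
  show "\<And>a x. a \<in> I \<Longrightarrow> x \<in> carrier R \<Longrightarrow> a \<otimes> x \<in> I"
    using assms(1,4) m_comm by (metis subsetD)
qed

section \<open>Homogeneous components\<close>

definition pr :: "'a \<Rightarrow> nat \<Rightarrow> 'a" where
  "pr x = (THE c. (\<forall>i. c i \<in> G i) \<and> finite {i. c i \<noteq> \<zero>} \<and> x = (\<Oplus>i\<in>{i. c i \<noteq> \<zero>}. c i))"

lemma pr_props:
  assumes "x \<in> carrier R"
  shows "pr x i \<in> G i" "finite {i. pr x i \<noteq> \<zero>}" "x = (\<Oplus>i\<in>{i. pr x i \<noteq> \<zero>}. pr x i)"
  using theI'[OF direct_sum[OF assms], folded pr_def] by auto

lemma pr_carrier [simp]: "x \<in> carrier R \<Longrightarrow> pr x i \<in> carrier R"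
  using pr_props(1) G_carrier by blast

text \<open>Allowing \<open>A\<close> to exceed the support lets two decompositions be added over
  the union of their supports.\<close>

lemma pr_eqI:
  assumes "\<And>i. c i \<in> G i" "finite A" "\<And>i. i \<notin> A \<Longrightarrow> c i = \<zero>" "x = (\<Oplus>i\<in>A. c i)"
  shows "pr x = c"
proof -
  have cc: "c i \<in> carrier R" for i using assms(1) G_carrier by blast
  have x: "x \<in> carrier R" unfolding assms(4) by (intro finsum_closed) (use cc in auto)
  have "{i. c i \<noteq> \<zero>} \<subseteq> A" using assms(3) by blast
  then have "(\<Oplus>i\<in>A. c i) = (\<Oplus>i\<in>{i. c i \<noteq> \<zero>}. c i)"
    using cc assms(2) by (intro finsum_superset) auto
  moreover have "finite {i. c i \<noteq> \<zero>}" using \<open>_ \<subseteq> A\<close> assms(2) finite_subset by blast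
  ultimately show ?thesis
    unfolding pr_def using assms by (intro the1_equality[OF direct_sum[OF x]]) auto
qed

lemma pr_sum:
  assumes "x \<in> carrier R" "finite A" "{i. pr x i \<noteq> \<zero>} \<subseteq> A"
  shows "x = (\<Oplus>i\<in>A. pr x i)"
proof -
  have "(\<Oplus>i\<in>A. pr x i) = (\<Oplus>i\<in>{i. pr x i \<noteq> \<zero>}. pr x i)"
    by (rule finsum_superset[OF assms(2,3)]) (use assms(1) in auto)
  then show ?thesis using pr_props(3)[OF assms(1)] by (rule trans[OF _ sym, rotated])
qed

lemma pr_add:
  assumes "x \<in> carrier R" "y \<in> carrier R"
  shows "pr (x \<oplus> y) i = pr x i \<oplus> pr y i"
proof -
  let ?A = "{i. pr x i \<noteq> \<zero>} \<union> {i. pr y i \<noteq> \<zero>}"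
  have f: "finite ?A" using pr_props(2) assms by simp
  have "pr (x \<oplus> y) = (\<lambda>i. pr x i \<oplus> pr y i)"
  proof (rule pr_eqI[OF _ f])
    show "pr x i \<oplus> pr y i \<in> G i" for i
      by (rule G_closed(2)[OF pr_props(1)[OF assms(1)] pr_props(1)[OF assms(2)]])
    show "i \<notin> ?A \<Longrightarrow> pr x i \<oplus> pr y i = \<zero>" for i by simp
    have "(\<Oplus>i\<in>?A. pr x i \<oplus> pr y i) = (\<Oplus>i\<in>?A. pr x i) \<oplus> (\<Oplus>i\<in>?A. pr y i)"
      by (rule finsum_addf) (use assms in auto)
    also have "\<dots> = x \<oplus> y" using pr_sum[OF _ f] assms by simp
    finally show "x \<oplus> y = (\<Oplus>i\<in>?A. pr x i \<oplus> pr y i)" ..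
  qed
  then show ?thesis by simp
qed

lemma pr_hom:
  assumes "x \<in> G j"
  shows "pr x i = (if i = j then x else \<zero>)"
proof -
  have "pr x = (\<lambda>i. if i = j then x else \<zero>)"
    by (rule pr_eqI[of _ "{j}"]) (use assms G_closed G_carrier in auto)
  then show ?thesis by simp
qed

lemma pr_zero [simp]: "pr \<zero> i = \<zero>" using pr_hom[of \<zero> 0 i] G_closed(1) by simp

lemma pr_neg: assumes "x \<in> carrier R" shows "pr (\<ominus> x) i = \<ominus> pr x i"
proof -
  have "pr (\<ominus> x) i \<oplus> pr x i = \<zero>" using pr_add[of "\<ominus> x" x i] assms by (simp add: l_neg)
  from minus_equality[OF this] assms show ?thesis by simp
qed

lemma pr_minus: assumes "x \<in> carrier R" "y \<in> carrier R" shows "pr (x \<ominus> y) i = pr x i \<ominus> pr y i"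
  using assms by (simp add: a_minus_def pr_add pr_neg)

lemma graded_induct [consumes 1, case_names hom add]:
  assumes "x \<in> carrier R" "\<And>i x. x \<in> G i \<Longrightarrow> P x"
    "\<And>x y. x \<in> carrier R \<Longrightarrow> y \<in> carrier R \<Longrightarrow> P x \<Longrightarrow> P y \<Longrightarrow> P (x \<oplus> y)"
  shows "P x"
proof -
  have "(\<Oplus>i\<in>{i. pr x i \<noteq> \<zero>}. pr x i) \<in> {x \<in> carrier R. P x}"
    by (rule finsum_mem) (use assms(2)[OF G_closed(1)] assms(3) assms(2)[OF pr_props(1)[OF assms(1)]] assms(1) in auto)
  then show ?thesis using pr_props(3)[OF assms(1)] by simp
qed

lemma pr_mult_hom:
  assumes "r \<in> G s" "x \<in> carrier R"
  shows "pr (r \<otimes> x) i = (if s \<le> i then r \<otimes> pr x (i - s) else \<zero>)"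
  using assms(2)
proof (induction x rule: graded_induct)
  case (hom j x)
  then have "r \<otimes> x \<in> G (s + j)" using component_mult assms by blast
  moreover have "r \<otimes> \<zero> = \<zero>" using assms G_carrier by simp
  ultimately show ?case using hom by (auto simp: pr_hom)
next
  case (add x y)
  have r: "r \<in> carrier R" using assms G_carrier by simp
  have "pr (r \<otimes> (x \<oplus> y)) i = pr (r \<otimes> x) i \<oplus> pr (r \<otimes> y) i"
    using add r by (simp add: r_distr pr_add)
  then show ?case using add r by (auto simp: pr_add r_distr)
qed

subsection \<open>Homogeneous ideals\<close>

definition hideal :: "'a set \<Rightarrow> bool" where
  "hideal I \<longleftrightarrow> ideal I R \<and> (\<forall>x\<in>I. \<forall>i. pr x i \<in> I)"

lemma hidealD: assumes "hideal I" shows "ideal I R" "\<And>x i. x \<in> I \<Longrightarrow> pr x i \<in> I"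
  using assms by (auto simp: hideal_def)

lemma mem_if_pr_mem:
  assumes "sub I" "x \<in> carrier R" "\<And>i. pr x i \<in> I"
  shows "x \<in> I"
  by (subst pr_props(3)[OF assms(2)], rule finsum_mem) (use subD[OF assms(1)] assms(3) in auto)

text \<open>The ideal quotient \<open>(I : g)\<close>. With \<open>adjoin\<close>, which is
  \<open>I + gR\<close>, it gives the two outer terms of the exact sequence behind
  \<open>hf_exact\<close>.\<close>

definition colon :: "'a set \<Rightarrow> 'a \<Rightarrow> 'a set" where
  "colon I g = {r \<in> carrier R. g \<otimes> r \<in> I}"

definition adjoin :: "'a set \<Rightarrow> 'a \<Rightarrow> 'a set" where
  "adjoin I g = {i \<oplus> g \<otimes> r | i r. i \<in> I \<and> r \<in> carrier R}"

lemma ideal_colon: assumes "ideal I R" "g \<in> carrier R" shows "ideal (colon I g) R"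
proof (rule idealI')
  note I = ideal_props[OF assms(1)]
  show "colon I g \<subseteq> carrier R" "\<zero> \<in> colon I g" using assms(2) I(2) by (auto simp: colon_def)
  show "\<And>v w. v \<in> colon I g \<Longrightarrow> w \<in> colon I g \<Longrightarrow> v \<oplus> w \<in> colon I g"
    using assms(2) I(3) by (auto simp: colon_def r_distr)
  show "c \<otimes> v \<in> colon I g" if "c \<in> carrier R" "v \<in> colon I g" for c v
  proof -
    have "g \<otimes> (c \<otimes> v) = c \<otimes> (g \<otimes> v)" using that assms(2) by (simp add: colon_def m_lcomm)
    then show ?thesis using that I(4) by (simp add: colon_def)
  qed
qed

lemma colon_mono: "ideal I R \<Longrightarrow> g \<in> carrier R \<Longrightarrow> I \<subseteq> colon I g"
  using ideal_props(1,4) by (auto simp: colon_def)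

lemma hideal_colon: assumes "hideal I" "g \<in> G s" shows "hideal (colon I g)"
proof -
  have g: "g \<in> carrier R" using assms(2) G_carrier by blast
  have "pr x i \<in> colon I g" if "x \<in> colon I g" for x i
  proof -
    have x: "x \<in> carrier R" "g \<otimes> x \<in> I" using that by (auto simp: colon_def)
    then have "pr (g \<otimes> x) (i + s) \<in> I" using hidealD(2)[OF assms(1)] by blast
    then show ?thesis using pr_mult_hom[OF assms(2) x(1), of "i + s"] x by (simp add: colon_def)
  qed
  then show ?thesis using ideal_colon[OF hidealD(1)[OF assms(1)] g] by (simp add: hideal_def)
qed

lemma ideal_adjoin: assumes "ideal I R" "g \<in> carrier R"
  shows "ideal (adjoin I g) R" "I \<subseteq> adjoin I g" "g \<in> adjoin I g"
proof -
  note I = ideal_props[OF assms(1)]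
  have Ic: "i \<in> I \<Longrightarrow> i \<in> carrier R" for i using I(1) by blast
  show "I \<subseteq> adjoin I g"
  proof
    fix i assume "i \<in> I"
    then have "i = i \<oplus> g \<otimes> \<zero>" using Ic assms(2) by simp
    then show "i \<in> adjoin I g" using \<open>i \<in> I\<close> unfolding adjoin_def by blast
  qed
  have "g = \<zero> \<oplus> g \<otimes> \<one>" using assms(2) by simp
  then show "g \<in> adjoin I g" using I(2) unfolding adjoin_def by blast
  show "ideal (adjoin I g) R"
  proof (rule idealI')
    show "adjoin I g \<subseteq> carrier R" using Ic assms(2) by (auto simp: adjoin_def)
    show "\<zero> \<in> adjoin I g" using \<open>I \<subseteq> adjoin I g\<close> I(2) by blast
  next
    fix v w assume "v \<in> adjoin I g" "w \<in> adjoin I g"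
    then obtain i r j s where *: "v = i \<oplus> g \<otimes> r" "w = j \<oplus> g \<otimes> s" "i \<in> I" "j \<in> I" "r \<in> carrier R" "s \<in> carrier R"
      by (auto simp: adjoin_def)
    then have "v \<oplus> w = (i \<oplus> j) \<oplus> g \<otimes> (r \<oplus> s)" using assms(2) Ic by (simp add: r_distr a_ac)
    then show "v \<oplus> w \<in> adjoin I g" using * I(3) unfolding adjoin_def by blast
  next
    fix c v assume c: "c \<in> carrier R" and "v \<in> adjoin I g"
    then obtain i r where *: "v = i \<oplus> g \<otimes> r" "i \<in> I" "r \<in> carrier R" by (auto simp: adjoin_def)
    then have "c \<otimes> v = c \<otimes> i \<oplus> g \<otimes> (c \<otimes> r)" using assms(2) Ic c by (simp add: r_distr m_lcomm)
    then show "c \<otimes> v \<in> adjoin I g" using * I(4)[OF c] c unfolding adjoin_def by blast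
  qed
qed

lemma adjoin_least: assumes "ideal J R" "I \<subseteq> J" "g \<in> J" shows "adjoin I g \<subseteq> J"
  using assms(2,3) ideal_props[OF assms(1)] by (auto simp: adjoin_def subset_iff)

lemma hideal_adjoin: assumes "hideal I" "g \<in> G s" shows "hideal (adjoin I g)"
proof -
  have g: "g \<in> carrier R" using assms(2) G_carrier by blast
  note L = ideal_adjoin[OF hidealD(1)[OF assms(1)] g]
  have "pr x n \<in> adjoin I g" if "x \<in> adjoin I g" for x n
  proof -
    obtain i r where *: "x = i \<oplus> g \<otimes> r" "i \<in> I" "r \<in> carrier R" using \<open>x \<in> adjoin I g\<close> by (auto simp: adjoin_def)
    have ic: "i \<in> carrier R" using *(2) ideal_props(1)[OF hidealD(1)[OF assms(1)]] by blast
    have "pr x n = pr i n \<oplus> pr (g \<otimes> r) n" unfolding *(1) using ic g *(3) by (intro pr_add) auto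
    moreover have "pr i n \<in> adjoin I g" using hidealD(2)[OF assms(1) *(2)] L(2) by blast
    moreover have "pr (g \<otimes> r) n \<in> adjoin I g"
      using pr_mult_hom[OF assms(2) *(3)] ideal_props(2,5)[OF L(1)] L(3) *(3) by simp
    ultimately show ?thesis using ideal_props(3)[OF L(1)] by simp
  qed
  then show ?thesis using L(1) by (simp add: hideal_def)
qed

lemma hideal_zero: "hideal {\<zero>}"
  using zeroideal by (auto simp: hideal_def)

lemma hideal_INT: assumes "\<And>P. P \<in> S \<Longrightarrow> hideal P" "S \<noteq> {}" shows "hideal (\<Inter>S)"
  using assms i_Intersect[of S] by (auto simp: hideal_def)

lemma hideal_Idl: assumes "finite A" "A \<subseteq> G t" shows "hideal (Idl A)"
  using assms
proof (induction A)
  case empty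
  have "Idl {} = {\<zero>}"
  proof
    show "Idl {} \<subseteq> {\<zero>}" by (rule genideal_minimal[OF zeroideal]) simp
    show "{\<zero>} \<subseteq> Idl {}" using ideal_props(2)[OF genideal_ideal[of "{}"]] by simp
  qed
  then show ?case using hideal_zero by simp
next
  case (insert f A)
  then have h: "hideal (Idl A)" and f: "f \<in> G t" "f \<in> carrier R" and A: "A \<subseteq> carrier R" using G_carrier by auto
  have "Idl (insert f A) = adjoin (Idl A) f"
  proof
    show "Idl (insert f A) \<subseteq> adjoin (Idl A) f"
      using ideal_adjoin[OF hidealD(1)[OF h] f(2)] genideal_self[OF A]
      by (intro genideal_minimal) auto
    have fA: "insert f A \<subseteq> carrier R" using f A by simp
    show "adjoin (Idl A) f \<subseteq> Idl (insert f A)"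
    proof (rule adjoin_least)
      show "ideal (Idl (insert f A)) R" by (rule genideal_ideal[OF fA])
      show "Idl A \<subseteq> Idl (insert f A)"
        using genideal_self[OF fA] by (intro genideal_minimal genideal_ideal[OF fA]) auto
      show "f \<in> Idl (insert f A)" using genideal_self[OF fA] by auto
    qed
  qed
  then show ?case using hideal_adjoin[OF h f(1)] by simp
qed

section \<open>The filtration by degree\<close>

definition filt :: "nat \<Rightarrow> 'a set" where
  "filt m = {x \<in> carrier R. \<forall>i\<ge>m. pr x i = \<zero>}"

lemma sub_filt: "sub (filt m)"
proof (rule subI)
  fix c v assume c: "c \<in> K" and v: "v \<in> filt m"
  have "c \<in> G 0" using c degree_zero by simp
  then show "c \<otimes> v \<in> filt m" using v G_carrier by (auto simp: filt_def pr_mult_hom)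
qed (auto simp: filt_def pr_add)

lemma filt_0: "filt 0 = {\<zero>}"
proof -
  have "x = \<zero>" if "x \<in> filt 0" for x
    using mem_if_pr_mem[OF ideal_props(8)[OF zeroideal], of x] that by (auto simp: filt_def)
  then show ?thesis by (auto simp: filt_def)
qed

lemma filt_mono: "m \<le> n \<Longrightarrow> filt m \<subseteq> filt n" by (auto simp: filt_def)

lemma G_filt: "i < m \<Longrightarrow> G i \<subseteq> filt m" using G_carrier by (auto simp: filt_def pr_hom)

lemma filt_split:
  assumes "x \<in> filt (Suc m)"
  obtains y where "y \<in> filt m" "x = y \<oplus> pr x m"
proof
  have x: "x \<in> carrier R" using assms by (simp add: filt_def)
  show "x = (x \<ominus> pr x m) \<oplus> pr x m" using x by (simp add: a_minus_def a_assoc l_neg)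
  have "pr (x \<ominus> pr x m) i = \<zero>" if "i \<ge> m" for i
    using pr_minus[OF x, of "pr x m" i] x pr_hom[OF pr_props(1)[OF x], of m i] assms that
    by (cases "i = m") (auto simp: filt_def a_minus_def r_neg)
  then show "x \<ominus> pr x m \<in> filt m" using x by (auto simp: filt_def)
qed

lemma filt_Suc: "filt (Suc m) = V.submodule_sum (filt m) (G m)" "filt m \<inter> G m = {\<zero>}"
proof -
  have "filt (Suc m) \<subseteq> V.submodule_sum (filt m) (G m)"
  proof
    fix x assume x: "x \<in> filt (Suc m)"
    then have xc: "x \<in> carrier R" by (simp add: filt_def)
    obtain y where y: "y \<in> filt m" "x = y \<oplus> pr x m" using filt_split[OF x] .
    then show "x \<in> V.submodule_sum (filt m) (G m)" unfolding V.submodule_sum_def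
      using pr_props(1)[OF xc] by (intro image_eqI[of _ _ "(y, pr x m)"]) auto
  qed
  moreover have "V.submodule_sum (filt m) (G m) \<subseteq> filt (Suc m)"
    using filt_mono[of m "Suc m"] G_filt[of m "Suc m"] subD(3)[OF sub_filt]
    by (auto simp: V.submodule_sum_def subset_iff)
  ultimately show "filt (Suc m) = V.submodule_sum (filt m) (G m)" by blast
  show "filt m \<inter> G m = {\<zero>}" using pr_hom[of _ m m] G_closed(1) by (auto simp: filt_def)
qed

lemma ex_filt: "x \<in> carrier R \<Longrightarrow> \<exists>m. x \<in> filt m"
proof -
  assume x: "x \<in> carrier R"
  obtain m where "\<forall>i\<in>{i. pr x i \<noteq> \<zero>}. i < m" using pr_props(2)[OF x] finite_nat_set_iff_bounded by blast
  then show ?thesis using x by (intro exI[of _ m]) (auto simp: filt_def not_less[symmetric])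
qed

lemma filt_mult_hom:
  assumes "z \<in> G i" "i < m" "y \<in> filt (Suc n)"
  shows "z \<otimes> y \<in> filt (m + n)"
  using assms G_carrier[OF assms(1)] by (auto simp: filt_def pr_mult_hom)

text \<open>The bound in \<open>filt m\<close> is strict. Degrees below \<open>m\<close> plus
  degrees at most \<open>n\<close> stay below \<open>m + n\<close>, hence the single
  \<open>Suc\<close>.\<close>

lemma filt_mult:
  assumes "x \<in> filt m" "y \<in> filt (Suc n)"
  shows "x \<otimes> y \<in> filt (m + n)"
  using assms(1)
proof (induction m arbitrary: x)
  case 0
  have "x = \<zero>" "y \<in> carrier R" using 0 filt_0 assms(2) by (auto simp: filt_def)
  then show ?case using subD(2)[OF sub_filt] by simp
next
  case (Suc m)
  have xc: "x \<in> carrier R" and yc: "y \<in> carrier R" using Suc.prems assms(2) by (auto simp: filt_def)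
  obtain x' where x': "x' \<in> filt m" "x = x' \<oplus> pr x m" using filt_split[OF Suc.prems] .
  have xc': "x' \<in> carrier R" using x'(1) by (simp add: filt_def)
  have "x' \<otimes> y \<in> filt (Suc m + n)" using Suc.IH[OF x'(1)] filt_mono[of "m + n" "Suc m + n"] by auto
  moreover have "pr x m \<otimes> y \<in> filt (Suc m + n)"
    by (rule filt_mult_hom[OF pr_props(1)[OF xc] _ assms(2)]) simp
  moreover have "x \<otimes> y = x' \<otimes> y \<oplus> pr x m \<otimes> y"
    by (subst x'(2), subst l_distr) (use xc xc' yc in auto)
  ultimately show ?case using subD(3)[OF sub_filt] by simp
qed

text \<open>Leading components multiply, since all other contributions to the product have smaller
  degree. The right side may be zero.\<close>

lemma pr_mult_top:
  assumes "x \<in> filt (Suc m)" "y \<in> filt (Suc n)"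
  shows "pr (x \<otimes> y) (m + n) = pr x m \<otimes> pr y n"
proof -
  have xc: "x \<in> carrier R" and yc: "y \<in> carrier R" using assms by (auto simp: filt_def)
  obtain x' where x': "x' \<in> filt m" "x = x' \<oplus> pr x m" using filt_split[OF assms(1)] .
  have xc': "x' \<in> carrier R" using x'(1) by (simp add: filt_def)
  have "x \<otimes> y = x' \<otimes> y \<oplus> pr x m \<otimes> y"
    by (subst x'(2), subst l_distr) (use xc xc' yc in auto)
  then have "pr (x \<otimes> y) (m + n) = pr (x' \<otimes> y) (m + n) \<oplus> pr (pr x m \<otimes> y) (m + n)"
    using xc xc' yc by (simp add: pr_add)
  also have "pr (x' \<otimes> y) (m + n) = \<zero>" using filt_mult[OF x'(1) assms(2)] by (simp add: filt_def)
  also have "pr (pr x m \<otimes> y) (m + n) = pr x m \<otimes> pr y n"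
    using pr_mult_hom[OF pr_props(1)[OF xc] yc, of m "m + n"] by simp
  finally show ?thesis using xc yc by simp
qed

text \<open>If a product lies in \<open>I\<close>, homogeneity puts the product of the top
  components into \<open>I\<close>; then one of these is in \<open>I\<close>, and subtracting it
  lowers a degree bound. Hence the induction on \<open>m + n\<close>.\<close>

lemma hideal_primeI:
  assumes I: "hideal I" "carrier R \<noteq> I"
    and t: "\<And>a b i j. a \<in> G i \<Longrightarrow> b \<in> G j \<Longrightarrow> a \<otimes> b \<in> I \<Longrightarrow> a \<in> I \<or> b \<in> I"
  shows "primeideal I R"
proof (rule primeidealI[OF hidealD(1)[OF I(1)] is_cring I(2)])
  note Ip = ideal_props[OF hidealD(1)[OF I(1)]]
  have main: "x \<in> I \<or> y \<in> I" if "x \<in> filt m" "y \<in> filt n" "x \<otimes> y \<in> I" for x y m n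
    using that
  proof (induction "m + n" arbitrary: m n x y rule: less_induct)
    case less
    have xc: "x \<in> carrier R" and yc: "y \<in> carrier R" using less.prems by (auto simp: filt_def)
    show ?case
    proof (cases "m = 0 \<or> n = 0")
      case True
      then show ?thesis using less.prems filt_0 Ip(2) by auto
    next
      case False
      then obtain m' n' where mn: "m = Suc m'" "n = Suc n'" by (meson not0_implies_Suc)
      obtain x' where x': "x' \<in> filt m'" "x = x' \<oplus> pr x m'" using filt_split less.prems(1) mn by blast
      obtain y' where y': "y' \<in> filt n'" "y = y' \<oplus> pr y n'" using filt_split less.prems(2) mn by blast
      have xyc: "x' \<in> carrier R" "y' \<in> carrier R" using x' y' by (auto simp: filt_def)
      have "pr x m' \<otimes> pr y n' \<in> I"
        using pr_mult_top less.prems mn hidealD(2)[OF I(1) less.prems(3), of "m' + n'"] by simp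
      then consider "pr x m' \<in> I" | "pr y n' \<in> I"
        using t pr_props(1)[OF xc] pr_props(1)[OF yc] by blast
      then show ?thesis
      proof cases
        case 1
        have "x' = x \<ominus> pr x m'" using x'(2) xyc xc by (metis add.inv_solve_right' minus_eq pr_carrier)
        then have "x' \<otimes> y = x \<otimes> y \<ominus> pr x m' \<otimes> y" using xc yc by (simp add: a_minus_def l_distr l_minus)
        then have "x' \<otimes> y \<in> I" using Ip(7)[OF less.prems(3) Ip(5)[OF yc 1]] by simp
        from less.hyps[OF _ x'(1) less.prems(2) this] mn have "x' \<in> I \<or> y \<in> I" by simp
        then show ?thesis using x'(2) 1 Ip(3) by metis
      next
        case 2
        have "y' = y \<ominus> pr y n'" using y'(2) xyc yc by (metis add.inv_solve_right' minus_eq pr_carrier)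
        then have "x \<otimes> y' = x \<otimes> y \<ominus> x \<otimes> pr y n'" using xc yc by (simp add: a_minus_def r_distr r_minus)
        then have "x \<otimes> y' \<in> I" using Ip(7)[OF less.prems(3) Ip(4)[OF xc 2]] by simp
        from less.hyps[OF _ less.prems(1) y'(1) this] mn have "x \<in> I \<or> y' \<in> I" by simp
        then show ?thesis using y'(2) 2 Ip(3) by metis
      qed
    qed
  qed
  show "a \<in> I \<or> b \<in> I" if "a \<in> carrier R" "b \<in> carrier R" "a \<otimes> b \<in> I" for a b
    using main[of a _ b] ex_filt[OF that(1)] ex_filt[OF that(2)] that(3) by metis
qed

abbreviation hprime where "hprime P \<equiv> hideal P \<and> primeideal P R"

lemma primeD:
  assumes "primeideal P R"
  shows "ideal P R" "\<one> \<notin> P" "\<And>a b. a \<in> carrier R \<Longrightarrow> b \<in> carrier R \<Longrightarrow> a \<otimes> b \<in> P \<Longrightarrow> a \<in> P \<or> b \<in> P"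
proof -
  interpret primeideal P R by fact
  show "ideal P R" by unfold_locales
  show "\<one> \<notin> P" using I_notcarr one_imp_carrier by auto
  show "\<And>a b. a \<in> carrier R \<Longrightarrow> b \<in> carrier R \<Longrightarrow> a \<otimes> b \<in> P \<Longrightarrow> a \<in> P \<or> b \<in> P" by (rule I_prime)
qed

text \<open>The elements all of whose components lie in \<open>P\<close> form the largest
  homogeneous ideal inside \<open>P\<close>. It inherits primality on homogeneous elements, which is
  enough. A minimal prime therefore equals its core.\<close>

lemma hprime_core:
  assumes "primeideal P R"
  shows "\<exists>Q. hprime Q \<and> Q \<subseteq> P \<and> (\<forall>I. hideal I \<and> I \<subseteq> P \<longrightarrow> I \<subseteq> Q)"
proof -
  note P = primeD[OF assms] and Pi = ideal_props[OF primeD(1)[OF assms]]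
  let ?Q = "{x \<in> carrier R. \<forall>i. pr x i \<in> P}"
  have id: "ideal ?Q R"
  proof (rule idealI')
    fix c v assume c: "c \<in> carrier R" and v: "v \<in> ?Q"
    have "\<forall>i. pr (c \<otimes> v) i \<in> P" using c
    proof (induction c rule: graded_induct)
      case (hom j c)
      then show ?case using v Pi(2,4) G_carrier by (auto simp: pr_mult_hom)
    next
      case (add x y)
      then show ?case using v Pi(3) by (auto simp: l_distr pr_add)
    qed
    then show "c \<otimes> v \<in> ?Q" using c v by simp
  qed (use Pi in \<open>auto simp: pr_add\<close>)
  have QP: "?Q \<subseteq> P" using mem_if_pr_mem[OF Pi(8)] by blast
  have h: "hideal ?Q"
    using id Pi(2) by (auto simp: hideal_def pr_hom[OF pr_props(1)])
  have pri: "primeideal ?Q R"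
  proof (rule hideal_primeI[OF h])
    show "carrier R \<noteq> ?Q" using P(2) QP by blast
    fix a b i j assume ab: "a \<in> G i" "b \<in> G j" "a \<otimes> b \<in> ?Q"
    then have "a \<in> P \<or> b \<in> P" using P(3) QP G_carrier by blast
    then show "a \<in> ?Q \<or> b \<in> ?Q" using ab Pi(2) G_carrier by (auto simp: pr_hom)
  qed
  show ?thesis
  proof (intro exI[of _ ?Q] conjI h pri QP allI impI)
    fix I assume "hideal I \<and> I \<subseteq> P"
    then show "I \<subseteq> ?Q" using hidealD ideal_props(1) by blast
  qed
qed

lemma hprime_minimal:
  assumes "P \<in> minimal_primes R"
  shows "hprime P"
  using assms hprime_core[of P] unfolding minimal_primes_def by blast

subsection \<open>Finite dimensionality\<close>

text \<open>Degree \<open>n\<close> is spanned by the products of \<open>n\<close> algebra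
  generators, a finite set. The second claim uses the same description: a product of at least one
  generator has a factor in \<open>G 1\<close>.\<close>

lemma fin_G: "fin (G n)" and G_Suc_ideal: "ideal I R \<Longrightarrow> G 1 \<subseteq> I \<Longrightarrow> G (Suc n) \<subseteq> I"
proof -
  obtain S where S: "finite S" "S \<subseteq> G 1" "generate_ring R (K \<union> S) = carrier R"
    using generated_in_degree_one by blast
  \<comment> \<open>\<open>B n\<close> consists of the monomials of degree \<open>n\<close> in the
    generators.\<close>
  define B where "B = rec_nat {\<one>} (\<lambda>_ B. (\<lambda>(s, b). s \<otimes> b) ` (S \<times> B))"
  have B0: "B 0 = {\<one>}" and BS: "B (Suc n) = (\<lambda>(s, b). s \<otimes> b) ` (S \<times> B n)" for n by (simp_all add: B_def)
  have Sc: "S \<subseteq> carrier R" using S(2) G_carrier by blast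
  have Bf: "finite (B n)" for n by (induction n) (use S(1) in \<open>auto simp: B0 BS\<close>)
  have BG: "B n \<subseteq> G n" for n
  proof (induction n)
    case 0
    then show ?case using K_props(2) degree_zero by (simp add: B0)
  next
    case (Suc n)
    then show ?case using S(2) component_mult[of _ 1 _ n] by (auto simp: BS)
  qed
  have Bc: "B n \<subseteq> carrier R" for n using BG G_carrier by blast
  define W where "W n = V.span (B n)" for n
  have sW: "sub (W n)" for n unfolding W_def using V.span_is_subspace Bc by simp
  have BW: "B n \<subseteq> W n" for n unfolding W_def using V.in_own_span Bc by simp
  have Wmin: "W n \<subseteq> off" if "sub off" "B n \<subseteq> off" for n off
    unfolding W_def by (rule V.span_is_subset[OF that(2)]) (use that(1) in simp)
  have WG: "W n \<subseteq> G n" for n by (rule Wmin[OF sub_G BG])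
  have Wc: "W n \<subseteq> carrier R" for n using subD(1)[OF sW] .
  \<comment> \<open>Products of spans are treated one argument at a time: the preimage of
    \<open>W n\<close> under a multiplication is a subspace, so it contains a span as soon as it
    contains the monomials.\<close>
  have preim: "sub {y \<in> carrier R. x \<otimes> y \<in> W n}" if "x \<in> carrier R" for x n
  proof (rule subI)
    fix c v assume c: "c \<in> K" and v: "v \<in> {y \<in> carrier R. x \<otimes> y \<in> W n}"
    have "x \<otimes> (c \<otimes> v) = c \<otimes> (x \<otimes> v)" using that c v K_props(1) by (intro m_lcomm) auto
    then show "c \<otimes> v \<in> {y \<in> carrier R. x \<otimes> y \<in> W n}" using subD(4)[OF sW c] v c K_props(1) by auto
  qed (use that subD(2,3)[OF sW] in \<open>auto simp: r_distr\<close>)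
  have BB: "x \<otimes> y \<in> B (m + n)" if "x \<in> B m" "y \<in> B n" for x y m n
    using that(1)
  proof (induction m arbitrary: x)
    case 0
    have "y \<in> carrier R" using that(2) Bc by blast
    then show ?case using 0 that(2) by (simp add: B0)
  next
    case (Suc m)
    then obtain s b where sb: "s \<in> S" "b \<in> B m" "x = s \<otimes> b" by (auto simp: BS)
    then have "x \<otimes> y = s \<otimes> (b \<otimes> y)" using Sc Bc that(2) by (auto intro!: m_assoc simp: subset_iff)
    then show ?case using Suc.IH[OF sb(2)] sb(1) by (auto simp: BS)
  qed
  have BWm: "x \<otimes> y \<in> W (m + n)" if "x \<in> B m" "y \<in> W n" for x y m n
  proof -
    have "x \<in> carrier R" using that Bc by blast
    from Wmin[OF preim[OF this], of n "m + n"] show ?thesis using that BB BW Bc by blast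
  qed
  have WW: "x \<otimes> y \<in> W (m + n)" if "x \<in> W m" "y \<in> W n" for x y m n
  proof -
    have y: "y \<in> carrier R" using that Wc by blast
    have "B m \<subseteq> {z \<in> carrier R. y \<otimes> z \<in> W (m + n)}"
    proof
      fix z assume z: "z \<in> B m"
      then have "z \<in> carrier R" using Bc by blast
      then show "z \<in> {z \<in> carrier R. y \<otimes> z \<in> W (m + n)}"
        using BWm[OF z that(2)] m_comm[OF y] by simp
    qed
    from Wmin[OF preim[OF y] this] that(1) have "y \<otimes> x \<in> W (m + n)" by blast
    then show ?thesis using that(1) Wc y m_comm by (metis subsetD)
  qed
  \<comment> \<open>\<open>?A\<close> turns out to be a subring containing \<open>K\<close> and
    \<open>S\<close>, hence all of \<open>R\<close>; this forces \<open>G n = W n\<close>.\<close>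
  let ?A = "{x \<in> carrier R. \<forall>n. pr x n \<in> W n}"
  have WA: "W n \<subseteq> ?A" for n using WG G_carrier subD(2)[OF sW] by (fastforce simp: pr_hom)
  have Aadd: "x \<oplus> y \<in> ?A" if "x \<in> ?A" "y \<in> ?A" for x y
    using that subD(3)[OF sW] by (auto simp: pr_add)
  have A0: "\<zero> \<in> ?A" using subD(2)[OF sW] by simp
  have homA: "z \<otimes> y \<in> ?A" if "z \<in> W m" "y \<in> ?A" for z y m
  proof -
    have "z \<in> G m" using that WG by blast
    moreover have "z \<in> carrier R" using that Wc by blast
    moreover have "z \<otimes> pr y (n - m) \<in> W n" if "m \<le> n" for n
      using WW[OF \<open>z \<in> W m\<close>, of "pr y (n - m)" "n - m"] \<open>y \<in> ?A\<close> that by simp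
    ultimately show ?thesis using that subD(2)[OF sW] by (auto simp: pr_mult_hom)
  qed
  have Amult: "x \<otimes> y \<in> ?A" if x: "x \<in> ?A" and y: "y \<in> ?A" for x y
  proof -
    have xc: "x \<in> carrier R" and yc: "y \<in> carrier R" using x y by auto
    have "x \<otimes> y = (\<Oplus>i\<in>{i. pr x i \<noteq> \<zero>}. pr x i \<otimes> y)"
      by (subst (1) pr_props(3)[OF xc], rule finsum_ldistr) (use xc yc pr_props(2) in auto)
    also have "\<dots> \<in> ?A"
    proof (rule finsum_mem[OF A0 _ Aadd])
      show "pr x i \<otimes> y \<in> ?A" for i using homA[OF _ y, of "pr x i" i] x by simp
    qed auto
    finally show ?thesis .
  qed
  have "x \<in> ?A" if "x \<in> generate_ring R (K \<union> S)" for x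
    using that
  proof (induction rule: generate_ring.induct)
    case one
    then show ?case using BW[of 0] WA[of 0] by (auto simp: B0)
  next
    case (incl h)
    then show ?case
    proof
      assume "h \<in> K"
      then have "h \<otimes> \<one> \<in> W 0" using subD(4)[OF sW, of h \<one> 0] BW[of 0] by (auto simp: B0)
      moreover have "h \<otimes> \<one> = h" using \<open>h \<in> K\<close> K_props(1) by auto
      ultimately show ?case using WA[of 0] by auto
    next
      assume h: "h \<in> S"
      then have "h \<otimes> \<one> \<in> B (Suc 0)" by (auto simp: BS B0)
      moreover have "h \<otimes> \<one> = h" using h Sc by auto
      ultimately show ?case using WA[of "Suc 0"] BW[of "Suc 0"] by auto
    qed
  next
    case (a_inv h)
    then show ?case using subD(5)[OF sW] by (auto simp: pr_neg)
  next
    case (eng_add h1 h2)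
    then show ?case using Aadd by blast
  next
    case (eng_mult h1 h2)
    then show ?case using Amult by blast
  qed
  then have all: "carrier R \<subseteq> ?A" using S(3) by blast
  have GW: "G n = W n" for n
  proof
    show "G n \<subseteq> W n"
    proof
      fix x assume x: "x \<in> G n"
      then have "x \<in> ?A" using all G_carrier by blast
      then have "pr x n \<in> W n" by blast
      then show "x \<in> W n" using pr_hom[OF x, of n] by simp
    qed
  qed (rule WG)
  show "fin (G n)" unfolding GW W_def by (rule V.sfin_span[OF Bf]) (use Bc in simp)
  show "G (Suc n) \<subseteq> I" if I: "ideal I R" "G 1 \<subseteq> I"
  proof -
    have "B (Suc n) \<subseteq> I" using ideal_props(5)[OF I(1)] I(2) S(2) Bc by (auto simp: BS subset_iff)
    then show ?thesis unfolding GW using Wmin[OF ideal_props(8)[OF I(1)]] by blast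
  qed
qed

end

section \<open>Hilbert functions\<close>

context standard_graded_algebra
begin

lemma mult_linear:
  assumes "x \<in> carrier R"
  shows "linear_map KF (self_module R) (self_module R) ((\<otimes>) x)"
  by (intro linear_map.intro mod_hom.intro mod_hom_axioms.intro V.vectorspace_axioms
        V.module.module_axioms)
    (use assms K_props(1) in \<open>auto simp: module_hom_def r_distr m_lcomm subset_iff\<close>)

lemma mult_image:
  assumes "x \<in> carrier R" "sub off" "fin off"
  shows "dm ((\<otimes>) x ` off) + dm {u \<in> off. x \<otimes> u = \<zero>} = dm off"
    "fin ((\<otimes>) x ` off)" "sub ((\<otimes>) x ` off)"
  using linear_image_dim[OF mult_linear[OF assms(1)] assms(2,3)] by auto

text \<open>The kernel of multiplication by \<open>x\<close> lies in \<open>C\<close> and cancels: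
  the two images have the same relative codimension as the two spaces.\<close>

lemma mult_image_sub:
  assumes x: "x \<in> carrier R" and off: "sub off" "fin off" and C: "sub C" "C \<subseteq> off"
    and ann: "\<And>u. u \<in> off \<Longrightarrow> x \<otimes> u = \<zero> \<Longrightarrow> u \<in> C"
  shows "dm ((\<otimes>) x ` off) + dm C = dm ((\<otimes>) x ` C) + dm off"
proof -
  have fC: "fin C" using V.sfin_subspace(1)[OF off(1) C off(2)] .
  have "{u \<in> C. x \<otimes> u = \<zero>} = {u \<in> off. x \<otimes> u = \<zero>}" using ann C(2) by blast
  then show ?thesis using mult_image(1)[OF x off] mult_image(1)[OF x C(1) fC] by simp
qed

lemma mem_ssum: "x \<in> V.submodule_sum A B \<longleftrightarrow> (\<exists>a\<in>A. \<exists>b\<in>B. x = a \<oplus> b)"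
  by (auto simp: V.submodule_sum_def)

lemma fin_mono: "sub W \<Longrightarrow> fin W \<Longrightarrow> sub off \<Longrightarrow> off \<subseteq> W \<Longrightarrow> fin off"
  and dm_mono: "sub W \<Longrightarrow> fin W \<Longrightarrow> sub off \<Longrightarrow> off \<subseteq> W \<Longrightarrow> dm off \<le> dm W"
  using V.sfin_subspace by blast+

lemma sub_ssum: "sub A \<Longrightarrow> sub B \<Longrightarrow> sub (V.submodule_sum A B)"
  by (rule V.sum_is_subspace)

lemma sub_IG: "ideal I R \<Longrightarrow> sub (I \<inter> G t)"
  by (intro V.subspace_Int ideal_props(8) sub_G)

lemma fin_IG: "ideal I R \<Longrightarrow> fin (I \<inter> G t)"
  by (rule fin_mono[OF sub_G fin_G sub_IG]) auto

text \<open>The Hilbert function of \<open>R/I\<close>, computed inside \<open>R\<close>. For ideals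
  the subtraction is exact by \<open>hf_add\<close>.\<close>

definition hf :: "'a set \<Rightarrow> nat \<Rightarrow> nat" where
  "hf I t = dm (G t) - dm (I \<inter> G t)"

definition HF :: "'a set \<Rightarrow> nat \<Rightarrow> nat" where
  "HF I t = (\<Sum>i\<le>t. hf I i)"

lemma hf_add: "ideal I R \<Longrightarrow> hf I t + dm (I \<inter> G t) = dm (G t)"
  unfolding hf_def using dm_mono[OF sub_G fin_G sub_IG, of I t] by simp

lemma hf_anti: "ideal I R \<Longrightarrow> ideal J R \<Longrightarrow> I \<subseteq> J \<Longrightarrow> hf J t \<le> hf I t"
  unfolding hf_def using dm_mono[OF sub_IG fin_IG sub_IG, of J I t] by fastforce

lemma HF_anti: "ideal I R \<Longrightarrow> ideal J R \<Longrightarrow> I \<subseteq> J \<Longrightarrow> HF J t \<le> HF I t"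
  unfolding HF_def by (intro sum_mono hf_anti)

text \<open>A proper ideal contains no nonzero scalar, and degree 0 is the field itself.\<close>

lemma hf_0: assumes "ideal I R" "\<one> \<notin> I" shows "hf I 0 = 1"
proof -
  have "I \<inter> G 0 = {\<zero>}"
  proof -
    have "x = \<zero>" if x: "x \<in> I" "x \<in> G 0" for x
    proof (rule ccontr)
      assume "x \<noteq> \<zero>"
      then obtain y where y: "y \<in> K" "x \<otimes> y = \<one>"
        using subfield_m_inv[OF ground_field, of x] x degree_zero by auto
      then have "\<one> \<in> I" using ideal_props(5)[OF assms(1) _ x(1), of y] K_props(1) by auto
      then show False using assms(2) by simp
    qed
    moreover have "\<zero> \<in> I \<inter> G 0" using ideal_props(2)[OF assms(1)] G_closed(1) by simp
    ultimately show ?thesis by blast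
  qed
  moreover have "dm (G 0) = 1"
  proof -
    have sp: "V.span {\<one>} = G 0"
    proof
      show "V.span {\<one>} \<subseteq> G 0"
        by (rule V.span_is_subset) (use sub_G[of 0] degree_zero K_props(2) in auto)
      have sv: "sub (V.span {\<one>})" by (rule V.span_is_subspace) auto
      have "\<one> \<in> V.span {\<one>}" using V.in_own_span[of "{\<one>}"] by auto
      from subD(4)[OF sv _ this] have "c \<otimes> \<one> \<in> V.span {\<one>}" if "c \<in> K" for c using that by blast
      then show "G 0 \<subseteq> V.span {\<one>}" using degree_zero K_props(1) by (auto simp: subset_iff)
    qed
    interpret W: vectorspace KF "V.vs (G 0)" by (rule V.subspace_is_vs[OF sub_G])
    have "W.span {\<one>} = G 0"
      using V.span_li_not_depend(1)[of "{\<one>}" "G 0"] sp sub_G[of 0] degree_zero K_props(2) by auto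
    then have "W.dim \<le> card {\<one>}" using W.gen_ge_dim[of "{\<one>}"] degree_zero K_props(2) by auto
    moreover have "dm (G 0) > 0" using V.sdim_pos[OF sub_G fin_G, of \<one> 0] degree_zero K_props(2,7) by auto
    ultimately show ?thesis by (simp add: V.sdim_def)
  qed
  ultimately show ?thesis unfolding hf_def using V.sfin_zero(2) by simp
qed

lemma adjoin_G_low:
  assumes "hideal I" "g \<in> G s" "t < s"
  shows "adjoin I g \<inter> G t = I \<inter> G t"
proof -
  have g: "g \<in> carrier R" using assms(2) G_carrier by blast
  have "x \<in> I" if x: "x \<in> adjoin I g" "x \<in> G t" for x
  proof -
    obtain i r where *: "x = i \<oplus> g \<otimes> r" "i \<in> I" "r \<in> carrier R" using x(1) by (auto simp: adjoin_def)
    have ic: "i \<in> carrier R" using *(2) ideal_props(1)[OF hidealD(1)[OF assms(1)]] by blast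
    have "pr x t = pr i t \<oplus> pr (g \<otimes> r) t" unfolding *(1) using ic g *(3) by (intro pr_add) auto
    also have "\<dots> = pr i t" using pr_mult_hom[OF assms(2) *(3), of t] assms(3) ic by simp
    finally show ?thesis using hidealD(2)[OF assms(1) *(2), of t] pr_hom[OF x(2), of t] by simp
  qed
  then show ?thesis using ideal_adjoin(2)[OF hidealD(1)[OF assms(1)] g] by blast
qed

lemma adjoin_G:
  assumes "hideal I" "g \<in> G s" "s \<le> t"
  shows "adjoin I g \<inter> G t = V.submodule_sum (I \<inter> G t) ((\<otimes>) g ` G (t - s))"
proof
  have g: "g \<in> carrier R" using assms(2) G_carrier by blast
  show "adjoin I g \<inter> G t \<subseteq> V.submodule_sum (I \<inter> G t) ((\<otimes>) g ` G (t - s))"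
  proof
    fix x assume x: "x \<in> adjoin I g \<inter> G t"
    obtain i r where *: "x = i \<oplus> g \<otimes> r" "i \<in> I" "r \<in> carrier R" using x by (auto simp: adjoin_def)
    have ic: "i \<in> carrier R" using *(2) ideal_props(1)[OF hidealD(1)[OF assms(1)]] by blast
    have "pr x t = pr i t \<oplus> pr (g \<otimes> r) t" unfolding *(1) using ic g *(3) by (intro pr_add) auto
    then have "x = pr i t \<oplus> g \<otimes> pr r (t - s)"
      using pr_mult_hom[OF assms(2) *(3), of t] assms(3) x pr_hom[of x t t] by simp
    then show "x \<in> V.submodule_sum (I \<inter> G t) ((\<otimes>) g ` G (t - s))"
      unfolding mem_ssum using hidealD(2)[OF assms(1) *(2)] pr_props(1)[OF ic] pr_props(1)[OF *(3)] by blast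
  qed
  show "V.submodule_sum (I \<inter> G t) ((\<otimes>) g ` G (t - s)) \<subseteq> adjoin I g \<inter> G t"
  proof
    fix x assume "x \<in> V.submodule_sum (I \<inter> G t) ((\<otimes>) g ` G (t - s))"
    then obtain i r where *: "i \<in> I" "i \<in> G t" "r \<in> G (t - s)" "x = i \<oplus> g \<otimes> r" by (auto simp: mem_ssum)
    then have "x \<in> adjoin I g" using G_carrier unfolding adjoin_def by blast
    moreover have "g \<otimes> r \<in> G t" using component_mult[OF assms(2) *(3)] assms(3) by simp
    ultimately show "x \<in> adjoin I g \<inter> G t" using *(2,4) G_closed(2) by simp
  qed
qed

text \<open>Multiplication by \<open>g\<close> identifies \<open>R/(I : g)\<close>, shifted by
  \<open>s\<close>, with the kernel of the projection from \<open>R/I\<close> onto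
  \<open>R/(I + gR)\<close>.\<close>

lemma hf_exact:
  assumes "hideal I" "g \<in> G s"
  shows "hf I t = hf (adjoin I g) t + (if s \<le> t then hf (colon I g) (t - s) else 0)"
proof (cases "s \<le> t")
  case False
  then show ?thesis using adjoin_G_low[OF assms] by (simp add: hf_def)
next
  case True
  have g: "g \<in> carrier R" using assms(2) G_carrier by blast
  have idI: "ideal I R" and idC: "ideal (colon I g) R" and idL: "ideal (adjoin I g) R"
    using hidealD(1) assms hideal_colon hideal_adjoin by auto
  let ?G = "G (t - s)" and ?C = "colon I g \<inter> G (t - s)"
  have i: "dm ((\<otimes>) g ` ?G) + dm ?C = dm ((\<otimes>) g ` ?C) + dm ?G"
    by (rule mult_image_sub[OF g sub_G fin_G sub_IG[OF idC]])
      (use ideal_props(2)[OF idI] G_carrier in \<open>auto simp: colon_def\<close>)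
  note mi = mult_image(2,3)[OF g sub_G fin_G, of "t - s"]
  have "(I \<inter> G t) \<inter> ((\<otimes>) g ` ?G) = (\<otimes>) g ` ?C"
    using component_mult[OF assms(2), of _ "t - s"] True G_carrier by (auto simp: colon_def)
  then have "dm (adjoin I g \<inter> G t) + dm ((\<otimes>) g ` ?C) = dm (I \<inter> G t) + dm ((\<otimes>) g ` ?G)"
    using V.sdim_sum(1)[OF sub_IG[OF idI] fin_IG[OF idI] mi(2,1), of t]
      adjoin_G[OF assms True] by simp
  then show ?thesis using i hf_add[OF idI, of t] hf_add[OF idC, of "t - s"] hf_add[OF idL, of t] True
    by simp
qed

text \<open>Only an inequality, because the shift by \<open>s\<close> drops the last
  \<open>s\<close> values for \<open>colon I g\<close>.\<close>

lemma HF_exact: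
  assumes "hideal I" "g \<in> G s"
  shows "HF I t \<le> HF (adjoin I g) t + HF (colon I g) t"
proof -
  have "HF I t = HF (adjoin I g) t + (\<Sum>i\<le>t. if s \<le> i then hf (colon I g) (i - s) else 0)"
    unfolding HF_def sum.distrib[symmetric] by (rule sum.cong[OF refl]) (rule hf_exact[OF assms])
  also have "(\<Sum>i\<le>t. if s \<le> i then hf (colon I g) (i - s) else 0)
      = (\<Sum>i\<in>{s..t}. hf (colon I g) (i - s))"
    by (simp add: sum.If_cases) (rule sum.cong, auto)
  also have "\<dots> \<le> HF (colon I g) t"
  proof -
    have "(\<Sum>i\<in>{s..t}. hf (colon I g) (i - s)) = (\<Sum>j\<in>(\<lambda>i. i - s) ` {s..t}. hf (colon I g) j)"
      by (subst sum.reindex) (auto simp: inj_on_def)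
    also have "\<dots> \<le> HF (colon I g) t" unfolding HF_def by (rule sum_mono2) auto
    finally show ?thesis .
  qed
  finally show ?thesis by simp
qed

subsection \<open>Prime filtrations\<close>

text \<open>What is kept of a filtration of \<open>R/I\<close> whose factors are shifted copies of
  \<open>R/Q\<close>: additivity of the Hilbert function, and the fact that the primes
  \<open>Q\<close> together cut out the same closed set as \<open>I\<close>.\<close>

definition prime_filtration :: "'a set \<Rightarrow> ('a set \<times> nat) list \<Rightarrow> bool" where
  "prime_filtration I L \<longleftrightarrow>
     (\<forall>(Q, s)\<in>set L. hprime Q \<and> I \<subseteq> Q) \<and>
     (\<forall>t. hf I t = (\<Sum>(Q, s)\<leftarrow>L. if s \<le> t then hf Q (t - s) else 0)) \<and>
     (\<forall>P. primeideal P R \<and> I \<subseteq> P \<longrightarrow> (\<exists>(Q, s)\<in>set L. Q \<subseteq> P)) \<and>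
     (\<forall>x\<in>carrier R. (\<forall>(Q, s)\<in>set L. x \<in> Q) \<longrightarrow> (\<exists>n::nat. x [^] n \<in> I))"

lemma exists_prime_filtration:
  assumes "hideal I"
  shows "\<exists>L. prime_filtration I L"
  using hidealD(1)[OF assms] assms
proof (induction I rule: noetherian_induct)
  case (step I)
  note I = ideal_props[OF step.hyps]
  show ?case
  proof (cases "I = carrier R")
    case True
    \<comment> \<open>For the unit ideal the empty list works: no prime contains it, and the
      exponent 0 serves in the last clause.\<close>
    have "prime_filtration I []"
      unfolding prime_filtration_def
      using True primeD(2) I(2) by (auto simp: hf_def Int_absorb1 subD(1)[OF sub_G] intro!: exI[of _ "0::nat"])
    then show ?thesis by blast
  next
    case False
    let ?A = "{colon I g | g s. g \<in> G s \<and> g \<notin> I}"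
    have "?A \<noteq> {}"
    proof
      assume "?A = {}"
      then have "G s \<subseteq> I" for s by blast
      then have "x \<in> I" if "x \<in> carrier R" for x using mem_if_pr_mem[OF I(8) that] pr_props(1)[OF that] by blast
      then show False using False I(1) by blast
    qed
    moreover have "ideal X R" if "X \<in> ?A" for X using that ideal_colon[OF step.hyps] G_carrier by blast
    ultimately have "\<exists>M\<in>?A. \<forall>X\<in>?A. M \<subseteq> X \<longrightarrow> X = M" by (rule exists_maximal_ideal_in)
    then obtain M where M: "M \<in> ?A" "\<And>X. X \<in> ?A \<Longrightarrow> M \<subseteq> X \<Longrightarrow> X = M" by (elim bexE) simp
    then obtain g s where g: "M = colon I g" "g \<in> G s" "g \<notin> I" by blast
    have gc: "g \<in> carrier R" using g(2) G_carrier by blast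
    have hM: "hideal M" unfolding g(1) by (rule hideal_colon[OF step.prems g(2)])
    have pM: "primeideal M R"
    proof (rule hideal_primeI[OF hM])
      have "\<one> \<notin> M" using g gc by (simp add: colon_def)
      then show "carrier R \<noteq> M" by blast
      fix a b i j assume ab: "a \<in> G i" "b \<in> G j" "a \<otimes> b \<in> M"
      then have abc: "a \<in> carrier R" "b \<in> carrier R" using G_carrier by auto
      show "a \<in> M \<or> b \<in> M"
      proof (rule disjCI)
        \<comment> \<open>Then \<open>colon I (g \<otimes> b)\<close> is again in the family and
          contains \<open>M\<close>, so by maximality it is \<open>M\<close>; and it contains
          \<open>a\<close>.\<close>
        assume "b \<notin> M"
        then have nb: "g \<otimes> b \<notin> I" using abc g(1) by (simp add: colon_def)
        have gb: "g \<otimes> b \<in> G (s + j)" by (rule component_mult[OF g(2) ab(2)])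
        have "colon I (g \<otimes> b) \<in> ?A" using gb nb by blast
        moreover have "M \<subseteq> colon I (g \<otimes> b)"
        proof
          fix r assume "r \<in> M"
          then have r: "r \<in> carrier R" "g \<otimes> r \<in> I" using g(1) by (auto simp: colon_def)
          have "g \<otimes> b \<otimes> r = b \<otimes> (g \<otimes> r)" using r gc abc by (simp add: m_ac)
          then show "r \<in> colon I (g \<otimes> b)" using r I(4)[OF abc(2) r(2)] by (simp add: colon_def)
        qed
        ultimately have "colon I (g \<otimes> b) = M" by (rule M(2))
        moreover have "a \<in> colon I (g \<otimes> b)"
          using ab(3) abc gc g(1) by (simp add: colon_def m_ac)
        ultimately show "a \<in> M" by simp
      qed
    qed
    let ?J = "adjoin I g"
    note J = ideal_adjoin[OF step.hyps gc]
    have "I \<subset> ?J" using J(2,3) g(3) by blast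
    from step.IH[OF J(1) this hideal_adjoin[OF step.prems g(2)]] obtain L where L: "prime_filtration ?J L" by blast
    have "prime_filtration I ((M, s) # L)"
      unfolding prime_filtration_def
    proof (intro conjI allI impI ballI)
      fix x assume "x \<in> set ((M, s) # L)"
      then show "case x of (Q, s) \<Rightarrow> hprime Q \<and> I \<subseteq> Q"
        using L hM pM colon_mono[OF step.hyps gc] J(2) g(1) unfolding prime_filtration_def by fastforce
    next
      fix t
      show "hf I t = (\<Sum>(Q, s)\<leftarrow>(M, s) # L. if s \<le> t then hf Q (t - s) else 0)"
        using L hf_exact[OF step.prems g(2), of t] g(1) unfolding prime_filtration_def by auto
    next
      fix P assume P: "primeideal P R \<and> I \<subseteq> P"
      show "\<exists>(Q, s)\<in>set ((M, s) # L). Q \<subseteq> P"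
      proof (cases "g \<in> P")
        case True
        then have "?J \<subseteq> P" using adjoin_least primeD(1) P by blast
        then show ?thesis using L P unfolding prime_filtration_def by auto
      next
        case False
        then have "M \<subseteq> P" using primeD(3)[of P g] P gc g(1) by (auto simp: colon_def)
        then show ?thesis by auto
      qed
    next
      fix x assume x: "x \<in> carrier R" and a: "\<forall>(Q, s)\<in>set ((M, s) # L). x \<in> Q"
      then obtain n :: nat where n: "x [^] n \<in> ?J" using L unfolding prime_filtration_def by auto
      then obtain i r where ir: "x [^] n = i \<oplus> g \<otimes> r" "i \<in> I" "r \<in> carrier R" by (auto simp: adjoin_def)
      \<comment> \<open>Since \<open>x\<close> multiplies \<open>g\<close> into \<open>I\<close>,
        one more factor \<open>x\<close> carries \<open>i \<oplus> g \<otimes> r\<close> into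
        \<open>I\<close>.\<close>
      have gx: "g \<otimes> x \<in> I" using a g(1) by (simp add: colon_def)
      have ic: "i \<in> carrier R" using ir(2) I(1) by blast
      have "x [^] Suc n = (i \<oplus> g \<otimes> r) \<otimes> x" using ir(1) by simp
      also have "\<dots> = i \<otimes> x \<oplus> r \<otimes> (g \<otimes> x)"
      proof -
        have "g \<otimes> r \<otimes> x = r \<otimes> (g \<otimes> x)" using ir(3) x gc by (simp add: m_ac)
        then show ?thesis using ir(3) x gc ic by (subst l_distr) auto
      qed
      finally have "x [^] Suc n = i \<otimes> x \<oplus> r \<otimes> (g \<otimes> x)" .
      then have "x [^] Suc n \<in> I" using I(3)[OF I(5)[OF x ir(2)] I(4)[OF ir(3) gx]] by simp
      then show "\<exists>n::nat. x [^] n \<in> I" by blast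
    qed
    then show ?thesis by blast
  qed
qed

lemma prime_filtrationD:
  assumes "prime_filtration I L"
  shows "\<And>Q s. (Q, s) \<in> set L \<Longrightarrow> hprime Q" "\<And>Q s. (Q, s) \<in> set L \<Longrightarrow> I \<subseteq> Q"
    "\<And>t. hf I t = (\<Sum>(Q, s)\<leftarrow>L. if s \<le> t then hf Q (t - s) else 0)"
    "\<And>P. primeideal P R \<Longrightarrow> I \<subseteq> P \<Longrightarrow> \<exists>Q s. (Q, s) \<in> set L \<and> Q \<subseteq> P"
    "\<And>x. x \<in> carrier R \<Longrightarrow> (\<And>Q s. (Q, s) \<in> set L \<Longrightarrow> x \<in> Q) \<Longrightarrow> \<exists>n::nat. x [^] n \<in> I"
  using assms unfolding prime_filtration_def by fast+

subsection \<open>Chains of primes\<close>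

text \<open>Krull dimension involves chains of arbitrary primes, for which the graded Hilbert function makes
  no sense; the codimension in the degree filtration does.\<close>

definition fcodim :: "'a set \<Rightarrow> nat \<Rightarrow> nat" where
  "fcodim I m = dm (filt m) - dm (I \<inter> filt m)"

lemma fin_filt: "fin (filt m)"
proof (induction m)
  case 0
  then show ?case using V.sfin_zero(1) by (simp add: filt_0)
next
  case (Suc m)
  then show ?case using V.sdim_sum(2)[OF sub_filt _ sub_G fin_G] by (simp add: filt_Suc(1))
qed

lemma sub_IF: "ideal I R \<Longrightarrow> sub (I \<inter> filt t)"
  by (intro V.subspace_Int ideal_props(8) sub_filt)

lemma fin_IF: "ideal I R \<Longrightarrow> fin (I \<inter> filt t)"
  by (rule fin_mono[OF sub_filt fin_filt sub_IF]) auto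

lemma fcodim_add: "ideal I R \<Longrightarrow> fcodim I t + dm (I \<inter> filt t) = dm (filt t)"
  unfolding fcodim_def using dm_mono[OF sub_filt fin_filt sub_IF, of I t] by simp

lemma fcodim_anti: "ideal I R \<Longrightarrow> ideal J R \<Longrightarrow> I \<subseteq> J \<Longrightarrow> fcodim J t \<le> fcodim I t"
  unfolding fcodim_def using dm_mono[OF sub_IF fin_IF sub_IF, of J I t] by fastforce

text \<open>\<open>filt (Suc t)\<close> is the sum of the components of degree at most
  \<open>t\<close>, and a homogeneous ideal splits along this sum.\<close>

lemma fcodim_HF: assumes "hideal I" shows "fcodim I (Suc t) = HF I t"
proof -
  have id: "ideal I R" using hidealD(1)[OF assms] .
  have s: "fcodim I (Suc m) = fcodim I m + hf I m" for m
  proof -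
    have z: "dm {\<zero>} = 0" using V.sfin_zero(2) by simp
    have 1: "dm (filt (Suc m)) = dm (filt m) + dm (G m)"
      using V.sdim_sum(1)[OF sub_filt fin_filt sub_G fin_G, of m m] filt_Suc[of m] z by simp
    have "I \<inter> filt (Suc m) = V.submodule_sum (I \<inter> filt m) (I \<inter> G m)"
    proof
      show "I \<inter> filt (Suc m) \<subseteq> V.submodule_sum (I \<inter> filt m) (I \<inter> G m)"
      proof
        fix x assume x: "x \<in> I \<inter> filt (Suc m)"
        then obtain y where y: "y \<in> filt m" "x = y \<oplus> pr x m" using filt_split by blast
        have xc: "x \<in> carrier R" "y \<in> carrier R" using x y by (auto simp: filt_def)
        have p: "pr x m \<in> I" using hidealD(2)[OF assms] x by blast
        have "y = x \<ominus> pr x m" using y(2) xc by (metis add.inv_solve_right' minus_eq pr_carrier)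
        then have "y \<in> I" using ideal_props(7)[OF id] x p by simp
        then show "x \<in> V.submodule_sum (I \<inter> filt m) (I \<inter> G m)"
          unfolding mem_ssum using y p pr_props(1)[OF xc(1)] by blast
      qed
      show "V.submodule_sum (I \<inter> filt m) (I \<inter> G m) \<subseteq> I \<inter> filt (Suc m)"
      proof
        fix x assume "x \<in> V.submodule_sum (I \<inter> filt m) (I \<inter> G m)"
        then obtain a b where "a \<in> I" "a \<in> filt m" "b \<in> I" "b \<in> G m" "x = a \<oplus> b" by (auto simp: mem_ssum)
        then show "x \<in> I \<inter> filt (Suc m)"
          using ideal_props(3)[OF id, of a b] unfolding filt_Suc(1) IntD2 mem_ssum Int_iff by simp blast
      qed
    qed
    moreover have "(I \<inter> filt m) \<inter> (I \<inter> G m) = {\<zero>}"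
      using filt_Suc(2)[of m] ideal_props(2)[OF id] by blast
    ultimately have "dm (I \<inter> filt (Suc m)) = dm (I \<inter> filt m) + dm (I \<inter> G m)"
      using V.sdim_sum(1)[OF sub_IF fin_IF sub_IG fin_IG, OF id id id id, of m m] z by simp
    then show ?thesis using 1 fcodim_add[OF id, of m] fcodim_add[OF id, of "Suc m"] hf_add[OF id, of m] by simp
  qed
  have "I \<inter> filt 0 = filt 0" using ideal_props(2)[OF id] by (auto simp: filt_0)
  then have "fcodim I 0 = 0" by (simp add: fcodim_def)
  then show ?thesis unfolding HF_def by (induction t) (simp_all add: s)
qed

lemma fcodim_mono: assumes "ideal I R" "m \<le> n" shows "fcodim I m \<le> fcodim I n"
proof -
  have "V.submodule_sum (I \<inter> filt n) (filt m) \<subseteq> filt n"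
    using filt_mono[OF assms(2)] subD(3)[OF sub_filt[of n]] by (auto simp: mem_ssum subset_iff)
  then have "dm (V.submodule_sum (I \<inter> filt n) (filt m)) \<le> dm (filt n)"
    by (intro dm_mono sub_filt fin_filt sub_ssum sub_IF assms(1))
  moreover have "(I \<inter> filt n) \<inter> filt m = I \<inter> filt m" using filt_mono[OF assms(2)] by blast
  ultimately show ?thesis
    using V.sdim_sum(1)[OF sub_IF fin_IF sub_filt fin_filt, OF assms(1) assms(1), of n m]
      fcodim_add[OF assms(1), of m] fcodim_add[OF assms(1), of n] by simp
qed

lemma fcodim_pos: assumes "primeideal P R" "m \<ge> 1" shows "fcodim P m \<ge> 1"
proof -
  note P = primeD[OF assms(1)]
  have "V.submodule_sum {\<zero>} (G 0) = G 0" using G_carrier[of _ 0] by (auto simp: mem_ssum)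
  then have "filt 1 = G 0" using filt_Suc(1)[of 0] by (simp add: filt_0)
  then have "fcodim P 1 = 1" unfolding fcodim_def using hf_0[OF P(1,2)] by (simp add: hf_def)
  then show ?thesis using fcodim_mono[OF P(1) assms(2)] by simp
qed

text \<open>Multiplication by \<open>f\<close> is injective on \<open>R/P\<close>, raises degrees by
  at most \<open>s\<close> and lands in \<open>Q/P\<close>. So \<open>Q/P\<close> in filtration step
  \<open>m + s\<close> is at least as large as \<open>R/P\<close> in step \<open>m\<close>.\<close>

lemma fcodim_step:
  assumes P: "primeideal P R" and Q: "ideal Q R" "P \<subseteq> Q" and f: "f \<in> Q" "f \<notin> P" "f \<in> filt (Suc s)"
  shows "fcodim Q (m + s) + fcodim P m \<le> fcodim P (m + s)"
proof -
  note Pi = primeD[OF P]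
  have fc: "f \<in> carrier R" using f(3) by (simp add: filt_def)
  let ?C = "P \<inter> filt m"
  have Fc: "filt k \<subseteq> carrier R" for k by (auto simp: filt_def)
  have i: "dm ((\<otimes>) f ` filt m) + dm ?C = dm ((\<otimes>) f ` ?C) + dm (filt m)"
    by (rule mult_image_sub[OF fc sub_filt fin_filt sub_IF[OF Pi(1)]])
      (use Pi(3)[OF fc] f(2) ideal_props(2)[OF Pi(1)] Fc in \<open>auto simp: subset_iff\<close>)
  note mi = mult_image(2,3)[OF fc sub_filt fin_filt, of m]
  have fF: "(\<otimes>) f ` filt m \<subseteq> filt (m + s)"
    using filt_mult[OF _ f(3), of _ m] m_comm[OF fc] Fc by (auto simp: subset_iff)
  have fQ: "(\<otimes>) f ` filt m \<subseteq> Q" using ideal_props(5)[OF Q(1) _ f(1)] Fc by auto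
  have int: "(P \<inter> filt (m + s)) \<inter> ((\<otimes>) f ` filt m) = (\<otimes>) f ` ?C"
    using fF Pi(3)[OF fc] f(2) Fc ideal_props(4)[OF Pi(1) fc] by blast
  have "V.submodule_sum (P \<inter> filt (m + s)) ((\<otimes>) f ` filt m) \<subseteq> Q \<inter> filt (m + s)"
    using fQ fF Q(2) ideal_props(3)[OF Q(1)] subD(3)[OF sub_filt[of "m + s"]] by (auto simp: mem_ssum subset_iff)
  then have "dm (V.submodule_sum (P \<inter> filt (m + s)) ((\<otimes>) f ` filt m)) \<le> dm (Q \<inter> filt (m + s))"
    by (intro dm_mono sub_IF fin_IF Q sub_ssum Pi mi)
  then show ?thesis
    using V.sdim_sum(1)[OF sub_IF[OF Pi(1)] fin_IF[OF Pi(1)] mi(2,1), of "m + s"] int i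
      fcodim_add[OF Pi(1), of m] fcodim_add[OF Pi(1), of "m + s"] fcodim_add[OF Q(1), of "m + s"] by simp
qed

text \<open>Iterating \<open>fcodim_step\<close> \<open>m + 1\<close> times gains one power of
  \<open>m\<close> on passing from \<open>Q\<close> down to \<open>P\<close>. The argument on the
  right is rounded up to a product, which simplifies later constants.\<close>

lemma fcodim_growth:
  assumes P: "primeideal P R" and Q: "primeideal Q R" "P \<subset> Q"
  obtains s where "\<And>m. (m + 1) * fcodim Q m \<le> fcodim P ((m + 1) * (s + 1))"
proof -
  obtain f where f: "f \<in> Q" "f \<notin> P" using Q(2) by blast
  note Qi = primeD[OF Q(1)]
  have fc: "f \<in> carrier R" using f(1) ideal_props(1)[OF Qi(1)] by blast
  then obtain s where "f \<in> filt s" using ex_filt by blast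
  then have fs: "f \<in> filt (Suc s)" using filt_mono[of s "Suc s"] by auto
  have it: "j * fcodim Q m \<le> fcodim P (m + j * s)" for j m
  proof (induction j)
    case (Suc j)
    have "fcodim Q m \<le> fcodim Q (m + j * s + s)" by (rule fcodim_mono[OF Qi(1)]) simp
    then show ?case using fcodim_step[OF P Qi(1) psubset_imp_subset[OF Q(2)] f fs, of "m + j * s"] Suc
      by (simp add: algebra_simps)
  qed simp
  have "(m + 1) * fcodim Q m \<le> fcodim P ((m + 1) * (s + 1))" for m
    using it[of "m + 1" m] fcodim_mono[OF primeD(1)[OF P], of "m + (m + 1) * s" "(m + 1) * (s + 1)"]
    by (simp add: algebra_simps)
  then show thesis by (rule that)
qed

section \<open>Krull dimension through chains of primes above an ideal\<close>

definition pchain :: "'a set \<Rightarrow> nat \<Rightarrow> (nat \<Rightarrow> 'a set) \<Rightarrow> bool" where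
  "pchain I n P \<longleftrightarrow> (\<forall>i\<le>n. primeideal (P i) R \<and> I \<subseteq> P i) \<and> (\<forall>i<n. P i \<subset> P (Suc i))"

text \<open>The Krull dimension of \<open>R/I\<close> in terms of primes of \<open>R\<close>; for
  the unit ideal the supremum is empty and gives 0.\<close>

definition qdim :: "'a set \<Rightarrow> enat" where
  "qdim I = (SUP n \<in> {n. \<exists>P. pchain I n P}. enat n)"

text \<open>Each strict inclusion lowers the exponent of a polynomial bound by one. A bounded
  codimension leaves no room for an inclusion, because the codimension of a prime is at least 1 from
  step 1 on.\<close>

lemma chain_bound:
  assumes "pchain I n P" "\<And>m. fcodim (P 0) m \<le> C * (m + 1) ^ d"
  shows "n \<le> d"
  using assms
proof (induction d arbitrary: n P C)
  case 0
  show ?case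
  proof (rule ccontr)
    assume "\<not> n \<le> 0"
    then have p: "primeideal (P 0) R" "primeideal (P 1) R" "P 0 \<subset> P 1"
      using 0(1) by (auto simp: pchain_def)
    obtain s where "\<And>m. (m + 1) * fcodim (P 1) m \<le> fcodim (P 0) ((m + 1) * (s + 1))"
      using fcodim_growth[OF p] by blast
    \<comment> \<open>At \<open>m = C + 1\<close> the left side is at least \<open>C + 2\<close>,
      which exceeds the constant bound \<open>C\<close>.\<close>
    from this[of "C + 1"] have "(C + 2) * fcodim (P 1) (C + 1) \<le> fcodim (P 0) ((C + 2) * (s + 1))" by simp
    also have "\<dots> \<le> C" using 0(2)[of "(C + 2) * (s + 1)"] by simp
    finally have "(C + 2) * fcodim (P 1) (C + 1) \<le> C" .
    moreover have "(C + 2) * 1 \<le> (C + 2) * fcodim (P 1) (C + 1)"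
      by (intro mult_le_mono2 fcodim_pos[OF p(2)]) simp
    ultimately have "(C + 2) * 1 \<le> C" by (rule order_trans[rotated])
    then show False by simp
  qed
next
  case (Suc d)
  show ?case
  proof (cases n)
    case (Suc k)
    then have p: "primeideal (P 0) R" "primeideal (P 1) R" "P 0 \<subset> P 1"
      using Suc.prems(1) by (auto simp: pchain_def)
    obtain s where s: "\<And>m. (m + 1) * fcodim (P 1) m \<le> fcodim (P 0) ((m + 1) * (s + 1))"
      using fcodim_growth[OF p] by blast
    have "pchain I k (\<lambda>i. P (Suc i))" using Suc.prems(1) Suc by (auto simp: pchain_def)
    \<comment> \<open>The factor \<open>(s + 2) ^ Suc d\<close> absorbs
      \<open>(m + 1) * (s + 1) + 1\<close>, which is at most \<open>(m + 1) * (s + 2)\<close>; then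
      one factor \<open>m + 1\<close> cancels.\<close>
    moreover have "fcodim (P (Suc 0)) m \<le> C * (s + 2) ^ Suc d * (m + 1) ^ d" for m
    proof -
      have "(m + 1) * fcodim (P 1) m \<le> C * ((m + 1) * (s + 1) + 1) ^ Suc d"
        using s[of m] Suc.prems(2)[of "(m + 1) * (s + 1)"] by linarith
      also have "\<dots> \<le> C * ((m + 1) * (s + 2)) ^ Suc d"
        by (intro mult_le_mono2 power_mono) auto
      also have "\<dots> = (m + 1) * (C * (s + 2) ^ Suc d * (m + 1) ^ d)"
        by (simp only: power_mult_distrib power_Suc mult_ac)
      finally show ?thesis by (subst (asm) mult_le_cancel1) simp
    qed
    ultimately have "k \<le> d" by (rule Suc.IH)
    then show ?thesis using Suc by simp
  qed simp
qed

lemma qdim_le: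
  assumes "ideal I R" "\<And>m. fcodim I m \<le> C * (m + 1) ^ d"
  shows "qdim I \<le> enat d"
  unfolding qdim_def
proof (rule SUP_least)
  fix n assume "n \<in> {n. \<exists>P. pchain I n P}"
  then obtain P where P: "pchain I n P" by blast
  then have "ideal (P 0) R" "I \<subseteq> P 0" using primeD(1) by (auto simp: pchain_def)
  then have "fcodim (P 0) m \<le> C * (m + 1) ^ d" for m
    using fcodim_anti[OF assms(1), of "P 0" m] assms(2)[of m] by linarith
  then show "enat n \<le> enat d" using chain_bound[OF P, of C d] by simp
qed

lemma qdim_anti: "I \<subseteq> J \<Longrightarrow> qdim J \<le> qdim I"
  unfolding qdim_def
proof (rule SUP_subset_mono)
  show "I \<subseteq> J \<Longrightarrow> {n. \<exists>P. pchain J n P} \<subseteq> {n. \<exists>P. pchain I n P}"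
    unfolding pchain_def by (intro Collect_mono ex_mono impI) (simp, blast)
qed simp

text \<open>\<open>P\<close> is put in front of a chain above \<open>Q\<close>. The form with
  \<open>eSuc\<close> does not presuppose that the dimensions are finite.\<close>

lemma qdim_strict:
  assumes P: "primeideal P R" and Q: "primeideal Q R" "P \<subset> Q"
  shows "eSuc (qdim Q) \<le> qdim P"
proof -
  have "pchain Q 0 (\<lambda>_. Q)" using Q by (simp add: pchain_def)
  then have ne: "enat ` {n. \<exists>P. pchain Q n P} \<noteq> {}" by blast
  have "eSuc (qdim Q) = (SUP x\<in>enat ` {n. \<exists>P. pchain Q n P}. eSuc x)"
    unfolding qdim_def using eSuc_Sup[OF ne] by simp
  also have "\<dots> \<le> qdim P"
  proof (rule SUP_least)
    fix x assume "x \<in> enat ` {n. \<exists>P. pchain Q n P}"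
    then obtain n P' where x: "x = enat n" "pchain Q n P'" by blast
    have "pchain P (Suc n) (\<lambda>i. if i = 0 then P else P' (i - 1))"
      unfolding pchain_def
    proof (intro conjI allI impI)
      fix i assume i: "i < Suc n"
      show "(if i = 0 then P else P' (i - 1)) \<subset> (if Suc i = 0 then P else P' (Suc i - 1))"
      proof (cases i)
        case 0
        then show ?thesis using x(2) Q(2) by (auto simp: pchain_def)
      next
        case (Suc j)
        then show ?thesis using x(2) i by (auto simp: pchain_def)
      qed
    next
      fix i assume i: "i \<le> Suc n"
      show "primeideal (if i = 0 then P else P' (i - 1)) R" "P \<subseteq> (if i = 0 then P else P' (i - 1))"
        using i x(2) P Q(2) by (cases i; force simp: pchain_def)+
    qed
    then have "enat (Suc n) \<le> qdim P" unfolding qdim_def by (intro SUP_upper) blast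
    then show "eSuc x \<le> qdim P" by (simp add: x(1) eSuc_enat)
  qed
  finally show ?thesis .
qed

lemma krull_dim_eq_qdim: "krull_dim R = qdim {\<zero>}"
proof -
  have "{n. \<exists>P. (\<forall>i\<le>n. primeideal (P i) R) \<and> (\<forall>i<n. P i \<subset> P (Suc i))} = {n. \<exists>P. pchain {\<zero>} n P}"
    using ideal_props(2)[OF primeD(1)] unfolding pchain_def by blast
  then show ?thesis by (simp add: krull_dim_def qdim_def)
qed

lemma coset_facts:
  assumes "ideal I R"
  shows "carrier (R Quot I) = (+>) I ` carrier R"
    "\<And>x y. x \<in> carrier R \<Longrightarrow> y \<in> carrier R \<Longrightarrow> (I +> x) \<otimes>\<^bsub>R Quot I\<^esub> (I +> y) = I +> (x \<otimes> y)"
    "\<And>x y. x \<in> carrier R \<Longrightarrow> y \<in> carrier R \<Longrightarrow> (I +> x) \<oplus>\<^bsub>R Quot I\<^esub> (I +> y) = I +> (x \<oplus> y)"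
    "\<And>x y. x \<in> carrier R \<Longrightarrow> y \<in> carrier R \<Longrightarrow> I +> x = I +> y \<longleftrightarrow> x \<ominus> y \<in> I"
    "\<zero>\<^bsub>R Quot I\<^esub> = I +> \<zero>" "\<one>\<^bsub>R Quot I\<^esub> = I +> \<one>"
    "\<And>x. x \<in> carrier R \<Longrightarrow> I +> x = \<zero>\<^bsub>R Quot I\<^esub> \<longleftrightarrow> x \<in> I"
    "cring (R Quot I)"
proof -
  interpret h: ring_hom_ring R "R Quot I" "(+>) I" by (rule ideal.rcos_ring_hom_ring[OF assms])
  show "carrier (R Quot I) = (+>) I ` carrier R" unfolding FactRing_def A_RCOSETS_def' by auto
  show "\<And>x y. x \<in> carrier R \<Longrightarrow> y \<in> carrier R \<Longrightarrow> (I +> x) \<otimes>\<^bsub>R Quot I\<^esub> (I +> y) = I +> (x \<otimes> y)"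
    "\<And>x y. x \<in> carrier R \<Longrightarrow> y \<in> carrier R \<Longrightarrow> (I +> x) \<oplus>\<^bsub>R Quot I\<^esub> (I +> y) = I +> (x \<oplus> y)"
    by simp_all
  show e: "\<And>x y. x \<in> carrier R \<Longrightarrow> y \<in> carrier R \<Longrightarrow> I +> x = I +> y \<longleftrightarrow> x \<ominus> y \<in> I"
    using quotient_eq_iff_same_a_r_cos[OF assms] by simp
  show z: "\<zero>\<^bsub>R Quot I\<^esub> = I +> \<zero>" and "\<one>\<^bsub>R Quot I\<^esub> = I +> \<one>" by simp_all
  show "I +> x = \<zero>\<^bsub>R Quot I\<^esub> \<longleftrightarrow> x \<in> I" if "x \<in> carrier R" for x
    unfolding z using e[OF that zero_closed] that by (simp add: a_minus_def)
  show "cring (R Quot I)" by (rule ideal.quotient_is_cring[OF assms is_cring])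
qed

text \<open>Primes of the quotient correspond to primes above \<open>I\<close>, and strict
  inclusions survive in both directions.\<close>

lemma krull_dim_quot:
  assumes "ideal I R"
  shows "krull_dim (R Quot I) = qdim I"
proof -
  note cf = coset_facts[OF assms]
  interpret h: ring_hom_ring R "R Quot I" "(+>) I" by (rule ideal.rcos_ring_hom_ring[OF assms])
  \<comment> \<open>An ideal above \<open>I\<close> is a union of cosets of
    \<open>I\<close>.\<close>
  have mem: "x \<in> P" if P: "ideal P R" "I \<subseteq> P" "x \<in> carrier R" "y \<in> P" "I +> x = I +> y" for P x y
  proof -
    have y: "y \<in> carrier R" using ideal_props(1)[OF P(1)] P(4) by blast
    have "x \<ominus> y \<in> P" using cf(4)[OF P(3) y] P by blast
    then have "(x \<ominus> y) \<oplus> y \<in> P" using ideal_props(3)[OF P(1)] P(4) by blast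
    then show ?thesis using P(3) y by (simp add: a_minus_def a_assoc l_neg)
  qed
  have down: "primeideal ((+>) I ` P) (R Quot I)" if P: "primeideal P R" "I \<subseteq> P" for P
  proof (rule primeidealI)
    note Pi = primeD[OF P(1)]
    have Pc: "P \<subseteq> carrier R" using ideal_props(1)[OF Pi(1)] .
    show "ideal ((+>) I ` P) (R Quot I)" by (rule ring_ideal_imp_quot_ideal[OF assms Pi(1)])
    show "cring (R Quot I)" by (rule cf(8))
    show "carrier (R Quot I) \<noteq> (+>) I ` P"
    proof
      assume "carrier (R Quot I) = (+>) I ` P"
      then obtain y where "y \<in> P" "I +> \<one> = I +> y" unfolding cf(1) by blast
      then show False using mem[OF Pi(1) P(2) one_closed] Pi(2) by blast
    qed
    fix a b assume ab: "a \<in> carrier (R Quot I)" "b \<in> carrier (R Quot I)" "a \<otimes>\<^bsub>R Quot I\<^esub> b \<in> (+>) I ` P"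
    obtain x where x: "x \<in> carrier R" "a = I +> x" using ab(1) unfolding cf(1) by (rule imageE)
    obtain y where y: "y \<in> carrier R" "b = I +> y" using ab(2) unfolding cf(1) by (rule imageE)
    obtain z where z: "z \<in> P" "a \<otimes>\<^bsub>R Quot I\<^esub> b = I +> z" using ab(3) by (rule imageE)
    note xyz = x(1) y(1) z(1) x(2) y(2) z(2)
    have "I +> (x \<otimes> y) = I +> z" using z(2) cf(2)[OF x(1) y(1)] x(2) y(2) by simp
    from mem[OF Pi(1) P(2) m_closed[OF x(1) y(1)] z(1) this] have "x \<otimes> y \<in> P" .
    then show "a \<in> (+>) I ` P \<or> b \<in> (+>) I ` P" using Pi(3) xyz by blast
  qed
  let ?v = "\<lambda>P'. {r \<in> carrier R. I +> r \<in> P'}"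
  have up: "primeideal (?v P') R \<and> I \<subseteq> ?v P'" if P': "primeideal P' (R Quot I)" for P'
  proof -
    interpret p: primeideal P' "R Quot I" by fact
    have "?v P' \<noteq> carrier R"
    proof
      assume "?v P' = carrier R"
      then have "\<one>\<^bsub>R Quot I\<^esub> \<in> P'" unfolding cf(6) by blast
      then show False using p.one_imp_carrier p.I_notcarr by simp
    qed
    moreover have "ideal (?v P') R" by (rule h.ideal_vimage) unfold_locales
    moreover have "I \<subseteq> ?v P'"
    proof
      fix x assume x: "x \<in> I"
      then have "x \<in> carrier R" using ideal_props(1)[OF assms] by blast
      then show "x \<in> ?v P'" using cf(7)[of x] x p.zero_closed by simp
    qed
    moreover have "a \<in> ?v P' \<or> b \<in> ?v P'" if "a \<in> carrier R" "b \<in> carrier R" "a \<otimes> b \<in> ?v P'" for a b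
    proof -
      have "(I +> a) \<otimes>\<^bsub>R Quot I\<^esub> (I +> b) \<in> P'" using that(3) unfolding cf(2)[OF that(1,2)] by simp
      moreover have "I +> a \<in> carrier (R Quot I)" "I +> b \<in> carrier (R Quot I)"
        unfolding cf(1) using that by auto
      ultimately show ?thesis using p.I_prime[of "I +> a" "I +> b"] that(1,2) by blast
    qed
    ultimately show ?thesis using primeidealI[OF _ is_cring] by blast
  qed
  have "{n. \<exists>P. (\<forall>i\<le>n. primeideal (P i) (R Quot I)) \<and> (\<forall>i<n. P i \<subset> P (Suc i))} = {n. \<exists>P. pchain I n P}"
  proof (intro equalityI subsetI)
    fix n assume "n \<in> {n. \<exists>P. (\<forall>i\<le>n. primeideal (P i) (R Quot I)) \<and> (\<forall>i<n. P i \<subset> P (Suc i))}"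
    then obtain P where P: "\<And>i. i \<le> n \<Longrightarrow> primeideal (P i) (R Quot I)" "\<And>i. i < n \<Longrightarrow> P i \<subset> P (Suc i)" by blast
    have "?v (P i) \<subset> ?v (P (Suc i))" if i: "i < n" for i
    proof -
      obtain y where y: "y \<in> P (Suc i)" "y \<notin> P i" using P(2)[OF i] by blast
      interpret p: primeideal "P (Suc i)" "R Quot I" using P(1)[of "Suc i"] i by simp
      obtain x where x: "x \<in> carrier R" "y = I +> x" using p.Icarr[OF y(1)] cf(1) by blast
      show ?thesis using P(2)[OF i] y x by blast
    qed
    then have "pchain I n (\<lambda>i. ?v (P i))" using up P(1) by (simp add: pchain_def)
    then show "n \<in> {n. \<exists>P. pchain I n P}" by blast
  next
    fix n assume "n \<in> {n. \<exists>P. pchain I n P}"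
    then obtain P where P: "pchain I n P" by blast
    have "(+>) I ` P i \<subset> (+>) I ` P (Suc i)" if i: "i < n" for i
    proof -
      have p: "ideal (P i) R" "I \<subseteq> P i" "P i \<subset> P (Suc i)" "ideal (P (Suc i)) R"
        using P i primeD(1) by (auto simp: pchain_def)
      obtain y where y: "y \<in> P (Suc i)" "y \<notin> P i" using p(3) by blast
      have yc: "y \<in> carrier R" using y(1) ideal_props(1)[OF p(4)] by blast
      have "I +> y \<notin> (+>) I ` P i" using mem[OF p(1,2) yc] y(2) by blast
      then show ?thesis using y(1) p(3) by blast
    qed
    then have "(\<forall>i\<le>n. primeideal ((+>) I ` P i) (R Quot I)) \<and> (\<forall>i<n. (+>) I ` P i \<subset> (+>) I ` P (Suc i))"
      using P down by (simp add: pchain_def)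
    then show "n \<in> {n. \<exists>P. (\<forall>i\<le>n. primeideal (P i) (R Quot I)) \<and> (\<forall>i<n. P i \<subset> P (Suc i))}"
      by (intro CollectI exI[of _ "\<lambda>i. (+>) I ` P i"])
  qed
  then show ?thesis by (simp add: krull_dim_def qdim_def)
qed

end

section \<open>Growth of Hilbert functions\<close>

text \<open>The Stolz-Cesaro theorem for the denominators \<open>t ^ Suc D\<close>, whose increments
  behave like \<open>(D + 1) * t ^ D\<close>; hence the divisor \<open>D + 1\<close>.\<close>

lemma sum_asymptotics:
  fixes a :: "nat \<Rightarrow> real"
  assumes "(\<lambda>t. a t / real t ^ D) \<longlonglongrightarrow> c"
  shows "(\<lambda>t. (\<Sum>i\<le>t. a i) / real t ^ Suc D) \<longlonglongrightarrow> c / (real D + 1)"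
proof -
  define b where "b t = real t ^ Suc D" for t
  define A where "A t = (\<Sum>i\<le>t. a i)" for t
  define l where "l = c / (real D + 1)"
  define x where "x t = real t / real (Suc t)" for t
  define S where "S t = (\<Sum>k<Suc D. x t ^ k)" for t
  have x1: "x \<longlonglongrightarrow> 1" unfolding x_def using LIMSEQ_n_over_Suc_n by simp
  have S: "S \<longlonglongrightarrow> real D + 1"
  proof -
    have "S \<longlonglongrightarrow> (\<Sum>k<Suc D. 1 ^ k)" unfolding S_def by (intro tendsto_sum tendsto_power x1)
    then show ?thesis by (simp add: add.commute)
  qed
  \<comment> \<open>The factorization of \<open>1 - x ^ Suc D\<close> with
    \<open>x = t / (t + 1)\<close>, scaled by \<open>(t + 1) ^ Suc D\<close>.\<close>
  have db: "b (Suc t) - b t = real (Suc t) ^ D * S t" for t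
  proof -
    have "1 - x t ^ Suc D = (1 - x t) * S t" unfolding S_def by (rule one_diff_power_eq)
    moreover have "1 - x t = 1 / real (Suc t)" by (simp add: x_def field_simps)
    moreover have "x t ^ Suc D * real (Suc t) ^ Suc D = b t"
      unfolding x_def b_def power_mult_distrib[symmetric] by (simp del: power_Suc)
    moreover have "b (Suc t) = real (Suc t) ^ Suc D" by (simp add: b_def)
    ultimately have "b (Suc t) - b t = (1 / real (Suc t) * S t) * real (Suc t) ^ Suc D"
      by (metis (no_types, lifting) left_diff_distrib mult_1)
    also have "\<dots> = real (Suc t) ^ D * S t" by (simp add: field_simps)
    finally show ?thesis .
  qed
  have Spos: "S t \<ge> 1" for t
  proof -
    have "S t = 1 + (\<Sum>k<D. x t ^ Suc k)" unfolding S_def by (simp only: sum.lessThan_Suc_shift) simp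
    then show ?thesis by (simp add: sum_nonneg x_def)
  qed
  have dbpos: "b (Suc t) - b t > 0" for t unfolding db using Spos[of t] by simp
  have r: "(\<lambda>t. a (Suc t) / (b (Suc t) - b t)) \<longlonglongrightarrow> l"
  proof -
    have "(\<lambda>t. (a (Suc t) / real (Suc t) ^ D) / S t) \<longlonglongrightarrow> c / (real D + 1)"
      by (intro tendsto_divide S LIMSEQ_Suc[OF assms]) simp
    then show ?thesis by (simp add: db l_def)
  qed
  have binf: "filterlim b at_top sequentially"
    unfolding b_def by (intro filterlim_pow_at_top filterlim_real_sequentially) simp
  have "(\<lambda>t. A t / b t) \<longlonglongrightarrow> l"
  proof (rule LIMSEQ_I)
    fix e :: real assume e: "e > 0"
    obtain N where N: "\<And>t. t \<ge> N \<Longrightarrow> \<bar>a (Suc t) / (b (Suc t) - b t) - l\<bar> < e / 2"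
      using LIMSEQ_D[OF r, of "e / 2"] e by auto
    have step: "\<bar>a (Suc t) - l * (b (Suc t) - b t)\<bar> \<le> e / 2 * (b (Suc t) - b t)" if "t \<ge> N" for t
    proof -
      have "a (Suc t) - l * (b (Suc t) - b t) = (a (Suc t) / (b (Suc t) - b t) - l) * (b (Suc t) - b t)"
        using dbpos[of t] by (simp add: field_simps)
      then have "\<bar>a (Suc t) - l * (b (Suc t) - b t)\<bar> = \<bar>a (Suc t) / (b (Suc t) - b t) - l\<bar> * (b (Suc t) - b t)"
        using dbpos[of t] by (simp add: abs_mult)
      then show ?thesis using N[OF that] dbpos[of t] by (simp add: mult_right_mono)
    qed
    \<comment> \<open>Summing the estimates for single increments from \<open>N\<close> on: the
      error stays below half of \<open>e\<close> times the growth of \<open>b\<close>.\<close>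
    have tel: "\<bar>A t - A N - l * (b t - b N)\<bar> \<le> e / 2 * (b t - b N)" if "t \<ge> N" for t
      using that
    proof (induction t rule: dec_induct)
      case (step n)
      have "A (Suc n) - A N - l * (b (Suc n) - b N) = (A n - A N - l * (b n - b N)) + (a (Suc n) - l * (b (Suc n) - b n))"
        by (simp add: A_def algebra_simps)
      also have "\<bar>\<dots>\<bar> \<le> e / 2 * (b n - b N) + e / 2 * (b (Suc n) - b n)"
        using step.IH \<open>\<And>t. t \<ge> N \<Longrightarrow> \<bar>a (Suc t) - l * (b (Suc t) - b t)\<bar> \<le> e / 2 * (b (Suc t) - b t)\<close>[OF step.hyps(1)]
        by linarith
      also have "\<dots> = e / 2 * (b (Suc n) - b N)" by (simp add: field_simps)
      finally show ?case .
    qed simp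
    \<comment> \<open>\<open>C\<close> bounds the contribution of the indices up to
      \<open>N\<close>. Once \<open>b t\<close> exceeds \<open>2 * C / e\<close>, it uses up only
      the other half of \<open>e\<close>; the summand 1 keeps it positive.\<close>
    define C where "C = \<bar>A N - l * b N\<bar> + 1"
    have bN: "b N \<ge> 0" by (simp add: b_def)
    have "eventually (\<lambda>t. b t > 2 * C / e) sequentially"
      using binf by (simp add: filterlim_at_top_dense)
    then obtain M where M: "\<And>t. t \<ge> M \<Longrightarrow> b t > 2 * C / e" unfolding eventually_sequentially by blast
    show "\<exists>no. \<forall>n\<ge>no. norm (A n / b n - l) < e"
    proof (intro exI[of _ "max N M"] allI impI)
      fix t assume t: "max N M \<le> t"
      have Cp: "C > 0" by (simp add: C_def add_nonneg_pos)
      have bt: "b t > 2 * C / e" using M t by simp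
      then have bp: "b t > 0" using Cp e by (smt (verit) divide_pos_pos)
      have "A t - l * b t = (A t - A N - l * (b t - b N)) + (A N - l * b N)" by (simp add: algebra_simps)
      then have "\<bar>A t - l * b t\<bar> \<le> e / 2 * (b t - b N) + \<bar>A N - l * b N\<bar>"
        using tel[of t] t by linarith
      also have "\<dots> < e / 2 * b t + C"
      proof -
        have "e / 2 * b N \<ge> 0" using bN e by simp
        then show ?thesis by (simp add: C_def right_diff_distrib)
      qed
      also have "\<dots> < e / 2 * b t + e / 2 * b t" using bt e by (simp add: field_simps)
      finally have "\<bar>A t - l * b t\<bar> < e * b t" by simp
      moreover have "A t / b t - l = (A t - l * b t) / b t" using bp by (simp add: field_simps)
      ultimately show "norm (A t / b t - l) < e" using bp by (simp add: abs_divide pos_divide_less_eq)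
    qed
  qed
  then show ?thesis by (simp add: A_def b_def l_def)
qed

text \<open>Shifts are invisible in the limit because \<open>t / (t + s)\<close> tends to 1.\<close>

lemma shift_asymptotics:
  fixes f :: "nat \<Rightarrow> real"
  assumes "(\<lambda>t. f t / real t ^ d) \<longlonglongrightarrow> c"
  shows "(\<lambda>t. (if s \<le> t then f (t - s) else 0) / real t ^ d) \<longlonglongrightarrow> c"
proof (rule LIMSEQ_offset[of _ s])
  have "(\<lambda>t. real t / real (t + s)) \<longlonglongrightarrow> 1"
  proof -
    have "(\<lambda>t. 1 - real s * (1 / real (t + s))) \<longlonglongrightarrow> 1 - real s * 0"
      by (intro tendsto_intros LIMSEQ_ignore_initial_segment[OF lim_1_over_n])
    moreover have "eventually (\<lambda>t. 1 - real s * (1 / real (t + s)) = real t / real (t + s)) sequentially"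
      using eventually_gt_at_top[of 0] by eventually_elim (simp add: field_simps)
    ultimately show ?thesis using Lim_transform_eventually by fastforce
  qed
  then have "(\<lambda>t. f t / real t ^ d * (real t / real (t + s)) ^ d) \<longlonglongrightarrow> c * 1 ^ d"
    by (intro tendsto_mult assms tendsto_power)
  moreover have "eventually (\<lambda>t. f t / real t ^ d * (real t / real (t + s)) ^ d =
      (if s \<le> t + s then f (t + s - s) else 0) / real (t + s) ^ d) sequentially"
    using eventually_gt_at_top[of 0] by eventually_elim (simp add: power_divide)
  ultimately show "(\<lambda>t. (if s \<le> t + s then f (t + s - s) else 0) / real (t + s) ^ d) \<longlonglongrightarrow> c"
    using Lim_transform_eventually by fastforce
qed

lemma lower_degree_asymptotics:
  fixes f :: "nat \<Rightarrow> real"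
  assumes "(\<lambda>t. f t / real t ^ d) \<longlonglongrightarrow> c" "d < D"
  shows "(\<lambda>t. f t / real t ^ D) \<longlonglongrightarrow> 0"
proof -
  have "(\<lambda>t. f t / real t ^ d * (1 / real t) ^ (D - d)) \<longlonglongrightarrow> c * 0 ^ (D - d)"
    by (intro tendsto_mult assms(1) tendsto_power lim_1_over_n)
  moreover have "eventually (\<lambda>t. f t / real t ^ d * (1 / real t) ^ (D - d) = f t / real t ^ D) sequentially"
    using eventually_gt_at_top[of 0]
  proof eventually_elim
    case (elim t)
    have "real t ^ D = real t ^ d * real t ^ (D - d)" using assms(2) by (simp flip: power_add)
    then show ?case by (simp add: power_divide)
  qed
  ultimately have "(\<lambda>t. f t / real t ^ D) \<longlonglongrightarrow> c * 0 ^ (D - d)"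
    by (rule Lim_transform_eventually)
  then show ?thesis using assms(2) by (simp add: power_0_left)
qed

context standard_graded_algebra
begin

lemma HF_shift: "(\<Sum>i\<le>t. if s \<le> i then hf Q (i - s) else 0) = (if s \<le> t then HF Q (t - s) else 0)"
  unfolding HF_def
proof (induction t)
  case (Suc t)
  show ?case
  proof (cases "s \<le> t")
    case True
    then show ?thesis using Suc by (simp add: Suc_diff_le)
  next
    case False
    then show ?thesis using Suc by (cases "s = Suc t") auto
  qed
qed simp

lemma HF_filtration:
  assumes "prime_filtration I L"
  shows "HF I t = (\<Sum>(Q, s)\<leftarrow>L. if s \<le> t then HF Q (t - s) else 0)"
proof -
  have "HF I t = (\<Sum>i\<le>t. \<Sum>(Q, s)\<leftarrow>L. if s \<le> i then hf Q (i - s) else 0)"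
    unfolding HF_def prime_filtrationD(3)[OF assms] ..
  also have "\<dots> = (\<Sum>(Q, s)\<leftarrow>L. if s \<le> t then HF Q (t - s) else 0)"
    by (induction L) (auto simp: sum.distrib HF_shift)
  finally show ?thesis .
qed

text \<open>The value \<open>c = 0\<close> is allowed, so \<open>d\<close> alone is only an upper
  bound for the growth exponent.\<close>

definition grows :: "'a set \<Rightarrow> nat \<Rightarrow> real \<Rightarrow> bool" where
  "grows I d c \<longleftrightarrow> (\<lambda>t. real (HF I t) / real t ^ d) \<longlonglongrightarrow> c"

lemma grows_filtration:
  assumes L: "prime_filtration I L" and g: "\<And>Q s. (Q, s) \<in> set L \<Longrightarrow> grows Q d (c Q)"
  shows "grows I d (\<Sum>(Q, s)\<leftarrow>L. c Q)"
proof -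
  have "(\<lambda>t. (\<Sum>(Q, s)\<leftarrow>L. (if s \<le> t then real (HF Q (t - s)) else 0) / real t ^ d)) \<longlonglongrightarrow> (\<Sum>(Q, s)\<leftarrow>L. c Q)"
    using g
  proof (induction L)
    case (Cons q L)
    obtain Q s where q: "q = (Q, s)" by (cases q)
    have "grows Q d (c Q)" using Cons.prems[of Q s] q by simp
    then have "(\<lambda>t. (if s \<le> t then real (HF Q (t - s)) else 0) / real t ^ d) \<longlonglongrightarrow> c Q"
      unfolding grows_def by (rule shift_asymptotics)
    moreover have "(\<lambda>t. (\<Sum>(Q, s)\<leftarrow>L. (if s \<le> t then real (HF Q (t - s)) else 0) / real t ^ d)) \<longlonglongrightarrow> (\<Sum>(Q, s)\<leftarrow>L. c Q)"
      by (rule Cons.IH) (use Cons.prems in auto)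
    ultimately show ?case unfolding q by (simp only: list.map sum_list.Cons prod.case) (rule tendsto_add)
  qed simp
  moreover have "(\<Sum>(Q, s)\<leftarrow>L. (if s \<le> t then real (HF Q (t - s)) else 0) / real t ^ d)
      = real (HF I t) / real t ^ d" for t
    unfolding HF_filtration[OF L] by (induction L) (auto simp: add_divide_distrib)
  ultimately show ?thesis by (simp add: grows_def)
qed

lemma grows_lower: "grows I d c \<Longrightarrow> d < D \<Longrightarrow> grows I D 0"
  unfolding grows_def by (rule lower_degree_asymptotics)

text \<open>A convergent quotient is bounded, and this is the polynomial bound on
  \<open>fcodim\<close> that limits the length of chains.\<close>

lemma qdim_le_grows:
  assumes "hideal I" "grows I d c"
  shows "qdim I \<le> enat d"
proof -
  obtain B where B: "\<And>t. \<bar>real (HF I t) / real t ^ d\<bar> \<le> B"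
    using convergent_imp_Bseq[OF convergentI[OF assms(2)[unfolded grows_def]]]
    unfolding Bseq_def by auto
  \<comment> \<open>The bound \<open>B\<close> may say nothing at \<open>t = 0\<close>, where the
    denominator can vanish; \<open>HF I 0\<close> covers that value.\<close>
  define C where "C = nat \<lceil>B\<rceil> + HF I 0"
  have "fcodim I m \<le> C * (m + 1) ^ d" for m
  proof (cases m)
    case 0
    have "fcodim I 0 = 0" using ideal_props(2)[OF hidealD(1)[OF assms(1)]] by (simp add: fcodim_def filt_0 Int_absorb1)
    then show ?thesis using 0 by simp
  next
    case (Suc t)
    have "HF I t \<le> C * (t + 2) ^ d"
    proof (cases "t = 0")
      case True
      have "HF I 0 \<le> C * 1" by (simp add: C_def)
      also have "\<dots> \<le> C * (t + 2) ^ d" by (intro mult_le_mono2) simp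
      finally show ?thesis using True by simp
    next
      case False
      have "real (HF I t) \<le> B * real t ^ d" using B[of t] False by (simp add: pos_divide_le_eq)
      also have "\<dots> \<le> real C * real (t + 2) ^ d"
      proof (rule mult_mono)
        have "B \<le> real (nat \<lceil>B\<rceil>)" by linarith
        then show "B \<le> real C" by (simp add: C_def)
      qed (auto intro: power_mono)
      finally have "real (HF I t) \<le> real (C * (t + 2) ^ d)" by simp
      then show ?thesis by (simp only: of_nat_le_iff)
    qed
    then show ?thesis using fcodim_HF[OF assms(1), of t] Suc by simp
  qed
  then show ?thesis by (rule qdim_le[OF hidealD(1)[OF assms(1)]])
qed

lemma colon_prime: "primeideal P R \<Longrightarrow> x \<in> carrier R \<Longrightarrow> x \<notin> P \<Longrightarrow> colon P x = P"
proof -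
  assume P: "primeideal P R" and x: "x \<in> carrier R" "x \<notin> P"
  have "r \<in> P" if "r \<in> carrier R" "x \<otimes> r \<in> P" for r using primeD(3)[OF P x(1) that] x(2) by simp
  then show ?thesis using colon_mono[OF primeD(1)[OF P] x(1)] by (auto simp: colon_def)
qed

lemma one_notin_adjoin:
  assumes P: "hprime P" and x: "x \<in> G 1"
  shows "\<one> \<notin> adjoin P x"
proof
  assume o: "\<one> \<in> adjoin P x"
  have "\<one> \<in> G 0" using degree_zero K_props(2) by simp
  then have "\<one> \<in> adjoin P x \<inter> G 0" using o by simp
  then have "\<one> \<in> P" using adjoin_G_low[of P x 1 0] P x by auto
  then show False using primeD(2) P by blast
qed

text \<open>The quotient by \<open>adjoin P x\<close> is nonzero in degree 0, so its filtration is
  not empty. All its primes contain \<open>x\<close> and therefore lie strictly above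
  \<open>P\<close>, where the induction hypothesis is available.\<close>

lemma adjoin_filtration_nonempty:
  assumes P: "hprime P" and x: "x \<in> G 1" "x \<notin> P" and L: "prime_filtration (adjoin P x) L"
  shows "L \<noteq> []" "\<And>Q s. (Q, s) \<in> set L \<Longrightarrow> hprime Q \<and> P \<subset> Q"
proof -
  have xc: "x \<in> carrier R" using x(1) G_carrier by blast
  note J = ideal_adjoin[OF hidealD(1)[OF conjunct1[OF P]] xc]
  show "L \<noteq> []"
  proof
    assume "L = []"
    then have "hf (adjoin P x) 0 = 0" using prime_filtrationD(3)[OF L, of 0] by simp
    then show False using hf_0[OF J(1) one_notin_adjoin[OF P x(1)]] by simp
  qed
  show "hprime Q \<and> P \<subset> Q" if "(Q, s) \<in> set L" for Q s
    using prime_filtrationD(1,2)[OF L that] J(2,3) x(2) by auto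
qed

lemma grows_irrelevant:
  assumes "ideal I R" "\<one> \<notin> I" "G 1 \<subseteq> I"
  shows "grows I 0 1"
proof -
  have "hf I (Suc n) = 0" for n
    using G_Suc_ideal[OF assms(1,3), of n] by (simp add: hf_def Int_absorb1)
  then have "HF I t = 1" for t
    unfolding HF_def using hf_0[OF assms(1,2)] by (induction t) auto
  then show ?thesis by (simp add: grows_def)
qed

text \<open>Growth bounds the dimension from above. From below it is bounded by a prime of largest
  exponent in the filtration of \<open>adjoin P x\<close>, which lies strictly above
  \<open>P\<close>. Summation raises the exponent by exactly one, so the two bounds meet.\<close>

lemma hprime_growth:
  assumes "hprime P"
  shows "\<exists>d c. 0 < c \<and> qdim P = enat d \<and> grows P d c"
  using hidealD(1)[OF conjunct1[OF assms]] assms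
proof (induction P rule: noetherian_induct)
  case (step P)
  note P = primeD[OF conjunct2[OF step.prems]]
  have h: "hideal P" and pP: "primeideal P R" using step.prems by auto
  show ?case
  proof (cases "G 1 \<subseteq> P")
    case True
    have g: "grows P 0 1" by (rule grows_irrelevant[OF P(1,2) True])
    have "qdim P = enat 0" using qdim_le_grows[OF h g] by (simp add: zero_enat_def[symmetric])
    then show ?thesis using g by (intro exI[of _ 0] exI[of _ 1]) simp
  next
    case False
    then obtain x where x: "x \<in> G 1" "x \<notin> P" by blast
    have xc: "x \<in> carrier R" using x(1) G_carrier by blast
    let ?J = "adjoin P x"
    obtain L where L: "prime_filtration ?J L" using exists_prime_filtration[OF hideal_adjoin[OF h x(1)]] by blast
    note ne = adjoin_filtration_nonempty(1)[OF step.prems x L]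
    have PQ: "P \<subset> Q" "hprime Q" if "(Q, s) \<in> set L" for Q s
      using adjoin_filtration_nonempty(2)[OF step.prems x L that] by auto
    have "\<forall>Q\<in>fst ` set L. \<exists>d c. 0 < c \<and> qdim Q = enat d \<and> grows Q d c"
      using step.IH PQ hidealD(1) by fastforce
    then obtain dd cc where dc: "\<And>Q. Q \<in> fst ` set L \<Longrightarrow> 0 < cc Q \<and> qdim Q = enat (dd Q) \<and> grows Q (dd Q) (cc Q)"
      by metis
    define D where "D = Max (dd ` fst ` set L)"
    have Dge: "dd Q \<le> D" if "Q \<in> fst ` set L" for Q unfolding D_def using that by (intro Max_ge) auto
    have "D \<in> dd ` fst ` set L" unfolding D_def using ne by (intro Max_in) auto
    then obtain Q0 where Q0: "Q0 \<in> fst ` set L" "dd Q0 = D" by blast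
    \<comment> \<open>Primes of smaller exponent contribute 0 at exponent \<open>D\<close>; the
      total is positive because of \<open>Q0\<close>.\<close>
    define c where "c Q = (if dd Q = D then cc Q else 0)" for Q
    have "grows Q D (c Q)" if "(Q, s) \<in> set L" for Q s
    proof -
      have Q: "Q \<in> fst ` set L" using that by force
      show ?thesis using dc[OF Q] Dge[OF Q] grows_lower[of Q "dd Q" "cc Q" D] by (auto simp: c_def)
    qed
    from grows_filtration[OF L this] have gJ: "grows ?J D (\<Sum>(Q, s)\<leftarrow>L. c Q)" .
    have cnn: "c Q \<ge> 0" if "Q \<in> fst ` set L" for Q using dc[OF that] by (simp add: c_def)
    have pos: "(\<Sum>(Q, s)\<leftarrow>L. c Q) > 0"
    proof -
      obtain s0 where s0: "(Q0, s0) \<in> set L" using Q0(1) by force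
      obtain xs ys where L': "L = xs @ (Q0, s0) # ys" using split_list[OF s0] by blast
      have nn: "0 \<le> (\<Sum>(Q, s)\<leftarrow>zs. c Q)" if "set zs \<subseteq> set L" for zs
      proof (rule sum_list_nonneg)
        fix y assume "y \<in> set (map (\<lambda>(Q, s). c Q) zs)"
        then obtain q where q: "q \<in> set zs" "y = c (fst q)" by auto
        then have "fst q \<in> fst ` set L" using that by blast
        then show "0 \<le> y" using cnn q(2) by simp
      qed
      have "0 \<le> (\<Sum>(Q, s)\<leftarrow>xs. c Q)" "0 \<le> (\<Sum>(Q, s)\<leftarrow>ys. c Q)"
        by (intro nn, use L' in auto)+
      then have "(\<Sum>(Q, s)\<leftarrow>L. c Q) \<ge> c Q0" unfolding L' by simp
      then show ?thesis using dc[OF Q0(1)] Q0(2) by (simp add: c_def)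
    qed
    \<comment> \<open>Since \<open>colon P x = P\<close>, \<open>hf_exact\<close> says that the
      first difference of \<open>hf P\<close> is \<open>hf ?J\<close>.\<close>
    have hfP: "hf P t = HF ?J t" for t
    proof (induction t)
      case 0
      then show ?case using hf_exact[OF h x(1), of 0] by (simp add: HF_def)
    next
      case (Suc t)
      then show ?case using hf_exact[OF h x(1), of "Suc t"] colon_prime[OF pP xc x(2)] by (simp add: HF_def)
    qed
    define e where "e = (\<Sum>(Q, s)\<leftarrow>L. c Q) / (real D + 1)"
    have "(\<lambda>t. (\<Sum>i\<le>t. real (HF ?J i)) / real t ^ Suc D) \<longlonglongrightarrow> e"
      unfolding e_def by (rule sum_asymptotics) (use gJ in \<open>simp add: grows_def\<close>)
    then have gP: "grows P (Suc D) e" by (simp add: grows_def HF_def hfP)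
    have "eSuc (qdim Q0) \<le> qdim P"
    proof -
      obtain s0 where s0: "(Q0, s0) \<in> set L" using Q0(1) by force
      then show ?thesis using qdim_strict[OF pP, of Q0] PQ[OF s0] by blast
    qed
    then have "enat (Suc D) \<le> qdim P" using dc[OF Q0(1)] Q0(2) by (simp add: eSuc_enat)
    then have "qdim P = enat (Suc D)" using qdim_le_grows[OF h gP] by simp
    moreover have "e > 0" using pos by (simp add: e_def)
    ultimately show ?thesis using gP by blast
  qed
qed

text \<open>The multiplicity of \<open>R/P\<close> over itself divided by the factorial of its
  dimension; in dimension 1 the two coincide.\<close>

definition gcoeff :: "'a set \<Rightarrow> real" where
  "gcoeff P = (THE c. grows P (the_enat (qdim P)) c)"

lemma gcoeff_props:
  assumes "hprime P"
  shows "qdim P = enat (the_enat (qdim P))" "grows P (the_enat (qdim P)) (gcoeff P)" "gcoeff P > 0"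
proof -
  obtain d c where dc: "0 < c" "qdim P = enat d" "grows P d c" using hprime_growth[OF assms] by blast
  have "gcoeff P = c" unfolding gcoeff_def
    by (rule the_equality) (use dc in \<open>auto simp: grows_def intro: LIMSEQ_unique\<close>)
  then show "qdim P = enat (the_enat (qdim P))" "grows P (the_enat (qdim P)) (gcoeff P)" "gcoeff P > 0" using dc by auto
qed

section \<open>Hilbert functions of primes in dimension one and above\<close>

lemma hf_mono_prime:
  assumes "hprime P" "qdim P \<ge> 1"
  shows "hf P t \<le> hf P (Suc t)"
proof -
  note P = primeD[OF conjunct2[OF assms(1)]]
  \<comment> \<open>Positive dimension excludes that \<open>R/P\<close> is the ground field, so
    there is a linear form outside \<open>P\<close>; multiplication by it embeds each degree of
    \<open>R/P\<close> into the next.\<close>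
  have "\<not> G 1 \<subseteq> P"
  proof
    assume a: "G 1 \<subseteq> P"
    from qdim_le_grows[OF conjunct1[OF assms(1)] grows_irrelevant[OF P(1,2) a]] show False using assms(2)
      by (simp add: zero_enat_def[symmetric])
  qed
  then obtain x where x: "x \<in> G 1" "x \<notin> P" by blast
  then show ?thesis
    using hf_exact[OF conjunct1[OF assms(1)] x(1), of "Suc t"] colon_prime[of P x] assms(1) G_carrier by simp
qed

lemma hf_mono_prime':
  assumes "hprime P" "qdim P \<ge> 1" "s \<le> t"
  shows "hf P s \<le> hf P t"
  using assms(3) by (induction t rule: dec_induct) (use hf_mono_prime[OF assms(1,2)] order_trans in blast)+

text \<open>As \<open>hf P\<close> is nondecreasing, none of its values can exceed the limiting
  slope of its sum, which is \<open>gcoeff P\<close>. A bounded nondecreasing sequence of integers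
  becomes constant, and its final value is that slope.\<close>

lemma hf_dim1:
  assumes P: "hprime P" and k: "qdim P = 1"
  shows "real (hf P t) \<le> gcoeff P" "eventually (\<lambda>t. real (hf P t) = gcoeff P) sequentially"
proof -
  have d: "the_enat (qdim P) = 1" using k by (simp add: one_enat_def)
  have g: "(\<lambda>t. real (HF P t) / real t) \<longlonglongrightarrow> gcoeff P" using gcoeff_props(2)[OF P] d by (simp add: grows_def)
  have mono: "hf P s \<le> hf P t" if "s \<le> t" for s t using hf_mono_prime'[OF P _ that] k by simp
  show le: "real (hf P t) \<le> gcoeff P" for t
  proof (rule ccontr)
    assume "\<not> real (hf P t) \<le> gcoeff P"
    \<comment> \<open>A comparison function of slope \<open>hf P t\<close>: beyond \<open>t\<close>
      every summand of \<open>HF P n\<close> is at least \<open>hf P t\<close>.\<close>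
    have "(\<lambda>n. (if t \<le> n then real (n - t) * real (hf P t) else 0) / real n ^ 1) \<longlonglongrightarrow> real (hf P t)"
    proof (rule shift_asymptotics)
      have "eventually (\<lambda>n. real (hf P t) = real n * real (hf P t) / real n ^ 1) sequentially"
        using eventually_gt_at_top[of 0] by eventually_elim simp
      then show "(\<lambda>n. real n * real (hf P t) / real n ^ 1) \<longlonglongrightarrow> real (hf P t)"
        by (rule Lim_transform_eventually[OF tendsto_const])
    qed
    moreover have "(if t \<le> n then real (n - t) * real (hf P t) else 0) / real n ^ 1 \<le> real (HF P n) / real n" for n
    proof -
      have "(n - t) * hf P t \<le> HF P n" if "t \<le> n"
      proof -
        have "(n - t) * hf P t \<le> (\<Sum>i\<in>{t<..n}. hf P t)" by simp
        also have "\<dots> \<le> (\<Sum>i\<in>{t<..n}. hf P i)" by (rule sum_mono) (use mono in auto)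
        also have "\<dots> \<le> HF P n" unfolding HF_def by (rule sum_mono2) auto
        finally show ?thesis .
      qed
      then have "real (n - t) * real (hf P t) \<le> real (HF P n)" if "t \<le> n"
        using that by (simp only: of_nat_mult[symmetric] of_nat_le_iff)
      then show ?thesis by (auto intro!: divide_right_mono)
    qed
    ultimately have "real (hf P t) \<le> gcoeff P" using LIMSEQ_le[OF _ g] by blast
    then show False using \<open>\<not> _\<close> by simp
  qed
  obtain N where N: "\<And>t. t \<ge> N \<Longrightarrow> hf P t = hf P N"
  proof -
    have fs: "finite (range (hf P))"
    proof (rule finite_subset)
      show "range (hf P) \<subseteq> {..nat \<lceil>gcoeff P\<rceil>}"
      proof (clarsimp)
        fix t show "hf P t \<le> nat \<lceil>gcoeff P\<rceil>" using le[of t] by linarith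
      qed
    qed simp
    have "Max (range (hf P)) \<in> range (hf P)" by (rule Max_in[OF fs]) simp
    then obtain N where N: "hf P N = Max (range (hf P))" by auto
    have "hf P t = hf P N" if "t \<ge> N" for t
      using mono[OF that] Max_ge[OF fs, of "hf P t"] N by simp
    then show thesis by (rule that)
  qed
  have "gcoeff P = real (hf P N)"
  proof (rule antisym)
    have "real (HF P n) / real n \<le> real (hf P N) * (1 + 1 / real n)" if "n > 0" for n
    proof -
      have "hf P i \<le> hf P N" for i using mono[of i "max i N"] N[of "max i N"] by simp
      then have "HF P n \<le> (\<Sum>i\<le>n. hf P N)" unfolding HF_def by (intro sum_mono)
      then have "real (HF P n) \<le> real (hf P N) * (real n + 1)"
        by (simp add: algebra_simps flip: of_nat_mult of_nat_add of_nat_Suc)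
      then show ?thesis using that by (simp add: field_simps)
    qed
    then have "eventually (\<lambda>n. real (HF P n) / real n \<le> real (hf P N) * (1 + 1 / real n)) sequentially"
      by (intro eventually_mono[OF eventually_gt_at_top[of 0]])
    moreover have "(\<lambda>n. real (hf P N) * (1 + 1 / real n)) \<longlonglongrightarrow> real (hf P N) * (1 + 0)"
      by (intro tendsto_intros lim_1_over_n)
    ultimately show "gcoeff P \<le> real (hf P N)"
      using tendsto_le[OF sequentially_bot _ g] by fastforce
  qed (rule le)
  then have "real (hf P t) = gcoeff P" if "t \<ge> N" for t using N[OF that] by simp
  then show "eventually (\<lambda>t. real (hf P t) = gcoeff P) sequentially"
    by (rule eventually_sequentiallyI)
qed

text \<open>Otherwise monotonicity bounds all values of \<open>hf P\<close> by \<open>l\<close>, so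
  \<open>fcodim P\<close> grows at most linearly and the dimension is at most 1.\<close>

lemma hf_unbounded:
  assumes P: "hprime P" and k: "qdim P \<ge> 2"
  shows "eventually (\<lambda>t. l \<le> hf P t) sequentially"
proof (rule ccontr)
  assume a: "\<not> eventually (\<lambda>t. l \<le> hf P t) sequentially"
  have k1: "qdim P \<ge> 1" using k order_trans[of "1::enat" 2] by simp
  have lt: "hf P t < l" for t
  proof (rule ccontr)
    assume "\<not> hf P t < l"
    then have "l \<le> hf P n" if "n \<ge> t" for n using hf_mono_prime'[OF P k1 that] by simp
    then show False using a unfolding eventually_sequentially by blast
  qed
  have "HF P t \<le> l * (t + 1)" for t
  proof -
    have "HF P t \<le> (\<Sum>i\<le>t. l)" unfolding HF_def by (rule sum_mono) (use lt in \<open>simp add: less_imp_le\<close>)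
    then show ?thesis by (simp add: algebra_simps)
  qed
  moreover have "fcodim P 0 = 0" using ideal_props(2)[OF primeD(1)] P by (simp add: fcodim_def filt_0 Int_absorb1)
  ultimately have "fcodim P m \<le> l * (m + 1) ^ 1" for m
  proof (cases m)
    case (Suc t)
    have "HF P t \<le> l * (t + 1)" by fact
    also have "\<dots> \<le> l * (m + 1) ^ 1" using Suc by (intro mult_le_mono2) simp
    finally show ?thesis using fcodim_HF[of P t] P Suc by simp
  qed simp
  then have "qdim P \<le> enat 1" using qdim_le[of P l 1] primeD(1) P by blast
  then have "2 \<le> enat 1" using k by (rule order_trans[rotated])
  then show False by (simp add: numeral_eq_enat)
qed

end

section \<open>Reduced algebras\<close>

locale reduced_graded_algebra = standard_graded_algebra +
  assumes reduced: "reduced_ring R"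
begin

abbreviation Min_primes ("\<M>") where "\<M> \<equiv> minimal_primes R"

lemma hprime_M: "P \<in> \<M> \<Longrightarrow> hprime P"
  by (rule hprime_minimal)

lemma M_minimal: "P \<in> \<M> \<Longrightarrow> primeideal Q R \<Longrightarrow> Q \<subseteq> P \<Longrightarrow> Q = P"
  by (simp add: minimal_primes_def)

text \<open>All three follow from a prime filtration of the zero ideal: every prime contains one of
  its finitely many members, and an element of all members is nilpotent, hence zero.\<close>

lemma M_basic: "finite \<M>" "\<And>P. primeideal P R \<Longrightarrow> \<exists>Q\<in>\<M>. Q \<subseteq> P"
  "\<And>x. x \<in> carrier R \<Longrightarrow> (\<And>P. P \<in> \<M> \<Longrightarrow> x \<in> P) \<Longrightarrow> x = \<zero>"
proof -
  obtain L where L: "prime_filtration {\<zero>} L" using exists_prime_filtration[OF hideal_zero] by blast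
  let ?S = "fst ` set L"
  have Sp: "primeideal Q R" if "Q \<in> ?S" for Q using that prime_filtrationD(1)[OF L] by auto
  have contains: "\<exists>Q\<in>?S. Q \<subseteq> P" if P: "primeideal P R" for P
  proof -
    have "{\<zero>} \<subseteq> P" using ideal_props(2)[OF primeD(1)[OF P]] by simp
    from prime_filtrationD(4)[OF L P this] show ?thesis by force
  qed
  have "\<M> \<subseteq> ?S"
  proof
    fix P assume P: "P \<in> \<M>"
    then obtain Q where Q: "Q \<in> ?S" "Q \<subseteq> P" using contains[OF conjunct2[OF hprime_M[OF P]]] by blast
    then show "P \<in> ?S" using M_minimal[OF P Sp[OF Q(1)] Q(2)] by simp
  qed
  then show "finite \<M>" by (rule finite_subset) simp
  show mc: "\<exists>Q\<in>\<M>. Q \<subseteq> P" if P: "primeideal P R" for P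
  proof -
    obtain Q where Q: "Q \<in> ?S" "Q \<subseteq> P" using contains[OF P] by blast
    \<comment> \<open>Minimal among the members means minimal among all primes, because every prime
      contains a member.\<close>
    obtain Q' where Q': "Q' \<in> ?S" "Q' \<subseteq> Q" "\<And>X. X \<in> ?S \<Longrightarrow> X \<subseteq> Q' \<Longrightarrow> X = Q'"
      using finite_has_minimal2[of ?S Q] Q(1) by (metis List.finite_set finite_imageI)
    have "Q' \<in> \<M>"
      unfolding minimal_primes_def
    proof (intro CollectI conjI allI impI)
      show "primeideal Q' R" by (rule Sp[OF Q'(1)])
      fix X assume X: "primeideal X R \<and> X \<subseteq> Q'"
      then obtain Y where "Y \<in> ?S" "Y \<subseteq> X" using contains[of X] by blast
      then show "X = Q'" using Q'(3)[of Y] X by blast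
    qed
    then show ?thesis using Q'(2) Q(2) by blast
  qed
  show "x = \<zero>" if x: "x \<in> carrier R" "\<And>P. P \<in> \<M> \<Longrightarrow> x \<in> P" for x
  proof -
    have "x \<in> Q" if "(Q, s) \<in> set L" for Q s
      using mc[of Q] prime_filtrationD(1)[OF L that] x(2) by blast
    then have "\<exists>n::nat. x [^] n \<in> {\<zero>}" using prime_filtrationD(5)[OF L x(1)] by blast
    then obtain n :: nat where "x [^] n = \<zero>" by blast
    then show ?thesis using reduced x(1) unfolding reduced_ring_def by blast
  qed
qed

section \<open>Separators of the minimal primes\<close>

lemma prime_avoid_Inter:
  assumes P: "primeideal P R" and S: "finite S" "\<And>I. I \<in> S \<Longrightarrow> ideal I R \<and> \<not> I \<subseteq> P"
  shows "\<exists>x\<in>carrier R. x \<notin> P \<and> (\<forall>I\<in>S. x \<in> I)"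
  using S
proof (induction S)
  case empty
  then show ?case using primeD(2)[OF P] by auto
next
  case (insert I S)
  then obtain x where x: "x \<in> carrier R" "x \<notin> P" "\<And>J. J \<in> S \<Longrightarrow> x \<in> J" by blast
  have I: "ideal I R" "\<not> I \<subseteq> P" using insert.prems by auto
  obtain y where y: "y \<in> I" "y \<notin> P" using I(2) by blast
  have yc: "y \<in> carrier R" using y(1) ideal_props(1)[OF I(1)] by blast
  have "x \<otimes> y \<notin> P" using primeD(3)[OF P x(1) yc] x(2) y(2) by blast
  moreover have "x \<otimes> y \<in> I" by (rule ideal_props(4)[OF I(1) x(1) y(1)])
  moreover have "x \<otimes> y \<in> J" if "J \<in> S" for J
    using ideal_props(5)[of J y x] insert.prems[of J] that yc x(3) by blast
  ultimately show ?case using x(1) yc by (intro bexI[of _ "x \<otimes> y"]) auto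
qed

lemma prime_contains_Inter:
  assumes P: "primeideal P R" and S: "finite S" "\<And>I. I \<in> S \<Longrightarrow> ideal I R" and sub: "\<Inter>S \<subseteq> P" "S \<noteq> {}"
  shows "\<exists>I\<in>S. I \<subseteq> P"
proof (rule ccontr)
  assume "\<not> ?thesis"
  then obtain x where "x \<notin> P" "\<forall>I\<in>S. x \<in> I" using prime_avoid_Inter[OF P S(1)] S(2) by blast
  then show False using sub by blast
qed

text \<open>No other minimal prime lies inside \<open>P\<close>, so some element of all the others
  avoids \<open>P\<close>. One of its components still avoids \<open>P\<close>, and homogeneity
  keeps that component in the others.\<close>

lemma exists_separator:
  assumes P: "P \<in> \<M>"
  shows "\<exists>s f. f \<in> G s \<and> f \<notin> P \<and> (\<forall>P'\<in>\<M> - {P}. f \<in> P')"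
proof -
  have pP: "primeideal P R" using hprime_M[OF P] by simp
  have "\<not> I \<subseteq> P" if "I \<in> \<M> - {P}" for I
    using M_minimal[OF P, of I] hprime_M[of I] that by blast
  then obtain x where x: "x \<in> carrier R" "x \<notin> P" "\<And>I. I \<in> \<M> - {P} \<Longrightarrow> x \<in> I"
    using prime_avoid_Inter[OF pP, of "\<M> - {P}"] M_basic(1) hprime_M primeD(1) by (metis DiffD1 finite_Diff)
  obtain i where "pr x i \<notin> P" using mem_if_pr_mem[OF ideal_props(8)[OF primeD(1)[OF pP]] x(1)] x(2) by blast
  moreover have "pr x i \<in> I" if "I \<in> \<M> - {P}" for I
    using hidealD(2)[of I x i] hprime_M[of I] x(3)[OF that] that by blast
  ultimately show ?thesis using pr_props(1)[OF x(1)] by blast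
qed

text \<open>The degree is fixed first: it is the shift in the embedding of \<open>R/P\<close> into
  \<open>R\<close> by multiplication with \<open>sep P\<close>.\<close>

definition sdeg :: "'a set \<Rightarrow> nat" where
  "sdeg P = (SOME s. \<exists>f. f \<in> G s \<and> f \<notin> P \<and> (\<forall>P'\<in>\<M> - {P}. f \<in> P'))"

definition sep :: "'a set \<Rightarrow> 'a" where
  "sep P = (SOME f. f \<in> G (sdeg P) \<and> f \<notin> P \<and> (\<forall>P'\<in>\<M> - {P}. f \<in> P'))"

lemma sep_props:
  assumes "P \<in> \<M>"
  shows "sep P \<in> G (sdeg P)" "sep P \<notin> P" "\<And>P'. P' \<in> \<M> \<Longrightarrow> P' \<noteq> P \<Longrightarrow> sep P \<in> P'" "sep P \<in> carrier R"
proof -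
  have "\<exists>f. f \<in> G (sdeg P) \<and> f \<notin> P \<and> (\<forall>P'\<in>\<M> - {P}. f \<in> P')"
    unfolding sdeg_def by (rule someI_ex[OF exists_separator[OF assms]])
  from someI_ex[OF this] have *: "sep P \<in> G (sdeg P) \<and> sep P \<notin> P \<and> (\<forall>P'\<in>\<M> - {P}. sep P \<in> P')"
    unfolding sep_def .
  then show "sep P \<in> G (sdeg P)" "sep P \<notin> P" "\<And>P'. P' \<in> \<M> \<Longrightarrow> P' \<noteq> P \<Longrightarrow> sep P \<in> P'" by auto
  then show "sep P \<in> carrier R" using G_carrier by blast
qed

text \<open>For \<open>x \<in> P\<close> the product lies in every minimal prime: in
  \<open>P\<close> through \<open>x\<close>, in the others through the separator.\<close>

lemma sep_mult_zero:
  assumes P: "P \<in> \<M>" and x: "x \<in> carrier R"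
  shows "sep P \<otimes> x = \<zero> \<longleftrightarrow> x \<in> P"
proof
  note sp = sep_props[OF P]
  have pP: "primeideal P R" using hprime_M[OF P] by simp
  show "sep P \<otimes> x = \<zero> \<Longrightarrow> x \<in> P"
    using primeD(3)[OF pP sp(4) x] sp(2) ideal_props(2)[OF primeD(1)[OF pP]] by auto
  assume xP: "x \<in> P"
  show "sep P \<otimes> x = \<zero>"
  proof (rule M_basic(3))
    show "sep P \<otimes> x \<in> carrier R" using sp(4) x by simp
    fix P' assume P': "P' \<in> \<M>"
    have id: "ideal P' R" using hprime_M[OF P'] hidealD(1) by blast
    show "sep P \<otimes> x \<in> P'"
      using ideal_props(4)[OF id sp(4), of x] ideal_props(5)[OF id x, of "sep P"] sp(3)[OF P'] xP
      by (cases "P' = P") auto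
  qed
qed

text \<open>Forms that vanish on every component outside \<open>\<tau>\<close>. Finding families
  with prescribed vanishing amounts to finding independent elements in this space.\<close>

definition off :: "'a set set \<Rightarrow> nat \<Rightarrow> 'a set" where
  "off \<tau> t = {x \<in> G t. \<forall>P\<in>\<M> - \<tau>. x \<in> P}"

lemma off_sub: "sub (off \<tau> t)" "fin (off \<tau> t)" "off \<tau> t \<subseteq> G t"
proof -
  show s: "sub (off \<tau> t)"
  proof (rule subI)
    have id: "sub P" if "P \<in> \<M>" for P using hprime_M[OF that] hidealD(1) ideal_props(8) by blast
    note d = subD[OF sub_G[of t]]
    show "off \<tau> t \<subseteq> carrier R" using d(1) by (auto simp: off_def)
    show "\<zero> \<in> off \<tau> t" using d(2) subD(2)[OF id] by (auto simp: off_def)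
    show "\<And>v w. v \<in> off \<tau> t \<Longrightarrow> w \<in> off \<tau> t \<Longrightarrow> v \<oplus> w \<in> off \<tau> t"
      using d(3) subD(3)[OF id] by (auto simp: off_def)
    show "\<And>c v. c \<in> K \<Longrightarrow> v \<in> off \<tau> t \<Longrightarrow> c \<otimes> v \<in> off \<tau> t"
      using d(4) subD(4)[OF id] by (auto simp: off_def)
  qed
  show "off \<tau> t \<subseteq> G t" by (auto simp: off_def)
  then show "fin (off \<tau> t)" using fin_mono[OF sub_G fin_G s] by blast
qed

text \<open>Each separator contributes a shifted copy of \<open>R/P\<close>. The copies are
  independent, since an element common to \<open>off \<tau> t\<close> and the copy for a further
  \<open>P\<close> lies in all minimal primes.\<close>

lemma dm_off:
  assumes "finite \<tau>" "\<tau> \<subseteq> \<M>"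
  shows "(\<Sum>P\<in>\<tau>. if sdeg P \<le> t then hf P (t - sdeg P) else 0) \<le> dm (off \<tau> t)"
  using assms
proof (induction \<tau>)
  case (insert P \<tau>)
  have P: "P \<in> \<M>" and tau: "\<tau> \<subseteq> \<M>" using insert.prems by auto
  note sp = sep_props[OF P]
  have IH: "(\<Sum>P\<in>\<tau>. if sdeg P \<le> t then hf P (t - sdeg P) else 0) \<le> dm (off \<tau> t)" by (rule insert.IH[OF tau])
  have Umono: "off \<tau> t \<subseteq> off (insert P \<tau>) t" by (auto simp: off_def)
  show ?case
  proof (cases "sdeg P \<le> t")
    case False
    have "dm (off \<tau> t) \<le> dm (off (insert P \<tau>) t)" by (intro dm_mono off_sub Umono)
    then show ?thesis using IH False insert.hyps by simp
  next
    case True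
    let ?W = "(\<otimes>) (sep P) ` G (t - sdeg P)"
    have idP: "ideal P R" using hprime_M[OF P] hidealD(1) by blast
    note mi = mult_image[OF sp(4) sub_G fin_G, of "t - sdeg P"]
    have "{u \<in> G (t - sdeg P). sep P \<otimes> u = \<zero>} = P \<inter> G (t - sdeg P)"
      using sep_mult_zero[OF P] G_carrier by blast
    then have dW: "dm ?W = hf P (t - sdeg P)" using mi(1) hf_add[OF idP, of "t - sdeg P"] by simp
    have WU: "?W \<subseteq> off (insert P \<tau>) t"
    proof
      fix x assume "x \<in> ?W"
      then obtain y where y: "y \<in> G (t - sdeg P)" "x = sep P \<otimes> y" by blast
      have "x \<in> G t" using component_mult[OF sp(1) y(1)] y(2) True by simp
      moreover have "x \<in> P'" if "P' \<in> \<M> - insert P \<tau>" for P'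
      proof -
        have "ideal P' R" using hprime_M[of P'] that hidealD(1) by blast
        then show ?thesis using ideal_props(5)[of P' y "sep P"] sp(3)[of P'] that y G_carrier by auto
      qed
      ultimately show "x \<in> off (insert P \<tau>) t" by (auto simp: off_def)
    qed
    have "off \<tau> t \<inter> ?W = {\<zero>}"
    proof
      show "{\<zero>} \<subseteq> off \<tau> t \<inter> ?W" using subD(2)[OF off_sub(1)] subD(2)[OF mi(3)] by simp
      show "off \<tau> t \<inter> ?W \<subseteq> {\<zero>}"
      proof
        fix x assume x: "x \<in> off \<tau> t \<inter> ?W"
        have "x = \<zero>"
        proof (rule M_basic(3))
          show "x \<in> carrier R" using x subD(1)[OF off_sub(1)] by blast
          fix P' assume P': "P' \<in> \<M>"
          show "x \<in> P'"
          proof (cases "P' \<in> insert P \<tau>")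
            case False
            then show ?thesis using x WU P' by (auto simp: off_def)
          next
            case True
            show ?thesis
            proof (cases "P' = P")
              case True
              then show ?thesis using x P' insert.hyps(2) by (auto simp: off_def)
            next
              case False
              obtain y where y: "y \<in> G (t - sdeg P)" "x = sep P \<otimes> y" using x by blast
              have "ideal P' R" using hprime_M[OF P'] hidealD(1) by blast
              then show ?thesis using ideal_props(5)[of P' y "sep P"] sp(3)[OF P' False] y G_carrier by auto
            qed
          qed
        qed
        then show "x \<in> {\<zero>}" by simp
      qed
    qed
    then have "dm (V.submodule_sum (off \<tau> t) ?W) = dm (off \<tau> t) + hf P (t - sdeg P)"
      using V.sdim_sum(1)[OF off_sub(1,2) mi(3,2), of \<tau> t] V.sfin_zero(2) dW by simp
    moreover have "V.submodule_sum (off \<tau> t) ?W \<subseteq> off (insert P \<tau>) t"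
    proof
      fix x assume "x \<in> V.submodule_sum (off \<tau> t) ?W"
      then obtain a b where "a \<in> off \<tau> t" "b \<in> ?W" "x = a \<oplus> b" unfolding mem_ssum by blast
      then show "x \<in> off (insert P \<tau>) t" using subD(3)[OF off_sub(1), of a "insert P \<tau>" t b] Umono WU by blast
    qed
    then have "dm (V.submodule_sum (off \<tau> t) ?W) \<le> dm (off (insert P \<tau>) t)"
      by (intro dm_mono off_sub sub_ssum mi)
    ultimately show ?thesis using IH True insert.hyps by simp
  qed
qed simp

text \<open>A form of \<open>J\<close> in \<open>off \<tau> t\<close> lies in every minimal prime
  and is zero, so \<open>off \<tau> t\<close> embeds into degree \<open>t\<close> of
  \<open>R/J\<close>.\<close>

lemma dm_U_le_hf:
  assumes J: "ideal J R" and "\<And>P. P \<in> \<M> \<Longrightarrow> P \<in> \<tau> \<Longrightarrow> J \<subseteq> P"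
  shows "dm (off \<tau> t) \<le> hf J t"
proof -
  have "off \<tau> t \<inter> (J \<inter> G t) = {\<zero>}"
  proof
    show "{\<zero>} \<subseteq> off \<tau> t \<inter> (J \<inter> G t)"
      using subD(2)[OF off_sub(1)] subD(2)[OF sub_IG[OF J]] by simp
    show "off \<tau> t \<inter> (J \<inter> G t) \<subseteq> {\<zero>}"
    proof
      fix x assume x: "x \<in> off \<tau> t \<inter> (J \<inter> G t)"
      have "x = \<zero>"
      proof (rule M_basic(3))
        show "x \<in> carrier R" using x subD(1)[OF off_sub(1)] by blast
        fix P assume "P \<in> \<M>"
        then show "x \<in> P" using x assms(2)[of P] by (auto simp: off_def)
      qed
      then show "x \<in> {\<zero>}" by simp
    qed
  qed
  then have "dm (V.submodule_sum (off \<tau> t) (J \<inter> G t)) = dm (off \<tau> t) + dm (J \<inter> G t)"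
    using V.sdim_sum(1)[OF off_sub(1,2) sub_IG fin_IG, OF J J, of \<tau> t t] V.sfin_zero(2) by simp
  moreover have "V.submodule_sum (off \<tau> t) (J \<inter> G t) \<subseteq> G t"
  proof
    fix x assume "x \<in> V.submodule_sum (off \<tau> t) (J \<inter> G t)"
    then obtain a b where "a \<in> off \<tau> t" "b \<in> G t" "x = a \<oplus> b" unfolding mem_ssum by blast
    then show "x \<in> G t" using G_closed(2)[of a t b] off_sub(3) by blast
  qed
  then have "dm (V.submodule_sum (off \<tau> t) (J \<inter> G t)) \<le> dm (G t)"
    by (intro dm_mono off_sub sub_ssum sub_G fin_G sub_IG J)
  ultimately show ?thesis using hf_add[OF J, of t] by simp
qed

text \<open>The quotient by the intersection embeds into the product of the two quotients.\<close>

lemma hf_Int_le: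
  assumes "ideal I R" "ideal J R"
  shows "hf (I \<inter> J) t \<le> hf I t + hf J t"
proof -
  have IJ: "ideal (I \<inter> J) R" using i_intersect assms by blast
  have "V.submodule_sum (I \<inter> G t) (J \<inter> G t) \<subseteq> G t"
  proof
    fix x assume "x \<in> V.submodule_sum (I \<inter> G t) (J \<inter> G t)"
    then obtain a b where "a \<in> G t" "b \<in> G t" "x = a \<oplus> b" unfolding mem_ssum by blast
    then show "x \<in> G t" using G_closed(2)[of a t b] by simp
  qed
  then have "dm (V.submodule_sum (I \<inter> G t) (J \<inter> G t)) \<le> dm (G t)"
    by (intro dm_mono sub_ssum sub_G fin_G sub_IG assms)
  moreover have "(I \<inter> G t) \<inter> (J \<inter> G t) = (I \<inter> J) \<inter> G t" by blast
  ultimately show ?thesis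
    using V.sdim_sum(1)[OF sub_IG fin_IG sub_IG fin_IG, OF assms(1) assms(1) assms(2) assms(2), of t t]
      hf_add[OF IJ, of t] hf_add[OF assms(1), of t] hf_add[OF assms(2), of t] by simp
qed

lemma hf_INT_le:
  assumes "finite \<tau>" "\<tau> \<noteq> {}" "\<And>P. P \<in> \<tau> \<Longrightarrow> hideal P"
  shows "hf (\<Inter>\<tau>) t \<le> (\<Sum>P\<in>\<tau>. hf P t)"
  using assms
proof (induction \<tau> rule: finite_ne_induct)
  case (insert P \<tau>)
  have "ideal (\<Inter>\<tau>) R" using hideal_INT[of \<tau>] insert hidealD(1) by blast
  moreover have "ideal P R" using insert.prems hidealD(1) by blast
  ultimately have "hf (P \<inter> \<Inter>\<tau>) t \<le> hf P t + hf (\<Inter>\<tau>) t" by (intro hf_Int_le)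
  then show ?case using insert by fastforce
qed simp

lemma HF_lower:
  assumes J: "ideal J R" and tau: "\<tau> \<subseteq> \<M>" "\<And>P. P \<in> \<tau> \<Longrightarrow> J \<subseteq> P"
  shows "(\<Sum>P\<in>\<tau>. if sdeg P \<le> t then HF P (t - sdeg P) else 0) \<le> HF J t"
proof -
  have f: "finite \<tau>" using finite_subset[OF tau(1) M_basic(1)] .
  have "(\<Sum>P\<in>\<tau>. if sdeg P \<le> t then HF P (t - sdeg P) else 0)
      = (\<Sum>i\<le>t. \<Sum>P\<in>\<tau>. if sdeg P \<le> i then hf P (i - sdeg P) else 0)"
    unfolding HF_shift[symmetric] by (rule sum.swap)
  also have "\<dots> \<le> HF J t"
    unfolding HF_def
  proof (rule sum_mono)
    fix i
    show "(\<Sum>P\<in>\<tau>. if sdeg P \<le> i then hf P (i - sdeg P) else 0) \<le> hf J i"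
      using dm_off[OF f tau(1), of i] dm_U_le_hf[OF J, of \<tau> i] tau(2) by (meson le_trans)
  qed
  finally show ?thesis .
qed

text \<open>Adjoining \<open>sep P\<close> costs at most one copy of \<open>R/P\<close>, because
  \<open>P\<close> annihilates \<open>sep P\<close>. The remaining ideal \<open>L\<close> contains
  the separators of all \<open>P \<in> \<tau>\<close>, which later makes \<open>R/L\<close>
  negligible.\<close>

lemma HF_upper:
  assumes J: "hideal J" and tau: "finite \<tau>" "\<tau> \<subseteq> \<M>"
  shows "\<exists>L. hideal L \<and> J \<subseteq> L \<and> (\<forall>P\<in>\<tau>. sep P \<in> L) \<and> (\<forall>t. HF J t \<le> HF L t + (\<Sum>P\<in>\<tau>. HF P t))"
  using tau
proof (induction \<tau>)
  case empty
  then show ?case using J by auto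
next
  case (insert P \<tau>)
  then obtain L where L: "hideal L" "J \<subseteq> L" "\<And>P. P \<in> \<tau> \<Longrightarrow> sep P \<in> L"
    "\<And>t. HF J t \<le> HF L t + (\<Sum>P\<in>\<tau>. HF P t)" by auto
  have P: "P \<in> \<M>" using insert.prems by simp
  note sp = sep_props[OF P]
  note idL = hidealD(1)[OF L(1)]
  have idP: "ideal P R" using hprime_M[OF P] hidealD(1) by blast
  note A = ideal_adjoin[OF idL sp(4)]
  have "P \<subseteq> colon L (sep P)"
  proof
    fix x assume x: "x \<in> P"
    then have "x \<in> carrier R" using ideal_props(1)[OF idP] by blast
    then show "x \<in> colon L (sep P)" using iffD2[OF sep_mult_zero[OF P] x] ideal_props(2)[OF idL] by (simp add: colon_def)
  qed
  then have "HF (colon L (sep P)) t \<le> HF P t" for t by (rule HF_anti[OF idP ideal_colon[OF idL sp(4)]])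
  then have "HF J t \<le> HF (adjoin L (sep P)) t + (\<Sum>P\<in>insert P \<tau>. HF P t)" for t
    using HF_exact[OF L(1) sp(1), of t] L(4)[of t] unfolding sum.insert[OF insert.hyps]
    using \<open>\<And>t. HF (colon L (sep P)) t \<le> HF P t\<close>[of t] by linarith
  then show ?case using hideal_adjoin[OF L(1) sp(1)] A L(2,3)
    by (intro exI[of _ "adjoin L (sep P)"]) auto
qed

section \<open>Leading coefficients in the top dimension\<close>

definition top_coeff :: "nat \<Rightarrow> 'a set \<Rightarrow> real" where
  "top_coeff d P = (if qdim P = enat d then gcoeff P else 0)"

lemma grows_top:
  assumes "hprime P" "qdim P \<le> enat d"
  shows "grows P d (top_coeff d P)"
proof (cases "qdim P = enat d")
  case True
  then show ?thesis using gcoeff_props(2)[OF assms(1)] by (simp add: top_coeff_def)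
next
  case False
  then have "the_enat (qdim P) < d"
    using assms(2) gcoeff_props(1)[OF assms(1)] by (metis enat_ord_simps(2) less_le)
  then show ?thesis using grows_lower[OF gcoeff_props(2)[OF assms(1)]] False by (simp add: top_coeff_def)
qed

lemma grows_squeeze:
  assumes "\<And>t. g t \<le> HF J t" "\<And>t. HF J t \<le> h t"
    "(\<lambda>t. real (g t) / real t ^ d) \<longlonglongrightarrow> c" "(\<lambda>t. real (h t) / real t ^ d) \<longlonglongrightarrow> c"
  shows "grows J d c"
  unfolding grows_def
  by (rule tendsto_sandwich[OF _ _ assms(3,4)]) (use assms(1,2) in \<open>auto intro!: divide_right_mono always_eventually\<close>)

lemma grows_sum:
  assumes "finite \<tau>" "\<And>P. P \<in> \<tau> \<Longrightarrow> grows P d (c P)"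
  shows "(\<lambda>t. real (\<Sum>P\<in>\<tau>. HF P t) / real t ^ d) \<longlonglongrightarrow> (\<Sum>P\<in>\<tau>. c P)"
    and "(\<lambda>t. real (\<Sum>P\<in>\<tau>. if s P \<le> t then HF P (t - s P) else 0) / real t ^ d) \<longlonglongrightarrow> (\<Sum>P\<in>\<tau>. c P)"
proof -
  have "(\<lambda>t. \<Sum>P\<in>\<tau>. real (HF P t) / real t ^ d) \<longlonglongrightarrow> (\<Sum>P\<in>\<tau>. c P)"
    by (rule tendsto_sum) (use assms(2) in \<open>simp add: grows_def\<close>)
  then show "(\<lambda>t. real (\<Sum>P\<in>\<tau>. HF P t) / real t ^ d) \<longlonglongrightarrow> (\<Sum>P\<in>\<tau>. c P)"
    by (simp add: sum_divide_distrib)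
  have "(\<lambda>t. \<Sum>P\<in>\<tau>. (if s P \<le> t then real (HF P (t - s P)) else 0) / real t ^ d) \<longlonglongrightarrow> (\<Sum>P\<in>\<tau>. c P)"
    by (rule tendsto_sum, rule shift_asymptotics) (use assms(2) in \<open>simp add: grows_def\<close>)
  moreover have "real (\<Sum>P\<in>\<tau>. if s P \<le> t then HF P (t - s P) else 0) / real t ^ d
      = (\<Sum>P\<in>\<tau>. (if s P \<le> t then real (HF P (t - s P)) else 0) / real t ^ d)" for t
    by (simp add: sum_divide_distrib if_distrib cong: if_cong)
  ultimately show "(\<lambda>t. real (\<Sum>P\<in>\<tau>. if s P \<le> t then HF P (t - s P) else 0) / real t ^ d) \<longlonglongrightarrow> (\<Sum>P\<in>\<tau>. c P)"
    by simp
qed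

lemma grows_INT:
  assumes tau: "\<tau> \<subseteq> \<M>" "\<tau> \<noteq> {}" and g: "\<And>P. P \<in> \<tau> \<Longrightarrow> grows P d (c P)"
  shows "grows (\<Inter>\<tau>) d (\<Sum>P\<in>\<tau>. c P)"
proof (rule grows_squeeze)
  have f: "finite \<tau>" using finite_subset[OF tau(1) M_basic(1)] .
  have h: "hideal P" if "P \<in> \<tau>" for P using hprime_M tau(1) that by blast
  show "(\<Sum>P\<in>\<tau>. if sdeg P \<le> t then HF P (t - sdeg P) else 0) \<le> HF (\<Inter>\<tau>) t" for t
    by (rule HF_lower[OF hidealD(1)[OF hideal_INT[OF h tau(2)]] tau(1)]) auto
  show "HF (\<Inter>\<tau>) t \<le> (\<Sum>P\<in>\<tau>. HF P t)" for t
    unfolding HF_def by (subst sum.swap, rule sum_mono, rule hf_INT_le[OF f tau(2) h])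
  show "(\<lambda>t. real (\<Sum>P\<in>\<tau>. HF P t) / real t ^ d) \<longlonglongrightarrow> (\<Sum>P\<in>\<tau>. c P)" by (rule grows_sum(1)[OF f g])
  show "(\<lambda>t. real (\<Sum>P\<in>\<tau>. if sdeg P \<le> t then HF P (t - sdeg P) else 0) / real t ^ d) \<longlonglongrightarrow> (\<Sum>P\<in>\<tau>. c P)"
    by (rule grows_sum(2)[OF f g])
qed

text \<open>A prime above a finite intersection contains one of the members, so every chain lies
  above a single member.\<close>

lemma qdim_INT:
  assumes tau: "\<tau> \<subseteq> \<M>" "\<tau> \<noteq> {}" and k: "\<And>P. P \<in> \<tau> \<Longrightarrow> qdim P = D"
  shows "qdim (\<Inter>\<tau>) = D"
proof (rule antisym)
  have f: "finite \<tau>" using finite_subset[OF tau(1) M_basic(1)] .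
  show "qdim (\<Inter>\<tau>) \<le> D"
    unfolding qdim_def
  proof (rule SUP_least)
    fix n assume "n \<in> {n. \<exists>P. pchain (\<Inter>\<tau>) n P}"
    then obtain P where P: "pchain (\<Inter>\<tau>) n P" by blast
    then have p0: "primeideal (P 0) R" "\<Inter>\<tau> \<subseteq> P 0" by (auto simp: pchain_def)
    have "ideal I R" if "I \<in> \<tau>" for I using hprime_M[of I] tau(1) that hidealD(1) by blast
    then obtain Q where Q: "Q \<in> \<tau>" "Q \<subseteq> P 0" using prime_contains_Inter[OF p0(1) f _ p0(2) tau(2)] by blast
    have P0i: "P 0 \<subseteq> P i" if "i \<le> n" for i
      using that
    proof (induction i)
      case (Suc i)
      then have "P i \<subset> P (Suc i)" using P by (simp add: pchain_def)
      then show ?case using Suc by auto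
    qed simp
    have "pchain Q n P" using P P0i Q(2) unfolding pchain_def by blast
    then have "enat n \<le> qdim Q" unfolding qdim_def by (intro SUP_upper) blast
    then show "enat n \<le> D" using k[OF Q(1)] by simp
  qed
  obtain P where "P \<in> \<tau>" using tau(2) by blast
  then show "D \<le> qdim (\<Inter>\<tau>)" using qdim_anti[of "\<Inter>\<tau>" P] k by auto
qed

lemma qdim_le_kd_zero: "ideal I R \<Longrightarrow> qdim I \<le> qdim {\<zero>}"
  by (rule qdim_anti) (use ideal_props(2) in auto)

text \<open>The summed Hilbert function lies between two sums over the minimal primes above
  \<open>J\<close>. These differ only by shifts and by the contribution of \<open>L\<close>, which
  is of lower order.\<close>

lemma grows_ideal:
  assumes J: "hideal J" and d: "qdim {\<zero>} = enat d"
  shows "grows J d (\<Sum>P\<in>{P \<in> \<M>. J \<subseteq> P}. top_coeff d P)"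
proof -
  let ?\<tau> = "{P \<in> \<M>. J \<subseteq> P}"
  have f: "finite ?\<tau>" using M_basic(1) by simp
  have sub: "?\<tau> \<subseteq> \<M>" by blast
  have g: "grows P d (top_coeff d P)" if "hprime P" for P
    by (rule grows_top[OF that]) (use qdim_le_kd_zero[of P] d hidealD(1) that in auto)
  obtain L where L: "hideal L" "J \<subseteq> L" "\<forall>P\<in>?\<tau>. sep P \<in> L" "\<forall>t. HF J t \<le> HF L t + (\<Sum>P\<in>?\<tau>. HF P t)"
    using HF_upper[OF J f sub] by blast
  obtain X where X: "prime_filtration L X" using exists_prime_filtration[OF L(1)] by blast
  \<comment> \<open>A prime of full dimension is minimal, so it would be one of the primes in
    \<open>?\<tau>\<close>; but it contains \<open>L\<close> and with it its own separator.\<close>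
  have lt: "qdim Q \<noteq> enat d" if Q: "(Q, s) \<in> set X" for Q s
  proof
    assume k: "qdim Q = enat d"
    have pQ: "primeideal Q R" "L \<subseteq> Q" using prime_filtrationD(1,2)[OF X Q] by auto
    obtain P where P: "P \<in> \<M>" "P \<subseteq> Q" using M_basic(2)[OF pQ(1)] by blast
    have pP: "primeideal P R" using hprime_M[OF P(1)] by simp
    have "P = Q"
    proof (rule ccontr)
      assume "P \<noteq> Q"
      then have "eSuc (qdim Q) \<le> qdim P" using qdim_strict[OF pP pQ(1)] P(2) by blast
      then have "eSuc (enat d) \<le> enat d"
        using qdim_le_kd_zero[OF primeD(1)[OF pP]] d k by (metis order_trans)
      then show False by (simp add: eSuc_enat)
    qed
    then have "P \<in> ?\<tau>" using P L(2) pQ(2) by blast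
    then have "sep P \<in> P" using L(3) pQ(2) \<open>P = Q\<close> by blast
    then show False using sep_props(2)[OF P(1)] by simp
  qed
  have "grows L d (\<Sum>(Q, s)\<leftarrow>X. top_coeff d Q)"
    by (rule grows_filtration[OF X]) (use g prime_filtrationD(1)[OF X] in blast)
  moreover have "(\<Sum>(Q, s)\<leftarrow>X. top_coeff d Q) = 0"
  proof -
    have "map (\<lambda>(Q, s). top_coeff d Q) X = map (\<lambda>_. 0) X" using lt by (auto simp: top_coeff_def)
    then show ?thesis by (simp add: map_replicate_const sum_list_replicate)
  qed
  ultimately have gL: "(\<lambda>t. real (HF L t) / real t ^ d) \<longlonglongrightarrow> 0" by (simp add: grows_def)
  have gt: "\<And>P. P \<in> ?\<tau> \<Longrightarrow> grows P d (top_coeff d P)" using g hprime_M by blast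
  show ?thesis
  proof (rule grows_squeeze)
    show "(\<Sum>P\<in>?\<tau>. if sdeg P \<le> t then HF P (t - sdeg P) else 0) \<le> HF J t" for t
      by (rule HF_lower[OF hidealD(1)[OF J] sub]) simp
    show "HF J t \<le> HF L t + (\<Sum>P\<in>?\<tau>. HF P t)" for t using L(4) by blast
    show "(\<lambda>t. real (\<Sum>P\<in>?\<tau>. if sdeg P \<le> t then HF P (t - sdeg P) else 0) / real t ^ d)
        \<longlonglongrightarrow> (\<Sum>P\<in>?\<tau>. top_coeff d P)"
      by (rule grows_sum(2)[OF f gt])
    have "(\<lambda>t. real (HF L t) / real t ^ d + real (\<Sum>P\<in>?\<tau>. HF P t) / real t ^ d) \<longlonglongrightarrow> 0 + (\<Sum>P\<in>?\<tau>. top_coeff d P)"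
      by (intro tendsto_add gL grows_sum(1)[OF f gt])
    then show "(\<lambda>t. real (HF L t + (\<Sum>P\<in>?\<tau>. HF P t)) / real t ^ d) \<longlonglongrightarrow> (\<Sum>P\<in>?\<tau>. top_coeff d P)"
      by (simp add: add_divide_distrib)
  qed
qed

section \<open>Annihilators and associated primes\<close>

lemma annihilator_nonzero:
  assumes A: "A \<subseteq> carrier R"
  shows "annihilator R A \<noteq> {\<zero>} \<longleftrightarrow> (\<exists>P\<in>\<M>. A \<subseteq> P)"
proof
  have z: "\<zero> \<in> annihilator R A" using A by (auto simp: annihilator_def)
  assume "annihilator R A \<noteq> {\<zero>}"
  then obtain r where r: "r \<in> carrier R" "r \<noteq> \<zero>" "\<And>f. f \<in> A \<Longrightarrow> r \<otimes> f = \<zero>"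
    using z unfolding annihilator_def by blast
  \<comment> \<open>A minimal prime that misses the annihilating element must contain all of
    \<open>A\<close>.\<close>
  obtain P where P: "P \<in> \<M>" "r \<notin> P" using M_basic(3)[OF r(1)] r(2) by blast
  have pP: "primeideal P R" using hprime_M[OF P(1)] by simp
  have "f \<in> P" if "f \<in> A" for f
    using primeD(3)[OF pP r(1), of f] that A r(3)[OF that] ideal_props(2)[OF primeD(1)[OF pP]] P(2) by auto
  then show "\<exists>P\<in>\<M>. A \<subseteq> P" using P(1) by blast
next
  assume "\<exists>P\<in>\<M>. A \<subseteq> P"
  then obtain P where P: "P \<in> \<M>" "A \<subseteq> P" by blast
  note sp = sep_props[OF P(1)]
  have pP: "ideal P R" using hprime_M[OF P(1)] hidealD(1) by blast
  have "sep P \<in> annihilator R A" using sep_mult_zero[OF P(1)] P(2) A sp(4) by (auto simp: annihilator_def)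
  moreover have "sep P \<noteq> \<zero>" using sp(2) ideal_props(2)[OF pP] by metis
  ultimately show "annihilator R A \<noteq> {\<zero>}" by blast
qed

text \<open>Links \<open>unmixed\<close>, phrased with associated primes, to a list of minimal
  primes. An annihilator of \<open>x\<close> lies in any minimal prime missing \<open>x\<close>, and
  a minimal prime is the annihilator of its separator.\<close>

lemma associated_eq_minimal: "associated_primes R = \<M>"
proof
  show "associated_primes R \<subseteq> \<M>"
  proof
    fix P assume "P \<in> associated_primes R"
    then obtain x where x: "x \<in> carrier R" "P = annihilator R {x}" "primeideal P R"
      unfolding associated_primes_def by blast
    have "x \<noteq> \<zero>" using x primeD(2)[OF x(3)] by (auto simp: annihilator_def)
    then obtain Q where Q: "Q \<in> \<M>" "x \<notin> Q" using M_basic(3)[OF x(1)] by blast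
    have pQ: "primeideal Q R" using hprime_M[OF Q(1)] by simp
    have "P \<subseteq> Q"
    proof
      fix r assume "r \<in> P"
      then have "r \<in> carrier R" "r \<otimes> x = \<zero>" using x(2) by (auto simp: annihilator_def)
      then show "r \<in> Q" using primeD(3)[OF pQ _ x(1), of r] Q(2) ideal_props(2)[OF primeD(1)[OF pQ]] by auto
    qed
    then have "P = Q" by (rule M_minimal[OF Q(1) x(3)])
    then show "P \<in> \<M>" using Q(1) by simp
  qed
  show "\<M> \<subseteq> associated_primes R"
  proof
    fix P assume P: "P \<in> \<M>"
    note sp = sep_props[OF P]
    have pP: "primeideal P R" using hprime_M[OF P] by simp
    have "annihilator R {sep P} = P"
      using sep_mult_zero[OF P] m_comm[OF sp(4)] ideal_props(1)[OF primeD(1)[OF pP]]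
      by (auto simp: annihilator_def)
    then show "P \<in> associated_primes R" unfolding associated_primes_def using pP sp(4) by blast
  qed
qed

end

section \<open>Multiplicities\<close>

lemma module_along_simps [simp]:
  "carrier (module_along \<phi> B) = carrier B" "zero (module_along \<phi> B) = zero B"
  "add (module_along \<phi> B) = add B" "smult (module_along \<phi> B) = (\<lambda>a b. monoid.mult B (\<phi> a) b)"
  by (auto simp: module_along_def)

lemma (in cring) module_along_vectorspace:
  assumes "subfield K R" "ring_hom_cring R S \<phi>"
  shows "vectorspace (R\<lparr>carrier := K\<rparr>) (module_along \<phi> S)"
proof -
  interpret h: ring_hom_cring R S \<phi> by fact
  have K: "x \<in> K \<Longrightarrow> x \<in> carrier R" for x using subfieldE(3)[OF assms(1)] by blast
  show ?thesis
  proof (rule vs_criteria[OF subfield_iff(2)[OF assms(1)]])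
    show "\<forall>v\<in>carrier (module_along \<phi> S). \<exists>neg_v\<in>carrier (module_along \<phi> S).
        v \<oplus>\<^bsub>module_along \<phi> S\<^esub> neg_v = \<zero>\<^bsub>module_along \<phi> S\<^esub>"
    proof
      fix v assume "v \<in> carrier (module_along \<phi> S)"
      then show "\<exists>neg_v\<in>carrier (module_along \<phi> S). v \<oplus>\<^bsub>module_along \<phi> S\<^esub> neg_v = \<zero>\<^bsub>module_along \<phi> S\<^esub>"
        by (intro bexI[of _ "\<ominus>\<^bsub>S\<^esub> v"]) (auto simp: h.S.r_neg)
    qed
  qed (auto simp: K h.S.a_ac h.S.m_ac h.S.l_distr h.S.r_distr)
qed

context standard_graded_algebra
begin

lemma quotient_vectorspace:
  assumes "ideal I R"
  shows "vectorspace KF (quotient_module R I)"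
  unfolding quotient_module_def
  by (rule module_along_vectorspace[OF ground_field ideal.rcos_ring_hom_cring[OF assms is_cring]])

lemma quotient_linear:
  assumes "ideal I R"
  shows "linear_map KF (self_module R) (quotient_module R I) ((+>) I)"
proof -
  interpret W: vectorspace KF "quotient_module R I" by (rule quotient_vectorspace[OF assms])
  interpret h: ring_hom_ring R "R Quot I" "(+>) I" by (rule ideal.rcos_ring_hom_ring[OF assms])
  have K: "x \<in> K \<Longrightarrow> x \<in> carrier R" for x using K_props(1) by blast
  show ?thesis
    by (intro linear_map.intro mod_hom.intro mod_hom_axioms.intro V.vectorspace_axioms
        V.module.module_axioms W.vectorspace_axioms W.module.module_axioms)
      (auto simp: module_hom_def quotient_module_def K)
qed

lemma quotient_dim:
  assumes "ideal I R"
  shows "vectorspace.dim KF ((quotient_module R I)\<lparr>carrier := (+>) I ` G t\<rparr>) = hf I t"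
    and "subspace KF ((+>) I ` G t) (quotient_module R I)"
proof -
  interpret W: vectorspace KF "quotient_module R I" by (rule quotient_vectorspace[OF assms])
  note l = linear_image_dim[OF quotient_linear[OF assms] sub_G fin_G, of t]
  show "subspace KF ((+>) I ` G t) (quotient_module R I)" by (rule l(3))
  have "{u \<in> G t. I +> u = \<zero>\<^bsub>quotient_module R I\<^esub>} = I \<inter> G t"
    using coset_facts(7)[OF assms] G_carrier by (auto simp: quotient_module_def)
  then show "vectorspace.dim KF ((quotient_module R I)\<lparr>carrier := (+>) I ` G t\<rparr>) = hf I t"
    using l(1) hf_add[OF assms, of t] by (simp add: W.sdim_def)
qed

lemma hilbert_quotient:
  "ideal I R \<Longrightarrow> hilbert_function R G (quotient_module R I) (quotient_grading R G I) t = hf I t"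
  by (simp add: hilbert_function_def quotient_grading_def degree_zero quotient_dim(1))

lemma hilbert_self: "hilbert_function R G (self_module R) G t = hf {\<zero>} t"
proof -
  have "{\<zero>} \<inter> G t = {\<zero>}" using G_closed(1) by blast
  then show ?thesis using V.sfin_zero(2)
    by (simp add: hilbert_function_def degree_zero hf_def V.sdim_def)
qed

text \<open>The quotient ring carries two scalar fields: \<open>K\<close> and its isomorphic image. Linear combinations
  over both agree, hence so do the dimensions.\<close>

lemma hilbert_quotient_self:
  assumes I: "ideal I R" "\<one> \<notin> I"
  shows "hilbert_function (R Quot I) (quotient_grading R G I) (self_module (R Quot I))
      (quotient_grading R G I) t = hf I t"
proof -
  let ?T = "R Quot I" and ?\<pi> = "(+>) I" and ?W = "(+>) I ` G t"
  let ?K' = "(+>) I ` K"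
  let ?F' = "?T\<lparr>carrier := ?K'\<rparr>"
  interpret T: cring ?T by (rule coset_facts(8)[OF I(1)])
  interpret h: ring_hom_ring R ?T ?\<pi> by (rule ideal.rcos_ring_hom_ring[OF I(1)])
  have "\<one>\<^bsub>?T\<^esub> \<noteq> \<zero>\<^bsub>?T\<^esub>"
    unfolding coset_facts(6)[OF I(1)] using coset_facts(7)[OF I(1) one_closed] I(2) by simp
  then have sf: "subfield ?K' ?T" by (rule h.img_is_subfield(2)[OF ground_field])
  have "ring_hom_cring ?T ?T (\<lambda>x. x)"
    by (intro ring_hom_cring.intro ring_hom_cring_axioms.intro T.is_cring) (auto simp: ring_hom_def)
  then interpret A: vectorspace ?F' "self_module ?T"
    unfolding self_module_def by (rule T.module_along_vectorspace[OF sf])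
  interpret B: vectorspace KF "quotient_module R I" by (rule quotient_vectorspace[OF I(1)])
  have Wc: "?W \<subseteq> carrier ?T" unfolding coset_facts(1)[OF I(1)] using G_carrier by blast
  have sB: "subspace KF ?W (quotient_module R I)" by (rule quotient_dim(2)[OF I(1)])
  have K: "x \<in> K \<Longrightarrow> x \<in> carrier R" for x using K_props(1) by blast
  note Bd = B.subspaceD[OF sB]
  have sA: "subspace ?F' ?W (self_module ?T)"
    by (rule A.subspaceI) (use Bd Wc in \<open>auto simp: quotient_module_def\<close>)
  interpret A': vectorspace ?F' "A.vs ?W" by (rule A.subspace_is_vs[OF sA])
  interpret B': vectorspace KF "B.vs ?W" by (rule B.subspace_is_vs[OF sB])
  \<comment> \<open>The two structures share their addition, so finite sums do not see the
    scalars.\<close>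
  have finsum_eq: "finsum (A.vs ?W) f X = finsum (B.vs ?W) f X" for f and X :: "'a set set"
    by (simp add: finsum_def finprod_def quotient_module_def)
  have lincomb_eq: "A'.lincomb (\<lambda>v. I +> b v) X = B'.lincomb b X" if "X \<subseteq> ?W" "b \<in> X \<rightarrow> K" for X b
    unfolding A'.lincomb_def B'.lincomb_def finsum_eq by (simp add: quotient_module_def)
  have lincomb_eq': "\<exists>b\<in>X \<rightarrow> K. A'.lincomb a X = B'.lincomb b X" if X: "X \<subseteq> ?W" "a \<in> X \<rightarrow> ?K'" for X a
  proof -
    have "\<forall>v\<in>X. \<exists>c\<in>K. a v = I +> c" using X(2) by blast
    then obtain b where b: "\<And>v. v \<in> X \<Longrightarrow> b v \<in> K \<and> a v = I +> b v" by metis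
    have "A'.lincomb a X = A'.lincomb (\<lambda>v. I +> b v) X"
      by (rule A'.lincomb_cong) (use X b in auto)
    also have "\<dots> = B'.lincomb b X" by (rule lincomb_eq) (use X b in auto)
    finally show ?thesis using b by blast
  qed
  have span: "A'.span X = B'.span X" if "X \<subseteq> ?W" for X
  proof
    show "A'.span X \<subseteq> B'.span X"
    proof
      fix y assume "y \<in> A'.span X"
      then obtain Y a where Y: "y = A'.lincomb a Y" "finite Y" "Y \<subseteq> X" "a \<in> Y \<rightarrow> ?K'"
        unfolding A'.span_def by auto
      have "Y \<subseteq> ?W" using Y(3) that by (rule order_trans)
      from lincomb_eq'[OF this Y(4)] obtain b where "b \<in> Y \<rightarrow> K" "A'.lincomb a Y = B'.lincomb b Y" ..
      then show "y \<in> B'.span X" unfolding B'.span_def using Y by auto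
    qed
    show "B'.span X \<subseteq> A'.span X"
    proof
      fix y assume "y \<in> B'.span X"
      then obtain Y b where Y: "y = B'.lincomb b Y" "finite Y" "Y \<subseteq> X" "b \<in> Y \<rightarrow> K"
        unfolding B'.span_def by auto
      have "y = A'.lincomb (\<lambda>v. I +> b v) Y" using lincomb_eq[of Y b] Y that by simp
      moreover have "(\<lambda>v. I +> b v) \<in> Y \<rightarrow> ?K'" using Y(4) by blast
      ultimately show "y \<in> A'.span X" unfolding A'.span_def using Y(2,3) by auto
    qed
  qed
  \<comment> \<open>\<open>dim\<close> depends only on the sizes of finite generating sets, so
    equality of spans is enough.\<close>
  have "A'.dim = B'.dim"
  proof -
    have "(\<lambda>n. \<exists>A. finite A \<and> card A = n \<and> A \<subseteq> carrier (A.vs ?W) \<and> A'.gen_set A)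
        = (\<lambda>n. \<exists>A. finite A \<and> card A = n \<and> A \<subseteq> carrier (B.vs ?W) \<and> B'.gen_set A)"
      using span by (intro ext ex_cong) auto
    then show ?thesis unfolding A'.dim_def B'.dim_def by simp
  qed
  then show ?thesis
    by (simp add: hilbert_function_def quotient_grading_def degree_zero quotient_dim(1)[OF I(1)])
qed

lemma hs_limit:
  assumes "grows J d c"
  shows "lim (\<lambda>t. fact d * (\<Sum>i\<le>t. real (hf J i)) / real t ^ d) = fact d * c"
proof (rule limI)
  have "(\<lambda>t. fact d * (real (HF J t) / real t ^ d)) \<longlonglongrightarrow> fact d * c"
    by (intro tendsto_mult tendsto_const) (use assms in \<open>simp add: grows_def\<close>)
  then show "(\<lambda>t. fact d * (\<Sum>i\<le>t. real (hf J i)) / real t ^ d) \<longlonglongrightarrow> fact d * c"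
    by (simp add: HF_def)
qed

lemma e_quot_grows:
  assumes "ideal J R" "krull_dim R = enat d" "grows J d c"
  shows "e_quot R G J = fact d * c"
  unfolding e_quot_def hs_multiplicity_def hilbert_quotient[OF assms(1)]
  using hs_limit[OF assms(3)] assms(2) by simp

lemma e_ring_grows:
  assumes "krull_dim R = enat d" "grows {\<zero>} d c"
  shows "e_ring R G = fact d * c"
  unfolding e_ring_def hs_multiplicity_def hilbert_self
  using hs_limit[OF assms(2)] assms(1) by simp

text \<open>Normalized by the dimension of the quotient itself, unlike \<open>e_quot_grows\<close>;
  this is the form needed for the ring \<open>T\<close>.\<close>

lemma e_ring_quot_grows:
  assumes "ideal J R" "\<one> \<notin> J" "qdim J = enat d" "grows J d c"
  shows "e_ring (R Quot J) (quotient_grading R G J) = fact d * c"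
  unfolding e_ring_def hs_multiplicity_def hilbert_quotient_self[OF assms(1,2)]
  using hs_limit[OF assms(4)] krull_dim_quot[OF assms(1)] assms(3) by simp

end

section \<open>Generalized minimum distance\<close>

context reduced_graded_algebra
begin

text \<open>The components on which the family does not vanish identically. This set decides whether
  the annihilator is zero, and it determines the multiplicity of the quotient.\<close>

definition nonvan :: "'a set \<Rightarrow> 'a set set" where
  "nonvan A = {P \<in> \<M>. \<not> A \<subseteq> P}"

text \<open>The family lies in \<open>off (nonvan A) t\<close>, which embeds into \<open>R\<close>
  modulo the intersection of the primes in \<open>nonvan A\<close>. If \<open>nonvan A\<close> were
  empty, this space would be zero and hold no independent element.\<close>

lemma gmd_family_props:
  assumes "A \<in> gmd_family R G t l" "l \<ge> 1"
  shows "nonvan A \<noteq> {}" "nonvan A \<subset> \<M>" "l \<le> (\<Sum>P\<in>nonvan A. hf P t)"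
proof -
  have A: "A \<subseteq> G t" "finite A" "card A = l" "V.lin_indpt A" "annihilator R A \<noteq> {\<zero>}"
    using assms(1) by (auto simp: gmd_family_def degree_zero)
  have sub: "nonvan A \<subseteq> \<M>" by (auto simp: nonvan_def)
  have f: "finite (nonvan A)" using finite_subset[OF sub M_basic(1)] .
  have "A \<subseteq> carrier R" using A(1) G_carrier by blast
  then show "nonvan A \<subset> \<M>" using annihilator_nonzero A(5) by (auto simp: nonvan_def)
  have "A \<subseteq> off (nonvan A) t" using A(1) by (auto simp: off_def nonvan_def)
  then have l: "l \<le> dm (off (nonvan A) t)" using V.sdim_indep[OF off_sub(1,2) _ A(4)] A(3) by simp
  show ne: "nonvan A \<noteq> {}"
  proof
    assume "nonvan A = {}"
    then have "off (nonvan A) t \<subseteq> {\<zero>}" using M_basic(3) G_carrier by (auto simp: off_def)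
    then have "dm (off (nonvan A) t) \<le> dm {\<zero>}"
      using dm_mono[OF V.sfin_zero(3) V.sfin_zero(1)] off_sub(1) by simp
    then show False using V.sfin_zero(2) l assms(2) by simp
  qed
  have h: "hideal P" if "P \<in> nonvan A" for P using hprime_M sub that by blast
  have "dm (off (nonvan A) t) \<le> hf (\<Inter>(nonvan A)) t"
    by (rule dm_U_le_hf[OF hidealD(1)[OF hideal_INT[OF h ne]]]) auto
  also have "\<dots> \<le> (\<Sum>P\<in>nonvan A. hf P t)" by (rule hf_INT_le[OF f ne h])
  finally show "l \<le> (\<Sum>P\<in>nonvan A. hf P t)" using l by simp
qed

text \<open>A minimal prime left out of \<open>\<tau>\<close> contains every element of
  \<open>off \<tau> t\<close>, which makes the annihilator nonzero.\<close>

lemma exists_gmd_family: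
  assumes "\<tau> \<subset> \<M>" "l \<le> dm (off \<tau> t)"
  shows "\<exists>A\<in>gmd_family R G t l. nonvan A \<subseteq> \<tau>"
proof -
  obtain A where A: "A \<subseteq> off \<tau> t" "finite A" "card A = l" "V.lin_indpt A"
    using V.exists_indep_subset[OF off_sub(1,2) assms(2)] by blast
  have nv: "nonvan A \<subseteq> \<tau>" using A(1) by (auto simp: nonvan_def off_def)
  obtain P where P: "P \<in> \<M>" "P \<notin> \<tau>" using assms(1) by blast
  then have "A \<subseteq> P" using A(1) by (auto simp: off_def)
  moreover have "A \<subseteq> carrier R" using A(1) subD(1)[OF off_sub(1)] by blast
  ultimately have "annihilator R A \<noteq> {\<zero>}" using annihilator_nonzero P(1) by blast
  then have "A \<in> gmd_family R G t l"
    using A off_sub(3) by (auto simp: gmd_family_def degree_zero)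
  then show ?thesis using nv by blast
qed

lemma dm_U_unbounded:
  assumes "P \<in> \<M>" "qdim P \<ge> 2"
  shows "eventually (\<lambda>t. l \<le> dm (off {P} t)) sequentially"
proof -
  obtain N where N: "\<And>t. t \<ge> N \<Longrightarrow> l \<le> hf P t"
    using hf_unbounded[OF hprime_M[OF assms(1)] assms(2), of l] unfolding eventually_sequentially by blast
  have "l \<le> dm (off {P} t)" if "t \<ge> N + sdeg P" for t
  proof -
    have "l \<le> hf P (t - sdeg P)" by (rule N) (use that in linarith)
    moreover have "hf P (t - sdeg P) \<le> dm (off {P} t)" using dm_off[of "{P}" t] that assms(1) by simp
    ultimately show ?thesis by (rule order_trans)
  qed
  then show ?thesis by (rule eventually_sequentiallyI)
qed

text \<open>In large degrees each Hilbert function involved is constant, so the shifts by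
  \<open>sdeg P\<close> cost nothing.\<close>

lemma dm_U_dim1:
  assumes tau: "\<tau> \<subseteq> \<M>" "\<And>P. P \<in> \<tau> \<Longrightarrow> qdim P = 1" and l: "real l \<le> (\<Sum>P\<in>\<tau>. gcoeff P)"
  shows "eventually (\<lambda>t. l \<le> dm (off \<tau> t)) sequentially"
proof -
  have f: "finite \<tau>" using finite_subset[OF tau(1) M_basic(1)] .
  have "eventually (\<lambda>t. \<forall>P\<in>\<tau>. (if sdeg P \<le> t then hf P (t - sdeg P) else 0) = gcoeff P) sequentially"
  proof (rule eventually_ball_finite[OF f], rule ballI)
    fix P assume P: "P \<in> \<tau>"
    obtain N where N: "\<And>t. t \<ge> N \<Longrightarrow> hf P t = gcoeff P"
      using hf_dim1(2)[of P] hprime_M tau P unfolding eventually_sequentially by blast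
    show "eventually (\<lambda>t. (if sdeg P \<le> t then hf P (t - sdeg P) else 0) = gcoeff P) sequentially"
      by (rule eventually_sequentiallyI[of "N + sdeg P"]) (use N in auto)
  qed
  then show ?thesis
  proof eventually_elim
    case (elim t)
    have "real l \<le> (\<Sum>P\<in>\<tau>. real (if sdeg P \<le> t then hf P (t - sdeg P) else 0))"
      using l elim by (metis (no_types, lifting) sum.cong)
    also have "\<dots> \<le> real (dm (off \<tau> t))"
      using dm_off[OF f tau(1), of t] by (simp only: of_nat_sum[symmetric] of_nat_le_iff)
    finally show ?case by simp
  qed
qed

text \<open>\<open>hf P t\<close> never exceeds its stable value, so the bound holds in every degree
  \<open>t\<close>.\<close>

lemma gmd_family_dim1:
  assumes "A \<in> gmd_family R G t l" "l \<ge> 1" "\<And>P. P \<in> nonvan A \<Longrightarrow> qdim P = 1"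
  shows "real l \<le> (\<Sum>P\<in>nonvan A. gcoeff P)"
proof -
  have "real l \<le> real (\<Sum>P\<in>nonvan A. hf P t)" using gmd_family_props(3)[OF assms(1,2)] by (simp only: of_nat_le_iff)
  also have "\<dots> \<le> (\<Sum>P\<in>nonvan A. gcoeff P)"
    unfolding of_nat_sum by (rule sum_mono, rule hf_dim1(1)) (use assms(3) hprime_M in \<open>auto simp: nonvan_def\<close>)
  finally show ?thesis .
qed

text \<open>A homogeneous prime of dimension 0 contains all linear forms, hence everything of
  positive degree, while a proper homogeneous ideal is zero in degree 0. This excludes
  lower-dimensional components when \<open>R\<close> has dimension 1.\<close>

lemma hprime_kd_zero:
  assumes P: "hprime P" "qdim P < 1" and Q: "hprime Q"
  shows "Q \<subseteq> P"
proof -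
  note Pi = primeD[OF conjunct2[OF P(1)]] and Qi = primeD[OF conjunct2[OF Q]]
  have "G 1 \<subseteq> P"
  proof (rule ccontr)
    assume "\<not> G 1 \<subseteq> P"
    then obtain x where x: "x \<in> G 1" "x \<notin> P" by blast
    obtain X where X: "prime_filtration (adjoin P x) X"
      using exists_prime_filtration[OF hideal_adjoin[OF conjunct1[OF P(1)] x(1)]] by blast
    note X' = adjoin_filtration_nonempty[OF P(1) x X]
    obtain Q' s where "(Q', s) \<in> set X" using X'(1) by (cases X) auto
    then have "P \<subset> Q'" "primeideal Q' R" using X'(2) by auto
    from qdim_strict[OF conjunct2[OF P(1)] this(2,1)] have "eSuc (qdim Q') < 1"
      using P(2) by (rule order_le_less_trans)
    then show False by (simp add: one_eSuc)
  qed
  note g = this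
  show "Q \<subseteq> P"
  proof
    fix x assume x: "x \<in> Q"
    have xc: "x \<in> carrier R" using x ideal_props(1)[OF Qi(1)] by blast
    have "pr x i \<in> P" for i
    proof (cases i)
      case 0
      have "pr x 0 = \<zero>"
      proof (rule ccontr)
        assume nz: "pr x 0 \<noteq> \<zero>"
        have "pr x 0 \<in> K" using pr_props(1)[OF xc, of 0] degree_zero by simp
        then obtain y where y: "y \<in> K" "pr x 0 \<otimes> y = \<one>"
          using subfield_m_inv[OF ground_field, of "pr x 0"] nz by auto
        then have "\<one> \<in> Q"
          using ideal_props(5)[OF Qi(1) _ hidealD(2)[OF conjunct1[OF Q] x], of y 0] K_props(1) by auto
        then show False using Qi(2) by simp
      qed
      then show ?thesis using 0 ideal_props(2)[OF Pi(1)] by simp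
    next
      case (Suc n)
      then show ?thesis using G_Suc_ideal[OF Pi(1) g, of n] pr_props(1)[OF xc, of i] by auto
    qed
    then show "x \<in> P" using mem_if_pr_mem[OF ideal_props(8)[OF Pi(1)] xc] by blast
  qed
qed

lemma gmd_family_domain:
  assumes "domain R" "l \<ge> 1"
  shows "gmd_family R G t l = {}"
proof (rule ccontr)
  assume "gmd_family R G t l \<noteq> {}"
  then obtain A where A: "A \<in> gmd_family R G t l" by blast
  obtain P where P: "P \<in> \<M>" "A \<subseteq> P" using gmd_family_props(2)[OF A assms(2)] by (auto simp: nonvan_def)
  have z: "\<zero> \<in> Q" if "Q \<in> \<M>" for Q using ideal_props(2) hidealD(1) hprime_M[OF that] by blast
  have "primeideal {\<zero>} R" using assms(1) by (rule domain.zeroprimeideal)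
  then have "{\<zero>} = P" using z[OF P(1)] by (intro M_minimal[OF P(1)]) auto
  then have "nonvan A = {}" using P(2) z by (auto simp: nonvan_def)
  then show False using gmd_family_props(1)[OF A assms(2)] by simp
qed

lemma e_ring_INT_dim1:
  assumes "\<tau> \<subseteq> \<M>" "\<tau> \<noteq> {}" and k: "\<And>P. P \<in> \<tau> \<Longrightarrow> qdim P = 1"
  shows "e_ring (R Quot \<Inter>\<tau>) (quotient_grading R G (\<Inter>\<tau>)) = (\<Sum>P\<in>\<tau>. gcoeff P)"
proof -
  have g: "grows P 1 (gcoeff P)" if "P \<in> \<tau>" for P
    using gcoeff_props(2)[OF hprime_M, of P] k[OF that] assms(1) that by (auto simp: one_enat_def)
  have h: "hideal (\<Inter>\<tau>)" using hideal_INT[OF _ assms(2)] hprime_M assms(1) by blast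
  have o: "\<one> \<notin> \<Inter>\<tau>" using assms(1,2) primeD(2) hprime_M by blast
  have "qdim (\<Inter>\<tau>) = enat 1" using qdim_INT[OF assms(1,2) k] by (simp add: one_enat_def)
  from e_ring_quot_grows[OF hidealD(1)[OF h] o this grows_INT[OF assms(1,2) g]] show ?thesis by simp
qed

section \<open>The distance function as a minimum over sets of minimal primes\<close>

abbreviation e_prime where "e_prime \<equiv> e_quot R G"

context
  fixes d assumes dimR: "krull_dim R = enat d"
begin

lemma kd0: "qdim {\<zero>} = enat d" using dimR krull_dim_eq_qdim by simp

lemma e_quot_hideal:
  assumes "hideal J"
  shows "e_quot R G J = (\<Sum>P\<in>{P \<in> \<M>. J \<subseteq> P}. fact d * top_coeff d P)"
  unfolding e_quot_grows[OF hidealD(1)[OF assms] dimR grows_ideal[OF assms kd0]]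
  by (rule sum_distrib_left)

lemma e_prime_M: assumes "P \<in> \<M>" shows "e_prime P = fact d * top_coeff d P"
proof -
  have "{P' \<in> \<M>. P \<subseteq> P'} = {P}" using M_minimal[of _ P] hprime_M[OF assms] assms by auto
  then show ?thesis using e_quot_hideal[of P] hprime_M[OF assms] by simp
qed

lemma e_prime_nonneg: "P \<in> \<M> \<Longrightarrow> e_prime P \<ge> 0"
  using gcoeff_props(3)[OF hprime_M, of P] by (simp add: e_prime_M top_coeff_def)

lemma e_prime_low: "P \<in> \<M> \<Longrightarrow> qdim P < enat d \<Longrightarrow> e_prime P = 0"
  by (auto simp: e_prime_M top_coeff_def)

lemma e_quot_sum: assumes "hideal J" shows "e_quot R G J = (\<Sum>P\<in>{P \<in> \<M>. J \<subseteq> P}. e_prime P)"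
  unfolding e_quot_hideal[OF assms] by (rule sum.cong) (auto simp: e_prime_M)

lemma e_ring_sum: "e_ring R G = (\<Sum>P\<in>\<M>. e_prime P)"
proof -
  have "{P \<in> \<M>. {\<zero>} \<subseteq> P} = \<M>" using hprime_M hidealD(1) ideal_props(2) by blast
  then have "grows {\<zero>} d (\<Sum>P\<in>\<M>. top_coeff d P)" using grows_ideal[OF hideal_zero kd0] by simp
  from e_ring_grows[OF dimR this] show ?thesis by (simp add: e_prime_M sum_distrib_left)
qed

text \<open>The minimal primes above the ideal of \<open>A\<close> are those outside
  \<open>nonvan A\<close>, and multiplicities add up over them.\<close>

lemma e_quot_Idl:
  assumes "A \<in> gmd_family R G t l"
  shows "e_quot R G (Idl A) = e_ring R G - (\<Sum>P\<in>nonvan A. e_prime P)"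
proof -
  have A: "A \<subseteq> G t" "finite A" using assms by (auto simp: gmd_family_def)
  have Ac: "A \<subseteq> carrier R" using A(1) G_carrier by blast
  have "Idl A \<subseteq> P \<longleftrightarrow> A \<subseteq> P" if "P \<in> \<M>" for P
    using genideal_minimal[of P A] genideal_self[OF Ac] hprime_M[OF that] hidealD(1) by blast
  then have "{P \<in> \<M>. Idl A \<subseteq> P} = \<M> - nonvan A" by (auto simp: nonvan_def)
  then have "e_quot R G (Idl A) = (\<Sum>P\<in>\<M> - nonvan A. e_prime P)"
    using e_quot_sum[OF hideal_Idl[OF A(2,1)]] by simp
  also have "\<dots> = (\<Sum>P\<in>\<M>. e_prime P) - (\<Sum>P\<in>nonvan A. e_prime P)"
    by (rule sum_diff[OF M_basic(1)]) (auto simp: nonvan_def)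
  finally show ?thesis by (simp add: e_ring_sum)
qed

text \<open>The value of a family depends only on its \<open>nonvan\<close>, a subset of the finite
  set of minimal primes, so the set under \<open>Max\<close> is finite.\<close>

lemma gmd_eqI:
  assumes "A \<in> gmd_family R G t l" "(\<Sum>P\<in>nonvan A. e_prime P) = v"
    and "\<And>B. B \<in> gmd_family R G t l \<Longrightarrow> v \<le> (\<Sum>P\<in>nonvan B. e_prime P)"
  shows "gmd R G t l = v"
proof -
  let ?S = "{e_quot R G (Idl\<^bsub>R\<^esub> A) | A. A \<in> gmd_family R G t l}"
  have "?S \<subseteq> (\<lambda>\<sigma>. e_ring R G - (\<Sum>P\<in>\<sigma>. e_prime P)) ` Pow \<M>"
  proof
    fix x assume "x \<in> ?S"
    then obtain B where "B \<in> gmd_family R G t l" "x = e_quot R G (Idl B)" by blast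
    then show "x \<in> (\<lambda>\<sigma>. e_ring R G - (\<Sum>P\<in>\<sigma>. e_prime P)) ` Pow \<M>"
      using e_quot_Idl[of B t l] by (intro image_eqI[of _ _ "nonvan B"]) (auto simp: nonvan_def)
  qed
  then have f: "finite ?S" by (rule finite_subset) (use M_basic(1) in simp)
  have "Max ?S = e_ring R G - v"
  proof (rule Max_eqI[OF f])
    show "e_ring R G - v \<in> ?S" using e_quot_Idl[OF assms(1)] assms(1,2) by force
    fix y assume "y \<in> ?S"
    then obtain B where "B \<in> gmd_family R G t l" "y = e_quot R G (Idl B)" by blast
    then show "y \<le> e_ring R G - v" using e_quot_Idl[of B t l] assms(3)[of B] by simp
  qed
  then show ?thesis using assms(1) unfolding gmd_def by auto
qed

lemma gmd_stable_eqI: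
  assumes "eventually (\<lambda>t. gmd R G t l = v) sequentially"
  shows "gmd_stable R G l = v"
  unfolding gmd_stable_def by (rule limI, rule tendsto_eventually, rule assms)

lemma gmd_stable_empty:
  assumes "\<And>t. gmd_family R G t l = {}"
  shows "gmd_stable R G l = e_ring R G"
  by (rule gmd_stable_eqI) (simp add: gmd_def assms)

text \<open>A family in \<open>off \<tau> t\<close> has its \<open>nonvan\<close> inside
  \<open>\<tau>\<close>, so its value is at most \<open>v\<close>; the lower bound forces equality
  even if \<open>nonvan\<close> is smaller than \<open>\<tau>\<close>.\<close>

lemma gmd_stable_subset:
  assumes tau: "\<tau> \<subset> \<M>" and ev: "eventually (\<lambda>t. l \<le> dm (off \<tau> t)) sequentially"
    and v: "(\<Sum>P\<in>\<tau>. e_prime P) = v"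
    and lower: "\<And>t B. B \<in> gmd_family R G t l \<Longrightarrow> v \<le> (\<Sum>P\<in>nonvan B. e_prime P)"
  shows "gmd_stable R G l = v"
proof (rule gmd_stable_eqI)
  show "eventually (\<lambda>t. gmd R G t l = v) sequentially"
    using ev
  proof eventually_elim
    case (elim t)
    obtain A where A: "A \<in> gmd_family R G t l" "nonvan A \<subseteq> \<tau>" using exists_gmd_family[OF tau elim] by blast
    have "(\<Sum>P\<in>nonvan A. e_prime P) \<le> (\<Sum>P\<in>\<tau>. e_prime P)"
      using A(2) tau e_prime_nonneg finite_subset[OF _ M_basic(1), of \<tau>] by (intro sum_mono2) auto
    then have "(\<Sum>P\<in>nonvan A. e_prime P) = v" using lower[OF A(1)] v by simp
    then show ?case using gmd_eqI[OF A(1)] lower by blast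
  qed
qed

lemma sum_eP_nonneg: "\<sigma> \<subseteq> \<M> \<Longrightarrow> (\<Sum>P\<in>\<sigma>. e_prime P) \<ge> 0"
  by (rule sum_nonneg) (use e_prime_nonneg in auto)

lemma sum_eP_ge: "\<sigma> \<subseteq> \<M> \<Longrightarrow> P \<in> \<sigma> \<Longrightarrow> e_prime P \<le> (\<Sum>P\<in>\<sigma>. e_prime P)"
  using member_le_sum[of P \<sigma> e_prime] e_prime_nonneg finite_subset[OF _ M_basic(1), of \<sigma>] by blast

lemma nonvan_M: "nonvan A \<subseteq> \<M>" by (auto simp: nonvan_def)

end

end

theorem theorem3p8:
  fixes K :: "'a set" and R :: "('a, 'm) ring_scheme" and G :: "nat \<Rightarrow> 'a set"
    and q p :: "nat \<Rightarrow> 'a set" and a b l :: nat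
  assumes "standard_graded_algebra K R G"
    and "reduced_ring R"
    and "a \<ge> 1"
    and "minimal_primes R = q ` {1..a} \<union> p ` {1..b}"
    and "inj_on q {1..a}" and "inj_on p {1..b}" and "q ` {1..a} \<inter> p ` {1..b} = {}"
    and "\<And>i. i \<in> {1..a} \<Longrightarrow> krull_dim (R Quot q i) = krull_dim R"
    and "\<And>i. i \<in> {1..b} \<Longrightarrow> krull_dim (R Quot p i) < krull_dim R"
    and "\<And>i j. \<lbrakk> i \<in> {1..a}; j \<in> {1..a}; i \<le> j \<rbrakk> \<Longrightarrow> e_quot R G (q i) \<le> e_quot R G (q j)"
    and "l \<ge> 1"
  shows
    "(mixed R \<and> (\<exists>j\<in>{1..b}. krull_dim (R Quot p j) \<ge> 2) \<longrightarrow> gmd_stable R G l = 0)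
   \<and> (domain R \<longrightarrow> gmd_stable R G l = e_ring R G)
   \<and> (unmixed R \<and> krull_dim R \<ge> 2 \<longrightarrow> gmd_stable R G l = e_quot R G (q 1))
   \<and> (krull_dim R = 1 \<and> real l \<le> e_ring R G - e_quot R G (q 1) \<longrightarrow>
        gmd_stable R G l =
          Min {(\<Sum>i\<in>\<sigma>. e_quot R G (q i)) | \<sigma>. \<sigma> \<subset> {1..a} \<and> real l \<le> (\<Sum>i\<in>\<sigma>. e_quot R G (q i))})
   \<and> (krull_dim R = 1 \<and> real l > e_ring R G - e_quot R G (q 1) \<longrightarrow>
        gmd_stable R G l = e_ring R G)
   \<and> (mixed R \<and> (\<forall>j\<in>{1..b}. krull_dim (R Quot p j) = 1)
        \<and> real l \<le> e_ring (R Quot (\<Inter>i\<in>{1..b}. p i)) (quotient_grading R G (\<Inter>i\<in>{1..b}. p i)) \<longrightarrow>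
        gmd_stable R G l = 0)
   \<and> (mixed R \<and> (\<forall>j\<in>{1..b}. krull_dim (R Quot p j) = 1)
        \<and> real l > e_ring (R Quot (\<Inter>i\<in>{1..b}. p i)) (quotient_grading R G (\<Inter>i\<in>{1..b}. p i)) \<longrightarrow>
        gmd_stable R G l = e_quot R G (q 1))"
proof -
  interpret reduced_graded_algebra K R G
    using assms(1,2) by (simp add: reduced_graded_algebra_def reduced_graded_algebra_axioms_def)
  note M = assms(4) and l = assms(11)
  let ?e = "e_quot R G"
    and ?eT = "e_ring (R Quot (\<Inter>i\<in>{1..b}. p i)) (quotient_grading R G (\<Inter>i\<in>{1..b}. p i))"
  have qM: "q i \<in> \<M>" if "i \<in> {1..a}" for i using M that by blast
  have pM: "p j \<in> \<M>" if "j \<in> {1..b}" for j using M that by blast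
  have q1: "q 1 \<in> \<M>" using qM assms(3) by simp
  have idM: "ideal P R" if "P \<in> \<M>" for P using hprime_M[OF that] hidealD(1) by blast
  have kq: "qdim (q i) = krull_dim R" if "i \<in> {1..a}" for i
    using assms(8)[OF that] krull_dim_quot[OF idM[OF qM[OF that]]] by simp
  have kp: "qdim (p j) = krull_dim (R Quot p j)" if "j \<in> {1..b}" for j
    using krull_dim_quot[OF idM[OF pM[OF that]]] by simp
  \<comment> \<open>\<open>q 1\<close> has the dimension of \<open>R\<close>, which is therefore
    finite like that of every homogeneous prime.\<close>
  obtain d where d: "krull_dim R = enat d" using kq[of 1] gcoeff_props(1)[OF hprime_M[OF q1]] assms(3) by auto
  have ep0: "?e (p j) = 0" if "j \<in> {1..b}" for j
    using e_prime_low[OF d pM[OF that]] assms(9)[OF that] kp[OF that] d by simp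
  have qp: "q i \<noteq> p j" if "i \<in> {1..a}" "j \<in> {1..b}" for i j using assms(7) that by blast
  have qmin: "?e (q 1) \<le> ?e (q i)" if "i \<in> {1..a}" for i using assms(10)[of 1 i] that by simp
  have mixed_b: "b \<ge> 1" if "mixed R"
  proof (rule ccontr)
    assume "\<not> b \<ge> 1"
    then have "\<M> = q ` {1..a}" using M by simp
    then show False using that assms(8) unfolding unmixed_def associated_eq_minimal by auto
  qed
  have unmixed_b: "b = 0" if "unmixed R"
  proof (rule ccontr)
    assume "b \<noteq> 0"
    then have "1 \<in> {1..b}" by simp
    then show False using assms(9)[of 1] pM[of 1] that unfolding unmixed_def associated_eq_minimal by simp
  qed
  \<comment> \<open>A lower-dimensional minimal prime would have dimension 0 and so contain
    \<open>q 1\<close>, against minimality.\<close>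
  have b0: "b = 0" if k1: "krull_dim R = 1"
  proof (rule ccontr)
    assume "b \<noteq> 0"
    then have one: "1 \<in> {1..b}" by simp
    have "qdim (p 1) < 1" using assms(9)[OF one] kp[OF one] k1 by simp
    from hprime_kd_zero[OF hprime_M[OF pM[OF one]] this hprime_M[OF q1]] have "q 1 = p 1"
      using M_minimal[OF pM[OF one]] hprime_M[OF q1] by blast
    then show False using qp[of 1 1] one assms(3) by simp
  qed
  have lower_q: "?e (q 1) \<le> (\<Sum>P\<in>nonvan B. ?e P)" if "i \<in> {1..a}" "q i \<in> nonvan B" for i B
    using sum_eP_ge[OF d nonvan_M[OF d] that(2)] qmin[OF that(1)] by simp
  have all_q: "qdim P = krull_dim R" "\<exists>i\<in>{1..a}. P = q i" if "b = 0" "P \<in> \<M>" for P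
    using that M kq by auto

  \<comment> \<open>A single lower-dimensional component with unbounded Hilbert function has room
    for \<open>l\<close> forms and weight 0.\<close>
  have item1: "gmd_stable R G l = 0" if j: "j \<in> {1..b}" "krull_dim (R Quot p j) \<ge> 2" for j
  proof (rule gmd_stable_subset[OF d])
    show "{p j} \<subset> \<M>" using pM[OF j(1)] q1 qp[of 1 j] j(1) assms(3) by auto
    show "eventually (\<lambda>t. l \<le> dm (off {p j} t)) sequentially"
      by (rule dm_U_unbounded[OF pM[OF j(1)]]) (use j kp in simp)
    show "(\<Sum>P\<in>{p j}. ?e P) = 0" using ep0[OF j(1)] by simp
    show "0 \<le> (\<Sum>P\<in>nonvan B. ?e P)" for B by (rule sum_eP_nonneg[OF d nonvan_M[OF d]])
  qed

  have item2: "gmd_stable R G l = e_ring R G" if dom: "domain R"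
    by (rule gmd_stable_empty[OF d gmd_family_domain[OF dom l]])

  have item3: "gmd_stable R G l = ?e (q 1)" if un: "unmixed R" and k2: "krull_dim R \<ge> 2"
  proof (cases "a = 1")
    \<comment> \<open>With one component there is no nonempty proper set of components, so no family
      exists; the default value is the multiplicity of \<open>R\<close>, which here is that of
      \<open>q 1\<close>.\<close>
    case True
    have M1: "\<M> = {q 1}" using M unmixed_b[OF un] True by simp
    have "gmd_stable R G l = e_ring R G"
    proof (rule gmd_stable_empty[OF d])
      show "gmd_family R G t l = {}" for t
        using gmd_family_props(1,2)[of _ t l] l M1 by (metis equals0I subset_singletonD psubsetE)
    qed
    then show ?thesis using e_ring_sum[OF d] M1 by simp
  next
    case False
    show ?thesis
    proof (rule gmd_stable_subset[OF d])
      have "2 \<in> {1..a}" "q 2 \<noteq> q 1" using False assms(3) inj_onD[OF assms(5), of 2 1] by auto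
      then show "{q 1} \<subset> \<M>" using q1 qM[of 2] by auto
      show "eventually (\<lambda>t. l \<le> dm (off {q 1} t)) sequentially"
        by (rule dm_U_unbounded[OF q1]) (use kq[of 1] k2 assms(3) in simp)
      show "?e (q 1) \<le> (\<Sum>P\<in>nonvan B. ?e P)" if B: "B \<in> gmd_family R G t l" for t B
      proof -
        obtain P where P: "P \<in> nonvan B" using gmd_family_props(1)[OF B l] by blast
        then obtain i where "i \<in> {1..a}" "P = q i" using all_q(2)[OF unmixed_b[OF un]] nonvan_M[OF d] by blast
        then show ?thesis using lower_q P by blast
      qed
    qed simp
  qed

  have dim1: "d = 1" "\<And>P. P \<in> \<M> \<Longrightarrow> qdim P = 1" "\<And>P. P \<in> \<M> \<Longrightarrow> ?e P = gcoeff P"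
    if k1: "krull_dim R = 1"
  proof -
    show d1: "d = 1" using d k1 by (simp add: one_enat_def)
    show k: "qdim P = 1" if "P \<in> \<M>" for P using all_q(1)[OF b0[OF k1] that] k1 by simp
    show "?e P = gcoeff P" if "P \<in> \<M>" for P using e_prime_M[OF d that] k[OF that] d1 by (simp add: top_coeff_def one_enat_def)
  qed
  have sumq: "(\<Sum>i\<in>\<sigma>. ?e (q i)) = (\<Sum>P\<in>q ` \<sigma>. ?e P)" if "\<sigma> \<subseteq> {1..a}" for \<sigma>
    using sum.reindex[of q \<sigma> ?e] inj_on_subset[OF assms(5) that] by simp
  \<comment> \<open>In dimension 1 the weight of a component is also the number of independent forms
    it can carry.\<close>
  have value1: "real l \<le> (\<Sum>P\<in>nonvan B. ?e P)" if k1: "krull_dim R = 1" and B: "B \<in> gmd_family R G t l" for t B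
  proof -
    have nM: "P \<in> \<M>" if "P \<in> nonvan B" for P using nonvan_M[OF d] that by blast
    have "real l \<le> (\<Sum>P\<in>nonvan B. gcoeff P)" by (rule gmd_family_dim1[OF B l]) (use dim1(2)[OF k1] nM in blast)
    also have "\<dots> = (\<Sum>P\<in>nonvan B. ?e P)" by (rule sum.cong) (use dim1(3)[OF k1] nM in auto)
    finally show ?thesis .
  qed

  have item4: "gmd_stable R G l =
      Min {(\<Sum>i\<in>\<sigma>. ?e (q i)) | \<sigma>. \<sigma> \<subset> {1..a} \<and> real l \<le> (\<Sum>i\<in>\<sigma>. ?e (q i))}" (is "_ = Min ?S")
    if k1: "krull_dim R = 1" and le: "real l \<le> e_ring R G - ?e (q 1)"
  proof -
    have Mq: "\<M> = q ` {1..a}" using M b0[OF k1] by simp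
    have fS: "finite ?S"
    proof (rule finite_subset)
      show "finite ((\<lambda>\<sigma>. \<Sum>i\<in>\<sigma>. ?e (q i)) ` Pow {1..a})" by simp
      show "?S \<subseteq> (\<lambda>\<sigma>. \<Sum>i\<in>\<sigma>. ?e (q i)) ` Pow {1..a}"
      proof
        fix y assume "y \<in> ?S"
        then have "\<exists>\<sigma>. y = (\<Sum>i\<in>\<sigma>. ?e (q i)) \<and> \<sigma> \<subset> {1..a} \<and> real l \<le> (\<Sum>i\<in>\<sigma>. ?e (q i))"
          by (simp only: mem_Collect_eq)
        then obtain \<sigma> where "y = (\<Sum>i\<in>\<sigma>. ?e (q i))" "\<sigma> \<subset> {1..a}" "real l \<le> (\<Sum>i\<in>\<sigma>. ?e (q i))"
          by (elim exE conjE)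
        then show "y \<in> (\<lambda>\<sigma>. \<Sum>i\<in>\<sigma>. ?e (q i)) ` Pow {1..a}" by (intro image_eqI[of _ _ \<sigma>]) (simp_all only: Pow_iff psubset_imp_subset)
      qed
    qed
    \<comment> \<open>The hypothesis on \<open>l\<close> says that omitting a component of least
      multiplicity leaves enough room, so \<open>Min\<close> is taken over a nonempty set.\<close>
    have "(\<Sum>i\<in>{1..a} - {1}. ?e (q i)) \<in> ?S"
    proof (intro CollectI exI[of _ "{1..a} - {1}"] conjI refl)
      have "1 \<in> {1..a}" using assms(3) by simp
      then show "{1..a} - {1} \<subset> {1..a}" by blast
      have "(\<Sum>i\<in>{1..a} - {1}. ?e (q i)) = (\<Sum>i\<in>{1..a}. ?e (q i)) - ?e (q 1)"
        using assms(3) by (subst sum_diff1) auto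
      then show "real l \<le> (\<Sum>i\<in>{1..a} - {1}. ?e (q i))"
        using le e_ring_sum[OF d] sumq[of "{1..a}"] Mq by simp
    qed
    then have "?S \<noteq> {}" by blast
    from Min_in[OF fS this] have "\<exists>\<sigma>. Min ?S = (\<Sum>i\<in>\<sigma>. ?e (q i)) \<and> \<sigma> \<subset> {1..a} \<and>
      real l \<le> (\<Sum>i\<in>\<sigma>. ?e (q i))" by (simp only: mem_Collect_eq)
    then obtain \<sigma> where s: "Min ?S = (\<Sum>i\<in>\<sigma>. ?e (q i))" "\<sigma> \<subset> {1..a}"
      "real l \<le> (\<Sum>i\<in>\<sigma>. ?e (q i))" by (elim exE conjE)
    have ss: "\<sigma> \<subseteq> {1..a}" using s(2) by blast
    show ?thesis
    proof (rule gmd_stable_subset[OF d])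
      show tM: "q ` \<sigma> \<subset> \<M>"
        unfolding Mq using s(2) inj_on_image_eq_iff[OF assms(5) ss subset_refl] image_mono[OF ss, of q] by blast
      have "(\<Sum>P\<in>q ` \<sigma>. gcoeff P) = (\<Sum>P\<in>q ` \<sigma>. ?e P)"
        by (rule sum.cong) (use dim1(3)[OF k1] tM in auto)
      then show "eventually (\<lambda>t. l \<le> dm (off (q ` \<sigma>) t)) sequentially"
        using s(3) sumq[OF ss] tM dim1(2)[OF k1] by (intro dm_U_dim1) auto
      show "(\<Sum>P\<in>q ` \<sigma>. ?e P) = Min ?S" using s(1) sumq[OF ss] by simp
      show "Min ?S \<le> (\<Sum>P\<in>nonvan B. ?e P)" if B: "B \<in> gmd_family R G t l" for t B
      proof (rule Min_le[OF fS])
        \<comment> \<open>The indices of \<open>nonvan B\<close>; a proper subset, because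
          \<open>B\<close> has a nonzero annihilator.\<close>
        define \<rho> where "\<rho> = {i \<in> {1..a}. q i \<in> nonvan B}"
        have r: "q ` \<rho> = nonvan B"
        proof
          show "nonvan B \<subseteq> q ` \<rho>"
          proof
            fix P assume P: "P \<in> nonvan B"
            then obtain i where "i \<in> {1..a}" "P = q i" using nonvan_M[OF d, of B] Mq by blast
            then show "P \<in> q ` \<rho>" using P by (simp add: \<rho>_def)
          qed
        qed (auto simp: \<rho>_def)
        have rs: "\<rho> \<subseteq> {1..a}" by (auto simp: \<rho>_def)
        have "\<rho> \<noteq> {1..a}" using gmd_family_props(2)[OF B l] r Mq by auto
        then have "\<rho> \<subset> {1..a}" using rs by blast
        moreover have "(\<Sum>i\<in>\<rho>. ?e (q i)) = (\<Sum>P\<in>nonvan B. ?e P)" using sumq[OF rs] r by simp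
        ultimately show "(\<Sum>P\<in>nonvan B. ?e P) \<in> ?S" using value1[OF k1 B]
          by (intro CollectI exI[of _ \<rho>]) simp
      qed
    qed
  qed

  \<comment> \<open>A family vanishes on some component, so its value is at most the multiplicity of
    \<open>R\<close> minus the least one, hence below \<open>l\<close>; but \<open>value1\<close>
    makes it at least \<open>l\<close>.\<close>
  have item5: "gmd_stable R G l = e_ring R G"
    if k1: "krull_dim R = 1" and gt: "real l > e_ring R G - ?e (q 1)"
  proof (rule gmd_stable_empty[OF d])
    fix t
    show "gmd_family R G t l = {}"
    proof (rule ccontr)
      assume "gmd_family R G t l \<noteq> {}"
      then obtain A where A: "A \<in> gmd_family R G t l" by blast
      obtain P where P: "P \<in> \<M>" "P \<notin> nonvan A" using gmd_family_props(2)[OF A l] by blast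
      obtain i where i: "i \<in> {1..a}" "P = q i" using all_q(2)[OF b0[OF k1] P(1)] by blast
      have "(\<Sum>P\<in>nonvan A. ?e P) \<le> (\<Sum>P\<in>\<M> - {P}. ?e P)"
        by (rule sum_mono2) (use M_basic(1) nonvan_M[OF d] P e_prime_nonneg[OF d] in auto)
      also have "\<dots> = e_ring R G - ?e P"
        using P(1) M_basic(1) e_ring_sum[OF d] by (simp add: sum_diff1)
      finally show False using value1[OF k1 A] gt qmin[OF i(1)] i(2) by simp
    qed
  qed

  have eT: "?eT = (\<Sum>P\<in>p ` {1..b}. gcoeff P)"
    "\<And>P. P \<in> p ` {1..b} \<Longrightarrow> qdim P = 1"
    if mx: "mixed R" and k1: "\<forall>j\<in>{1..b}. krull_dim (R Quot p j) = 1"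
  proof -
    have sub: "p ` {1..b} \<subseteq> \<M>" "p ` {1..b} \<noteq> {}" using pM mixed_b[OF mx] by auto
    show k: "qdim P = 1" if "P \<in> p ` {1..b}" for P using that kp k1 by auto
    show "?eT = (\<Sum>P\<in>p ` {1..b}. gcoeff P)"
      by (rule e_ring_INT_dim1[OF sub k])
  qed

  \<comment> \<open>The lower-dimensional components together have room for \<open>?eT\<close> forms
    and weight 0.\<close>
  have item6: "gmd_stable R G l = 0"
    if mx: "mixed R" and k1: "\<forall>j\<in>{1..b}. krull_dim (R Quot p j) = 1"
      and le: "real l \<le> ?eT"
  proof (rule gmd_stable_subset[OF d])
    have "q 1 \<noteq> p j" if "j \<in> {1..b}" for j using qp[OF _ that, of 1] assms(3) by simp
    then have "q 1 \<notin> p ` {1..b}" by blast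
    then show "p ` {1..b} \<subset> \<M>" using pM q1 by blast
    then show "eventually (\<lambda>t. l \<le> dm (off (p ` {1..b}) t)) sequentially"
      using eT[OF mx k1] le by (intro dm_U_dim1) auto
    show "(\<Sum>P\<in>p ` {1..b}. ?e P) = 0" using ep0 by (intro sum.neutral) auto
    show "0 \<le> (\<Sum>P\<in>nonvan B. ?e P)" for B by (rule sum_eP_nonneg[OF d nonvan_M[OF d]])
  qed

  have item7: "gmd_stable R G l = ?e (q 1)"
    if mx: "mixed R" and k1: "\<forall>j\<in>{1..b}. krull_dim (R Quot p j) = 1"
      and gt: "real l > ?eT"
  proof (rule gmd_stable_subset[OF d])
    have b1: "1 \<in> {1..b}" using mixed_b[OF mx] by simp
    show "{q 1} \<subset> \<M>" using q1 pM[OF b1] qp[of 1 1] b1 assms(3) by auto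
    \<comment> \<open>A component of dimension 1 that is not top-dimensional forces dimension at
      least 2, so \<open>q 1\<close> alone has room for any \<open>l\<close>.\<close>
    have "1 < krull_dim R" using assms(9)[OF b1] k1 b1 by simp
    then have "2 \<le> qdim (q 1)" using kq[of 1] assms(3) d by (simp add: one_enat_def numeral_eq_enat)
    then show "eventually (\<lambda>t. l \<le> dm (off {q 1} t)) sequentially" by (rule dm_U_unbounded[OF q1])
    show "?e (q 1) \<le> (\<Sum>P\<in>nonvan B. ?e P)" if B: "B \<in> gmd_family R G t l" for t B
    proof -
      \<comment> \<open>The components \<open>p j\<close> have room for at most \<open>?eT\<close>
        forms, fewer than \<open>l\<close>, so every family is nonzero on some
        \<open>q i\<close>.\<close>
      have "\<not> nonvan B \<subseteq> p ` {1..b}"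
      proof
        assume s: "nonvan B \<subseteq> p ` {1..b}"
        have "real l \<le> (\<Sum>P\<in>nonvan B. gcoeff P)"
          by (rule gmd_family_dim1[OF B l]) (use s eT(2)[OF mx k1] in blast)
        also have "\<dots> \<le> (\<Sum>P\<in>p ` {1..b}. gcoeff P)"
          by (rule sum_mono2) (use s pM gcoeff_props(3)[OF hprime_M] in \<open>auto intro: less_imp_le\<close>)
        finally show False using eT(1)[OF mx k1] gt by simp
      qed
      then obtain P where "P \<in> nonvan B" "P \<notin> p ` {1..b}" by blast
      moreover from this have "P \<in> q ` {1..a}" using nonvan_M[OF d, of B] M by auto
      ultimately obtain i where "i \<in> {1..a}" "q i \<in> nonvan B" by auto
      then show ?thesis by (rule lower_q)
    qed
  qed simp

  show ?thesis using item1 item2 item3 item4 item5 item6 item7 by blast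
qed

end
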